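(* Let $\mathcal V$ be a closed monoidal category and let $\mathcal C$ be a tensored $\mathcal V$-category. The following are equivalent: (1) Every $\mathcal V$-representable functor $\mathcal R^a=\mathcal C(a\to-):\mathcal C\to\widehat{\mathcal V}$ is tensored. (2) The $\mathcal V$-functor $\mathcal I:\mathcal C\to\overline{\mathcal C}$ is tensored. (3) The $\mathcal V$-functor $\mathcal I:\mathcal C\to\overline{\mathcal C}$ witnesses a $\mathcal V$-equivalence.
   Context: Conventions: composition is written left to right; tensor products in $\mathcal V$ are juxtaposition; associators and unitors are suppressed; "mate" means the morphism corresponding under the indicated adjunction. A $\mathcal V$-category $\mathcal C$ has hom objects $\mathcal C(a\to b)\in\mathcal V$, identities $j_a:1_{\mathcal V}\to\mathcal C(a\to a)$ and composition $-\circ_{\mathcal C}-:\mathcal C(a\to b)\mathcal C(b\to c)\to\mathcal C(a\to c)$, associative and unital. A $\mathcal V$-functor $F$ has morphisms $F_{a\to b}:\mathcal C(a\to b)\to\mathcal D(F(a)\to F(b))$ compatible with composition and identities. The underlying category $\mathcal C^{\mathcal V}$ has $\mathcal C^{\mathcal V}(a\to b)=\mathcal V(1_{\mathcal V}\to\mathcal C(a\to b))$. $\mathcal V$ closed: internal homs $\widehat{\mathcal V}(u\to v)$ satisfy $\mathcal V(uw\to v)\cong\mathcal V(w\to\widehat{\mathcal V}(u\to v))$, with $\varepsilon^{\widehat{\mathcal V}}_{u\to v}:u\widehat{\mathcal V}(u\to v)\to v$ the mate of the identity. $\widehat{\mathcal V}$ is the self-enriched $\mathcal V$-category, with composition the mate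 of $(\varepsilon^{\widehat{\mathcal V}}_{u\to v}\mathrm{id})\circ\varepsilon^{\widehat{\mathcal V}}_{v\to w}$; its underlying category is identified with $\mathcal V$. $\mathcal R^a:\mathcal C\to\widehat{\mathcal V}$ is $b\mapsto\mathcal C(a\to b)$, with action $\mathcal C(b\to c)\to\widehat{\mathcal V}(\mathcal C(a\to b)\to\mathcal C(a\to c))$ the mate of $-\circ_{\mathcal C}-$. $\mathcal C$ is tensored if every $\mathcal R^a$ has a left $\mathcal V$-adjoint $\mathcal L^a$, i.e. a $\mathcal V$-functor with isomorphisms $\mathcal C(\mathcal L^a(v)\to b)\cong\widehat{\mathcal V}(v\to\mathcal C(a\to b))$ in $\mathcal V$ that are $\mathcal V$-natural in both variables. Write $a\vartriangleleft v=\mathcal L^a(v)$; then $\mathcal C^{\mathcal V}(a\vartriangleleft v\to b)\cong\mathcal V(v\to\mathcal C(a\to b))$, with unit $\eta^{\mathcal C}_{a,v}:v\to\mathcal C(a\to a\vartriangleleft v)$. For $\widehat{\mathcal V}$ itself, $u\vartriangleleft v=uv$. A $\mathcal V$-functor $F:\mathcal C\to\mathcal D$ of tensored $\mathcal V$-categories is tensored if for all $c\in\mathcal C$, $v\in\mathcal V$ the morphism $\mu^F_{c,v}\in\mathcal D^{\mathcal V}(F(c)\vartriangleleft v\to F(c\vartriangleleft v))$, defined as the mate of $\eta^{\mathcal C}_{c,v}\circ F_{c\to c\vartriangleleft v}\in\mathcal V(v\to\mathcal D(F(c)\to F(c\vartriangleleft v)))$, is an isomorphism. Completion: $\overline{\mathcal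 C}$ is the $\mathcal V$-category with objects formal symbols $a\blacktriangleleft u$ ($a\in\mathcal C$, $u\in\mathcal V$), hom objects $\overline{\mathcal C}(a\blacktriangleleft u\to b\blacktriangleleft v)=\widehat{\mathcal V}(u\to\mathcal C(a\to b)v)$, identity $j_{a\blacktriangleleft u}$ the mate of $j_a\mathrm{id}_u$, and composition the mate of $(\varepsilon^{\widehat{\mathcal V}}_{u\to\mathcal C(a\to b)v}\mathrm{id})\circ(\mathrm{id}_{\mathcal C(a\to b)}\varepsilon^{\widehat{\mathcal V}}_{v\to\mathcal C(b\to c)w})\circ((-\circ_{\mathcal C}-)\mathrm{id}_w)$. It is tensored with $(a\blacktriangleleft u)\vartriangleleft v=a\blacktriangleleft uv$. The $\mathcal V$-functor $\mathcal I:\mathcal C\to\overline{\mathcal C}$ is $a\mapsto a\blacktriangleleft1_{\mathcal V}$ with $\mathcal I_{a\to b}:\mathcal C(a\to b)\to\widehat{\mathcal V}(1_{\mathcal V}\to\mathcal C(a\to b))$ the mate of $\mathrm{id}_{\mathcal C(a\to b)}$. A $\mathcal V$-functor witnesses a $\mathcal V$-equivalence if it has an inverse $\mathcal V$-functor up to $\mathcal V$-natural isomorphism. *)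

theory Defs
  imports Main
begin

text \<open>
  Composition is written from left to right throughout: \<open>f \<cdot> g\<close> is ``first \<open>f\<close>, then \<open>g\<close>''.
  Associators and unitors are explicit; neither strictness nor a symmetry or braiding is assumed.
\<close>

section \<open>Closed monoidal categories\<close>

record ('o, 'm) category =
  objs :: "'o set"
  arrs :: "'m set"
  src :: "'m \<Rightarrow> 'o"
  trg :: "'m \<Rightarrow> 'o"
  idn :: "'o \<Rightarrow> 'm" ("\<i>\<d>\<index>")
  cmp :: "'m \<Rightarrow> 'm \<Rightarrow> 'm" (infixl "\<cdot>\<index>" 55)

definition hom :: "('o, 'm, 'x) category_scheme \<Rightarrow> 'o \<Rightarrow> 'o \<Rightarrow> 'm set" where
  "hom V u v = {f \<in> arrs V. src V f = u \<and> trg V f = v}"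

locale category =
  fixes V :: "('o, 'm, 'x) category_scheme" (structure)
  assumes src_closed: "f \<in> arrs V \<Longrightarrow> src V f \<in> objs V"
    and trg_closed: "f \<in> arrs V \<Longrightarrow> trg V f \<in> objs V"
    and idn_hom: "u \<in> objs V \<Longrightarrow> \<i>\<d> u \<in> hom V u u"
    and cmp_hom: "f \<in> hom V u v \<Longrightarrow> g \<in> hom V v w \<Longrightarrow> f \<cdot> g \<in> hom V u w"
    and idn_cmp: "f \<in> hom V u v \<Longrightarrow> \<i>\<d> u \<cdot> f = f"
    and cmp_idn: "f \<in> hom V u v \<Longrightarrow> f \<cdot> \<i>\<d> v = f"
    and cmp_assoc: "f \<in> hom V u v \<Longrightarrow> g \<in> hom V v w \<Longrightarrow> h \<in> hom V w x \<Longrightarrow>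
      (f \<cdot> g) \<cdot> h = f \<cdot> (g \<cdot> h)"

definition inverse_arrows :: "('o, 'm, 'x) category_scheme \<Rightarrow> 'm \<Rightarrow> 'm \<Rightarrow> bool" where
  "inverse_arrows V f g \<longleftrightarrow>
     f \<in> hom V (src V f) (trg V f) \<and> g \<in> hom V (trg V f) (src V f) \<and>
     f \<cdot>\<^bsub>V\<^esub> g = \<i>\<d>\<^bsub>V\<^esub> (src V f) \<and> g \<cdot>\<^bsub>V\<^esub> f = \<i>\<d>\<^bsub>V\<^esub> (trg V f)"

definition is_iso :: "('o, 'm, 'x) category_scheme \<Rightarrow> 'm \<Rightarrow> bool" where
  "is_iso V f \<longleftrightarrow> (\<exists>g. inverse_arrows V f g)"

definition inv_arr :: "('o, 'm, 'x) category_scheme \<Rightarrow> 'm \<Rightarrow> 'm" where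
  "inv_arr V f = (THE g. inverse_arrows V f g)"

text \<open>The tensor product is \<open>\<odot>\<close> on objects and \<open>\<otimes>\<close> on arrows.\<close>

record ('o, 'm) monoidal_category = "('o, 'm) category" +
  one :: "'o" ("\<one>\<index>")
  tobj :: "'o \<Rightarrow> 'o \<Rightarrow> 'o" (infixl "\<odot>\<index>" 70)
  tarr :: "'m \<Rightarrow> 'm \<Rightarrow> 'm" (infixl "\<otimes>\<index>" 70)
  assoc :: "'o \<Rightarrow> 'o \<Rightarrow> 'o \<Rightarrow> 'm"
  lunit :: "'o \<Rightarrow> 'm"
  runit :: "'o \<Rightarrow> 'm"

locale monoidal_category = category V
  for V :: "('o, 'm, 'x) monoidal_category_scheme" (structure) +
  assumes one_obj: "\<one> \<in> objs V"
    and tobj_obj: "u \<in> objs V \<Longrightarrow> v \<in> objs V \<Longrightarrow> u \<odot> v \<in> objs V"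
    and tarr_hom: "f \<in> hom V u v \<Longrightarrow> g \<in> hom V u' v' \<Longrightarrow> f \<otimes> g \<in> hom V (u \<odot> u') (v \<odot> v')"
    and tarr_idn: "u \<in> objs V \<Longrightarrow> v \<in> objs V \<Longrightarrow> \<i>\<d> u \<otimes> \<i>\<d> v = \<i>\<d> (u \<odot> v)"
    and interchange: "f \<in> hom V u v \<Longrightarrow> g \<in> hom V v w \<Longrightarrow> f' \<in> hom V u' v' \<Longrightarrow> g' \<in> hom V v' w' \<Longrightarrow>
      (f \<cdot> g) \<otimes> (f' \<cdot> g') = (f \<otimes> f') \<cdot> (g \<otimes> g')"
    and assoc_hom: "u \<in> objs V \<Longrightarrow> v \<in> objs V \<Longrightarrow> w \<in> objs V \<Longrightarrow>
      assoc V u v w \<in> hom V ((u \<odot> v) \<odot> w) (u \<odot> (v \<odot> w))"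
    and assoc_iso: "u \<in> objs V \<Longrightarrow> v \<in> objs V \<Longrightarrow> w \<in> objs V \<Longrightarrow> is_iso V (assoc V u v w)"
    and assoc_nat: "f \<in> hom V u u' \<Longrightarrow> g \<in> hom V v v' \<Longrightarrow> h \<in> hom V w w' \<Longrightarrow>
      ((f \<otimes> g) \<otimes> h) \<cdot> assoc V u' v' w' = assoc V u v w \<cdot> (f \<otimes> (g \<otimes> h))"
    and lunit_hom: "u \<in> objs V \<Longrightarrow> lunit V u \<in> hom V (\<one> \<odot> u) u"
    and lunit_iso: "u \<in> objs V \<Longrightarrow> is_iso V (lunit V u)"
    and lunit_nat: "f \<in> hom V u v \<Longrightarrow> (\<i>\<d> \<one> \<otimes> f) \<cdot> lunit V v = lunit V u \<cdot> f"
    and runit_hom: "u \<in> objs V \<Longrightarrow> runit V u \<in> hom V (u \<odot> \<one>) u"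
    and runit_iso: "u \<in> objs V \<Longrightarrow> is_iso V (runit V u)"
    and runit_nat: "f \<in> hom V u v \<Longrightarrow> (f \<otimes> \<i>\<d> \<one>) \<cdot> runit V v = runit V u \<cdot> f"
    and pentagon: "u \<in> objs V \<Longrightarrow> v \<in> objs V \<Longrightarrow> w \<in> objs V \<Longrightarrow> x \<in> objs V \<Longrightarrow>
      (assoc V u v w \<otimes> \<i>\<d> x) \<cdot> assoc V u (v \<odot> w) x \<cdot> (\<i>\<d> u \<otimes> assoc V v w x) =
      assoc V (u \<odot> v) w x \<cdot> assoc V u v (w \<odot> x)"
    and triangle: "u \<in> objs V \<Longrightarrow> v \<in> objs V \<Longrightarrow>
      assoc V u \<one> v \<cdot> (\<i>\<d> u \<otimes> lunit V v) = runit V u \<otimes> \<i>\<d> v"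

text \<open>
  \<open>ihom V u v\<close> is the internal hom from \<open>u\<close> to \<open>v\<close>, and \<open>mate V u w v\<close> is the adjunction bijection
  from \<open>hom V (u \<odot> w) v\<close> to \<open>hom V w (ihom V u v)\<close>, natural in \<open>w\<close>: for each \<open>u\<close>, the functor
  \<open>u \<odot> _\<close> has a right adjoint. The action of \<open>ihom V u\<close> on arrows is determined by naturality in \<open>v\<close>,
  so it is not part of the data. Nothing is assumed about \<open>_ \<odot> u\<close>.
\<close>

record ('o, 'm) closed_monoidal_category = "('o, 'm) monoidal_category" +
  ihom :: "'o \<Rightarrow> 'o \<Rightarrow> 'o"
  mate :: "'o \<Rightarrow> 'o \<Rightarrow> 'o \<Rightarrow> 'm \<Rightarrow> 'm"

locale closed_monoidal_category = monoidal_category V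
  for V :: "('o, 'm) closed_monoidal_category" (structure) +
  assumes ihom_obj: "u \<in> objs V \<Longrightarrow> v \<in> objs V \<Longrightarrow> ihom V u v \<in> objs V"
    and mate_bij: "u \<in> objs V \<Longrightarrow> w \<in> objs V \<Longrightarrow> v \<in> objs V \<Longrightarrow>
      bij_betw (mate V u w v) (hom V (u \<odot> w) v) (hom V w (ihom V u v))"
    and mate_nat: "u \<in> objs V \<Longrightarrow> v \<in> objs V \<Longrightarrow> g \<in> hom V w' w \<Longrightarrow> f \<in> hom V (u \<odot> w) v \<Longrightarrow>
      mate V u w' v ((\<i>\<d> u \<otimes> g) \<cdot> f) = g \<cdot> mate V u w v f"

definition unmate :: "('o, 'm) closed_monoidal_category \<Rightarrow> 'o \<Rightarrow> 'o \<Rightarrow> 'o \<Rightarrow> 'm \<Rightarrow> 'm" where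
  "unmate V u w v = the_inv_into (hom V (u \<odot>\<^bsub>V\<^esub> w) v) (mate V u w v)"

definition ev :: "('o, 'm) closed_monoidal_category \<Rightarrow> 'o \<Rightarrow> 'o \<Rightarrow> 'm" where
  "ev V u v = unmate V u (ihom V u v) v (\<i>\<d>\<^bsub>V\<^esub> (ihom V u v))"


section \<open>Enriched categories, functors and natural isomorphisms\<close>

record ('a, 'o, 'm) enriched_category =
  eobjs :: "'a set"
  ehom :: "'a \<Rightarrow> 'a \<Rightarrow> 'o"
  eid :: "'a \<Rightarrow> 'm"
  ecmp :: "'a \<Rightarrow> 'a \<Rightarrow> 'a \<Rightarrow> 'm"

locale enriched_category = closed_monoidal_category V
  for V :: "('o, 'm) closed_monoidal_category" (structure) +
  fixes C :: "('a, 'o, 'm) enriched_category"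
  assumes ehom_obj: "a \<in> eobjs C \<Longrightarrow> b \<in> eobjs C \<Longrightarrow> ehom C a b \<in> objs V"
    and eid_hom: "a \<in> eobjs C \<Longrightarrow> eid C a \<in> hom V \<one> (ehom C a a)"
    and ecmp_hom: "a \<in> eobjs C \<Longrightarrow> b \<in> eobjs C \<Longrightarrow> c \<in> eobjs C \<Longrightarrow>
      ecmp C a b c \<in> hom V (ehom C a b \<odot> ehom C b c) (ehom C a c)"
    and ecmp_assoc: "a \<in> eobjs C \<Longrightarrow> b \<in> eobjs C \<Longrightarrow> c \<in> eobjs C \<Longrightarrow> d \<in> eobjs C \<Longrightarrow>
      (ecmp C a b c \<otimes> \<i>\<d> (ehom C c d)) \<cdot> ecmp C a c d =
      assoc V (ehom C a b) (ehom C b c) (ehom C c d) \<cdot>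
        (\<i>\<d> (ehom C a b) \<otimes> ecmp C b c d) \<cdot> ecmp C a b d"
    and eid_ecmp: "a \<in> eobjs C \<Longrightarrow> b \<in> eobjs C \<Longrightarrow>
      (eid C a \<otimes> \<i>\<d> (ehom C a b)) \<cdot> ecmp C a a b = lunit V (ehom C a b)"
    and ecmp_eid: "a \<in> eobjs C \<Longrightarrow> b \<in> eobjs C \<Longrightarrow>
      (\<i>\<d> (ehom C a b) \<otimes> eid C b) \<cdot> ecmp C a b b = runit V (ehom C a b)"

text \<open>The underlying category: its arrows from \<open>a\<close> to \<open>b\<close> are the arrows \<open>\<one> \<rightarrow> ehom C a b\<close> of \<open>V\<close>.\<close>

definition und_hom :: "('o, 'm) closed_monoidal_category \<Rightarrow> ('a, 'o, 'm) enriched_category \<Rightarrow>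
    'a \<Rightarrow> 'a \<Rightarrow> 'm set" where
  "und_hom V C a b = hom V \<one>\<^bsub>V\<^esub> (ehom C a b)"

definition und_cmp :: "('o, 'm) closed_monoidal_category \<Rightarrow> ('a, 'o, 'm) enriched_category \<Rightarrow>
    'a \<Rightarrow> 'a \<Rightarrow> 'a \<Rightarrow> 'm \<Rightarrow> 'm \<Rightarrow> 'm" where
  "und_cmp V C a b c f g = inv_arr V (lunit V \<one>\<^bsub>V\<^esub>) \<cdot>\<^bsub>V\<^esub> (f \<otimes>\<^bsub>V\<^esub> g) \<cdot>\<^bsub>V\<^esub> ecmp C a b c"

definition und_iso :: "('o, 'm) closed_monoidal_category \<Rightarrow> ('a, 'o, 'm) enriched_category \<Rightarrow>
    'a \<Rightarrow> 'a \<Rightarrow> 'm \<Rightarrow> bool" where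
  "und_iso V C a b f \<longleftrightarrow> f \<in> und_hom V C a b \<and>
     (\<exists>g \<in> und_hom V C b a. und_cmp V C a b a f g = eid C a \<and> und_cmp V C b a b g f = eid C b)"

record ('a, 'b, 'm) enriched_functor =
  fobj :: "'a \<Rightarrow> 'b"
  farr :: "'a \<Rightarrow> 'a \<Rightarrow> 'm"

locale enriched_functor = C: enriched_category V C + D: enriched_category V D
  for V :: "('o, 'm) closed_monoidal_category" (structure)
    and C :: "('a, 'o, 'm) enriched_category"
    and D :: "('b, 'o, 'm) enriched_category" +
  fixes F :: "('a, 'b, 'm) enriched_functor"
  assumes fobj_obj: "a \<in> eobjs C \<Longrightarrow> fobj F a \<in> eobjs D"
    and farr_hom: "a \<in> eobjs C \<Longrightarrow> b \<in> eobjs C \<Longrightarrow>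
      farr F a b \<in> hom V (ehom C a b) (ehom D (fobj F a) (fobj F b))"
    and farr_eid: "a \<in> eobjs C \<Longrightarrow> eid C a \<cdot> farr F a a = eid D (fobj F a)"
    and farr_ecmp: "a \<in> eobjs C \<Longrightarrow> b \<in> eobjs C \<Longrightarrow> c \<in> eobjs C \<Longrightarrow>
      ecmp C a b c \<cdot> farr F a c =
      (farr F a b \<otimes> farr F b c) \<cdot> ecmp D (fobj F a) (fobj F b) (fobj F c)"

definition id_functor :: "('o, 'm) closed_monoidal_category \<Rightarrow> ('a, 'o, 'm) enriched_category \<Rightarrow>
    ('a, 'a, 'm) enriched_functor" where
  "id_functor V C = \<lparr> fobj = (\<lambda>a. a), farr = (\<lambda>a b. \<i>\<d>\<^bsub>V\<^esub> (ehom C a b)) \<rparr>"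

text \<open>\<open>cmp_functor V F G\<close> is ``first \<open>F\<close>, then \<open>G\<close>''.\<close>

definition cmp_functor :: "('o, 'm) closed_monoidal_category \<Rightarrow> ('a, 'b, 'm) enriched_functor \<Rightarrow>
    ('b, 'c, 'm) enriched_functor \<Rightarrow> ('a, 'c, 'm) enriched_functor" where
  "cmp_functor V F G =
     \<lparr> fobj = (\<lambda>a. fobj G (fobj F a)),
       farr = (\<lambda>a b. farr F a b \<cdot>\<^bsub>V\<^esub> farr G (fobj F a) (fobj F b)) \<rparr>"

locale enriched_nat_iso = F: enriched_functor V C D F + G: enriched_functor V C D G
  for V :: "('o, 'm) closed_monoidal_category" (structure)
    and C :: "('a, 'o, 'm) enriched_category"
    and D :: "('b, 'o, 'm) enriched_category"
    and F G :: "('a, 'b, 'm) enriched_functor" +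
  fixes \<theta> :: "'a \<Rightarrow> 'm"
  assumes component_iso: "a \<in> eobjs C \<Longrightarrow> und_iso V D (fobj F a) (fobj G a) (\<theta> a)"
    and naturality: "a \<in> eobjs C \<Longrightarrow> b \<in> eobjs C \<Longrightarrow>
      inv_arr V (runit V (ehom C a b)) \<cdot> (farr F a b \<otimes> \<theta> b) \<cdot>
        ecmp D (fobj F a) (fobj F b) (fobj G b) =
      inv_arr V (lunit V (ehom C a b)) \<cdot> (\<theta> a \<otimes> farr G a b) \<cdot>
        ecmp D (fobj F a) (fobj G a) (fobj G b)"

definition witnesses_equivalence :: "('o, 'm) closed_monoidal_category \<Rightarrow>
    ('a, 'o, 'm) enriched_category \<Rightarrow> ('b, 'o, 'm) enriched_category \<Rightarrow>
    ('a, 'b, 'm) enriched_functor \<Rightarrow> bool" where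
  "witnesses_equivalence V C D F \<longleftrightarrow> enriched_functor V C D F \<and>
     (\<exists>G. enriched_functor V D C G \<and>
       (\<exists>\<theta>. enriched_nat_iso V C C (cmp_functor V F G) (id_functor V C) \<theta>) \<and>
       (\<exists>\<theta>. enriched_nat_iso V D D (cmp_functor V G F) (id_functor V D) \<theta>))"


section \<open>Self-enrichment and representable functors\<close>

definition self_enriched :: "('o, 'm) closed_monoidal_category \<Rightarrow>
    ('o, 'o, 'm) enriched_category" where
  "self_enriched V =
     \<lparr> eobjs = objs V,
       ehom = ihom V,
       eid = (\<lambda>u. mate V u \<one>\<^bsub>V\<^esub> u (runit V u)),
       ecmp = (\<lambda>u v w. mate V u (ihom V u v \<odot>\<^bsub>V\<^esub> ihom V v w) w
         (inv_arr V (assoc V u (ihom V u v) (ihom V v w)) \<cdot>\<^bsub>V\<^esub>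
          (ev V u v \<otimes>\<^bsub>V\<^esub> \<i>\<d>\<^bsub>V\<^esub> (ihom V v w)) \<cdot>\<^bsub>V\<^esub> ev V v w)) \<rparr>"

definition representable :: "('o, 'm) closed_monoidal_category \<Rightarrow> ('a, 'o, 'm) enriched_category \<Rightarrow>
    'a \<Rightarrow> ('a, 'o, 'm) enriched_functor" where
  "representable V C a =
     \<lparr> fobj = (\<lambda>b. ehom C a b),
       farr = (\<lambda>b c. mate V (ehom C a b) (ehom C b c) (ehom C a c) (ecmp C a b c)) \<rparr>"


section \<open>Tensored categories and tensored functors\<close>

text \<open>
  A tensoring is a choice of left adjoints to all representable functors: \<open>ladj T a\<close> is the
  functor \<open>v \<mapsto> a \<lhd> v\<close> and \<open>tiso T a v b\<close> is the isomorphism from \<open>C(a \<lhd> v \<rightarrow> b)\<close> to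
  \<open>ihom V v (C(a \<rightarrow> b))\<close>. As \<open>V\<close> need not be braided there is no opposite of an enriched
  category, so enriched naturality in the contravariant variable \<open>v\<close> is expressed by compatibility
  with the left actions of the hom objects of \<open>V\<close> (on \<open>C(a \<lhd> v \<rightarrow> b)\<close> via \<open>ladj T a\<close>);
  naturality in \<open>b\<close> is expressed in the same style, by the right actions of the hom objects of \<open>C\<close>
  (on \<open>ihom V v (C(a \<rightarrow> b))\<close> via \<open>representable V C a\<close>).
\<close>

record ('a, 'o, 'm) tensoring =
  ladj :: "'a \<Rightarrow> ('o, 'a, 'm) enriched_functor"
  tiso :: "'a \<Rightarrow> 'o \<Rightarrow> 'a \<Rightarrow> 'm"

abbreviation act :: "('a, 'o, 'm) tensoring \<Rightarrow> 'a \<Rightarrow> 'o \<Rightarrow> 'a" where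
  "act T a v \<equiv> fobj (ladj T a) v"

locale tensoring = enriched_category V C
  for V :: "('o, 'm) closed_monoidal_category" (structure)
    and C :: "('a, 'o, 'm) enriched_category" +
  fixes T :: "('a, 'o, 'm) tensoring"
  assumes ladj_functor: "a \<in> eobjs C \<Longrightarrow> enriched_functor V (self_enriched V) C (ladj T a)"
    and tiso_hom: "a \<in> eobjs C \<Longrightarrow> v \<in> objs V \<Longrightarrow> b \<in> eobjs C \<Longrightarrow>
      tiso T a v b \<in> hom V (ehom C (act T a v) b) (ihom V v (ehom C a b))"
    and tiso_iso: "a \<in> eobjs C \<Longrightarrow> v \<in> objs V \<Longrightarrow> b \<in> eobjs C \<Longrightarrow> is_iso V (tiso T a v b)"
    and tiso_nat_right: "a \<in> eobjs C \<Longrightarrow> v \<in> objs V \<Longrightarrow> b \<in> eobjs C \<Longrightarrow> c \<in> eobjs C \<Longrightarrow>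
      ecmp C (act T a v) b c \<cdot> tiso T a v c =
      (tiso T a v b \<otimes> farr (representable V C a) b c) \<cdot>
        ecmp (self_enriched V) v (ehom C a b) (ehom C a c)"
    and tiso_nat_left: "a \<in> eobjs C \<Longrightarrow> u \<in> objs V \<Longrightarrow> v \<in> objs V \<Longrightarrow> b \<in> eobjs C \<Longrightarrow>
      (farr (ladj T a) u v \<otimes> \<i>\<d> (ehom C (act T a v) b)) \<cdot>
        ecmp C (act T a u) (act T a v) b \<cdot> tiso T a u b =
      (\<i>\<d> (ihom V u v) \<otimes> tiso T a v b) \<cdot> ecmp (self_enriched V) u v (ehom C a b)"

text \<open>
  The adjunction between the underlying categories: \<open>tmate V C T a v b\<close> maps \<open>V(v \<rightarrow> C(a \<rightarrow> b))\<close> to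
  \<open>und_hom V C (act T a v) b\<close>, and \<open>tunmate\<close> goes back. They are obtained by applying \<open>V(\<one> \<rightarrow> _)\<close> to
  \<open>tiso\<close> and identifying \<open>V(\<one> \<rightarrow> ihom V v x)\<close> with \<open>V(v \<rightarrow> x)\<close>.
\<close>

definition tmate :: "('o, 'm) closed_monoidal_category \<Rightarrow> ('a, 'o, 'm) enriched_category \<Rightarrow>
    ('a, 'o, 'm) tensoring \<Rightarrow> 'a \<Rightarrow> 'o \<Rightarrow> 'a \<Rightarrow> 'm \<Rightarrow> 'm" where
  "tmate V C T a v b f =
     mate V v \<one>\<^bsub>V\<^esub> (ehom C a b) (runit V v \<cdot>\<^bsub>V\<^esub> f) \<cdot>\<^bsub>V\<^esub> inv_arr V (tiso T a v b)"

definition tunmate :: "('o, 'm) closed_monoidal_category \<Rightarrow> ('a, 'o, 'm) enriched_category \<Rightarrow>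
    ('a, 'o, 'm) tensoring \<Rightarrow> 'a \<Rightarrow> 'o \<Rightarrow> 'a \<Rightarrow> 'm \<Rightarrow> 'm" where
  "tunmate V C T a v b g =
     inv_arr V (runit V v) \<cdot>\<^bsub>V\<^esub> unmate V v \<one>\<^bsub>V\<^esub> (ehom C a b) (g \<cdot>\<^bsub>V\<^esub> tiso T a v b)"

definition tunit :: "('o, 'm) closed_monoidal_category \<Rightarrow> ('a, 'o, 'm) enriched_category \<Rightarrow>
    ('a, 'o, 'm) tensoring \<Rightarrow> 'a \<Rightarrow> 'o \<Rightarrow> 'm" where
  "tunit V C T a v = tunmate V C T a v (act T a v) (eid C (act T a v))"

definition comparison :: "('o, 'm) closed_monoidal_category \<Rightarrow>
    ('a, 'o, 'm) enriched_category \<Rightarrow> ('a, 'o, 'm) tensoring \<Rightarrow>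
    ('b, 'o, 'm) enriched_category \<Rightarrow> ('b, 'o, 'm) tensoring \<Rightarrow>
    ('a, 'b, 'm) enriched_functor \<Rightarrow> 'a \<Rightarrow> 'o \<Rightarrow> 'm" where
  "comparison V C S D T F c v =
     tmate V D T (fobj F c) v (fobj F (act S c v))
       (tunit V C S c v \<cdot>\<^bsub>V\<^esub> farr F c (act S c v))"

locale tensored_functor = S: tensoring V C S + T: tensoring V D T + enriched_functor V C D F
  for V :: "('o, 'm) closed_monoidal_category" (structure)
    and C :: "('a, 'o, 'm) enriched_category" and S :: "('a, 'o, 'm) tensoring"
    and D :: "('b, 'o, 'm) enriched_category" and T :: "('b, 'o, 'm) tensoring"
    and F :: "('a, 'b, 'm) enriched_functor" +
  assumes comparison_iso: "c \<in> eobjs C \<Longrightarrow> v \<in> objs V \<Longrightarrow>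
    und_iso V D (act T (fobj F c) v) (fobj F (act S c v)) (comparison V C S D T F c v)"

text \<open>The canonical isomorphism from \<open>ihom V (u \<odot> v) x\<close> to \<open>ihom V v (ihom V u x)\<close>.\<close>

definition ihom_tensor :: "('o, 'm) closed_monoidal_category \<Rightarrow> 'o \<Rightarrow> 'o \<Rightarrow> 'o \<Rightarrow> 'm" where
  "ihom_tensor V u v x =
     mate V v (ihom V (u \<odot>\<^bsub>V\<^esub> v) x) (ihom V u x)
       (mate V u (v \<odot>\<^bsub>V\<^esub> ihom V (u \<odot>\<^bsub>V\<^esub> v) x) x
         (inv_arr V (assoc V u v (ihom V (u \<odot>\<^bsub>V\<^esub> v) x)) \<cdot>\<^bsub>V\<^esub> ev V (u \<odot>\<^bsub>V\<^esub> v) x))"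

text \<open>The tensoring \<open>u \<lhd> v = u \<odot> v\<close> of the self-enriched category.\<close>

definition self_tensoring :: "('o, 'm) closed_monoidal_category \<Rightarrow> ('o, 'o, 'm) tensoring" where
  "self_tensoring V =
     \<lparr> ladj = (\<lambda>u. \<lparr> fobj = (\<lambda>v. u \<odot>\<^bsub>V\<^esub> v),
         farr = (\<lambda>v w. mate V (u \<odot>\<^bsub>V\<^esub> v) (ihom V v w) (u \<odot>\<^bsub>V\<^esub> w)
           (assoc V u v (ihom V v w) \<cdot>\<^bsub>V\<^esub> (\<i>\<d>\<^bsub>V\<^esub> u \<otimes>\<^bsub>V\<^esub> ev V v w))) \<rparr>),
       tiso = (\<lambda>u v w. ihom_tensor V u v w) \<rparr>"


section \<open>The completion\<close>

text \<open>The pair \<open>(a, u)\<close> stands for the formal symbol with components \<open>a\<close> and \<open>u\<close>.\<close>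

definition completion :: "('o, 'm) closed_monoidal_category \<Rightarrow> ('a, 'o, 'm) enriched_category \<Rightarrow>
    ('a \<times> 'o, 'o, 'm) enriched_category" where
  "completion V C =
     \<lparr> eobjs = eobjs C \<times> objs V,
       ehom = (\<lambda>(a, u) (b, v). ihom V u (ehom C a b \<odot>\<^bsub>V\<^esub> v)),
       eid = (\<lambda>(a, u). mate V u \<one>\<^bsub>V\<^esub> (ehom C a a \<odot>\<^bsub>V\<^esub> u)
         (runit V u \<cdot>\<^bsub>V\<^esub> inv_arr V (lunit V u) \<cdot>\<^bsub>V\<^esub> (eid C a \<otimes>\<^bsub>V\<^esub> \<i>\<d>\<^bsub>V\<^esub> u))),
       ecmp = (\<lambda>(a, u) (b, v) (c, w).
         let p = ihom V u (ehom C a b \<odot>\<^bsub>V\<^esub> v); q = ihom V v (ehom C b c \<odot>\<^bsub>V\<^esub> w)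
         in mate V u (p \<odot>\<^bsub>V\<^esub> q) (ehom C a c \<odot>\<^bsub>V\<^esub> w)
           (inv_arr V (assoc V u p q) \<cdot>\<^bsub>V\<^esub>
            (ev V u (ehom C a b \<odot>\<^bsub>V\<^esub> v) \<otimes>\<^bsub>V\<^esub> \<i>\<d>\<^bsub>V\<^esub> q) \<cdot>\<^bsub>V\<^esub>
            assoc V (ehom C a b) v q \<cdot>\<^bsub>V\<^esub>
            (\<i>\<d>\<^bsub>V\<^esub> (ehom C a b) \<otimes>\<^bsub>V\<^esub> ev V v (ehom C b c \<odot>\<^bsub>V\<^esub> w)) \<cdot>\<^bsub>V\<^esub>
            inv_arr V (assoc V (ehom C a b) (ehom C b c) w) \<cdot>\<^bsub>V\<^esub>
            (ecmp C a b c \<otimes>\<^bsub>V\<^esub> \<i>\<d>\<^bsub>V\<^esub> w))) \<rparr>"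

text \<open>The tensoring \<open>(a, u) \<lhd> v = (a, u \<odot> v)\<close> of the completion.\<close>

definition completion_tensoring :: "('o, 'm) closed_monoidal_category \<Rightarrow>
    ('a, 'o, 'm) enriched_category \<Rightarrow> ('a \<times> 'o, 'o, 'm) tensoring" where
  "completion_tensoring V C =
     \<lparr> ladj = (\<lambda>(a, u). \<lparr> fobj = (\<lambda>v. (a, u \<odot>\<^bsub>V\<^esub> v)),
         farr = (\<lambda>v w. mate V (u \<odot>\<^bsub>V\<^esub> v) (ihom V v w) (ehom C a a \<odot>\<^bsub>V\<^esub> (u \<odot>\<^bsub>V\<^esub> w))
           (assoc V u v (ihom V v w) \<cdot>\<^bsub>V\<^esub> (\<i>\<d>\<^bsub>V\<^esub> u \<otimes>\<^bsub>V\<^esub> ev V v w) \<cdot>\<^bsub>V\<^esub>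
            inv_arr V (lunit V (u \<odot>\<^bsub>V\<^esub> w)) \<cdot>\<^bsub>V\<^esub> (eid C a \<otimes>\<^bsub>V\<^esub> \<i>\<d>\<^bsub>V\<^esub> (u \<odot>\<^bsub>V\<^esub> w)))) \<rparr>),
       tiso = (\<lambda>(a, u) v (b, w). ihom_tensor V u v (ehom C a b \<odot>\<^bsub>V\<^esub> w)) \<rparr>"

definition completion_embedding :: "('o, 'm) closed_monoidal_category \<Rightarrow>
    ('a, 'o, 'm) enriched_category \<Rightarrow> ('a, 'a \<times> 'o, 'm) enriched_functor" where
  "completion_embedding V C =
     \<lparr> fobj = (\<lambda>a. (a, \<one>\<^bsub>V\<^esub>)),
       farr = (\<lambda>a b. mate V \<one>\<^bsub>V\<^esub> (ehom C a b) (ehom C a b \<odot>\<^bsub>V\<^esub> \<one>\<^bsub>V\<^esub>)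
         (lunit V (ehom C a b) \<cdot>\<^bsub>V\<^esub> inv_arr V (runit V (ehom C a b)))) \<rparr>"

end

(*
  Write eta : v -> C(c -> c <| v) for the unit of the tensoring. The comparison of a representable R^a at
  (c, v) corresponds to the arrow (id (x) eta) o : C(a -> c) v -> C(a -> c <| v), so (1) says that all
  these are invertible. The comparison of I at (c, v) corresponds to eta, read as an arrow
  v -> C(c -> c <| v) 1, so (2) says that eta has a two-sided inverse 1 -> C(c <| v -> c) v for Kleisli
  composition. Such an inverse is obtained from the identity of c <| v by inverting the comparison at
  a = c <| v, and conversely composing with it inverts the comparison for every a.

  I is always fully faithful, hence an equivalence if and only if every object of the completion is
  isomorphic to some I(b). If I is tensored, then (a, u) is isomorphic to (a, 1 u) = I(a) <| u, hence to
  I(a <| u). Conversely the comparison I(c) <| v -> I(c <| v) is universal among arrows into objects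
  of the form I(b), hence invertible as soon as I(c) <| v is itself isomorphic to such an object.
*)

theory Submission
  imports Defs
begin

section \<open>Whiskering calculus in a monoidal category\<close>

text \<open>With explicit associators and no braiding, the main cost is coherence, and the proof is
  arranged so that it is paid once. Composites in \<open>V\<close> are normalised as words of
  whiskered arrows, until a pentagon or a law of \<open>C\<close> remains. The self-enrichment and
  the completion are both Kleisli categories of a strong monad with many objects: the identity monad
  on one index, and the monad \<open>ehom C a b \<odot> _\<close> by which \<open>C\<close> acts on
  \<open>V\<close>. Category axioms, tensorings, transposes and underlying isomorphisms are proved
  for the general construction, so the comparisons of the representables and of the embedding are
  computed by one lemma, \<open>tmate_mate\<close>. Hom objects are internal homs, so arrows into
  them are compared after evaluation; underlying arrows act on hom objects through
  \<open>pre\<close> and \<open>post\<close>. In (1) to (2), inverting the comparison at the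
  tensored object yields only one of the two Kleisli equations. The other is obtained by cancelling
  the comparison at \<open>a = c\<close>.\<close>

context category
begin

lemma arrs_idn [simp]: "u \<in> objs V \<Longrightarrow> \<i>\<d> u \<in> arrs V"
  and src_idn [simp]: "u \<in> objs V \<Longrightarrow> src V (\<i>\<d> u) = u"
  and trg_idn [simp]: "u \<in> objs V \<Longrightarrow> trg V (\<i>\<d> u) = u"
  using idn_hom by (auto simp: hom_def)

lemma cmp_typing:
  assumes "f \<in> arrs V" "g \<in> arrs V" "trg V f = src V g"
  shows arrs_cmp [simp]: "f \<cdot> g \<in> arrs V"
    and src_cmp [simp]: "src V (f \<cdot> g) = src V f"
    and trg_cmp [simp]: "trg V (f \<cdot> g) = trg V g"
  using cmp_hom[of f "src V f" "src V g" g "trg V g"] assms by (auto simp: hom_def)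

lemma cmp_assoc' [simp]:
  assumes "f \<in> arrs V" "g \<in> arrs V" "h \<in> arrs V" "trg V f = src V g" "trg V g = src V h"
  shows "f \<cdot> g \<cdot> h = f \<cdot> (g \<cdot> h)"
  using cmp_assoc[of f "src V f" "src V g" g "src V h" h "trg V h"] assms by (auto simp: hom_def)

lemma idn_cmp' [simp]: "f \<in> arrs V \<Longrightarrow> src V f = u \<Longrightarrow> \<i>\<d> u \<cdot> f = f"
  and cmp_idn' [simp]: "f \<in> arrs V \<Longrightarrow> trg V f = u \<Longrightarrow> f \<cdot> \<i>\<d> u = f"
  using idn_cmp cmp_idn by (auto simp: hom_def)

declare src_closed [simp] trg_closed [simp]

text \<open>Simp nests composites to the right, which hides the pattern \<open>f \<cdot> g\<close>
  of an equation whenever more factors follow. Applied with \<open>THEN\<close>, this rule supplies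
  the version of the equation with a tail \<open>h\<close>.\<close>

lemma cmp_extend:
  assumes "f \<cdot> g = k" "f \<in> arrs V" "g \<in> arrs V" "h \<in> arrs V" "trg V f = src V g" "trg V g = src V h"
  shows "f \<cdot> (g \<cdot> h) = k \<cdot> h"
  using assms cmp_assoc' by metis

lemma cmp_extend3:
  assumes "f \<cdot> (g \<cdot> h) = k" "f \<in> arrs V" "g \<in> arrs V" "h \<in> arrs V" "t \<in> arrs V"
    "trg V f = src V g" "trg V g = src V h" "trg V h = src V t"
  shows "f \<cdot> (g \<cdot> (h \<cdot> t)) = k \<cdot> t"
  using cmp_extend[OF assms(1), of t] assms(2-) by simp

lemma inverse_unique:
  assumes "inverse_arrows V f g" "inverse_arrows V f h"
  shows "g = h"
proof -
  have "g \<cdot> f \<cdot> h = g \<cdot> (f \<cdot> h)"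
    using assms by (intro cmp_assoc') (auto simp: inverse_arrows_def hom_def)
  then show ?thesis
    using assms by (auto simp: inverse_arrows_def hom_def)
qed

lemma inv_arr_eq: "inverse_arrows V f g \<Longrightarrow> inv_arr V f = g"
  unfolding inv_arr_def using inverse_unique by blast

lemma iso_inverse:
  assumes "is_iso V f"
  shows "inverse_arrows V f (inv_arr V f)"
  using assms inv_arr_eq unfolding is_iso_def by auto

lemma iso_simps:
  assumes "is_iso V f"
  shows "inv_arr V f \<in> arrs V" "src V (inv_arr V f) = trg V f" "trg V (inv_arr V f) = src V f"
    "f \<cdot> inv_arr V f = \<i>\<d> (src V f)" "inv_arr V f \<cdot> f = \<i>\<d> (trg V f)" "f \<in> arrs V"
  using iso_inverse[OF assms] by (auto simp: inverse_arrows_def hom_def)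

lemma iso_cancel_left:
  assumes "is_iso V f" "f \<cdot> g = f \<cdot> h" "g \<in> arrs V" "h \<in> arrs V" "src V g = trg V f" "src V h = trg V f"
  shows "g = h"
proof -
  have "inv_arr V f \<cdot> (f \<cdot> k) = k" if "k \<in> arrs V" "src V k = trg V f" for k
    using cmp_extend[OF iso_simps(5)[OF assms(1)], of k] that iso_simps(1-3,6)[OF assms(1)] by simp
  from this[of g] this[of h] show ?thesis
    unfolding assms(2) using assms(3-) by simp
qed

lemma iso_cancel_right:
  assumes "is_iso V f" "g \<cdot> f = h \<cdot> f" "g \<in> arrs V" "h \<in> arrs V" "trg V g = src V f" "trg V h = src V f"
  shows "g = h"
proof -
  have "k \<cdot> f \<cdot> inv_arr V f = k" if "k \<in> arrs V" "trg V k = src V f" for k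
    using cmp_assoc'[of k f "inv_arr V f"] that iso_simps[OF assms(1)] by (simp del: cmp_assoc')
  from this[of g] this[of h] show ?thesis
    unfolding assms(2) using assms(3-) by simp
qed

lemma is_isoI:
  assumes "f \<in> arrs V" "g \<in> arrs V" "src V g = trg V f" "trg V g = src V f"
    "f \<cdot> g = \<i>\<d> (src V f)" "g \<cdot> f = \<i>\<d> (trg V f)"
  shows "is_iso V f"
  using assms unfolding is_iso_def inverse_arrows_def hom_def by auto

end

section \<open>Whiskering, naturality and coherence\<close>

context monoidal_category
begin

text \<open>
  Diagrams are written as words of whiskered arrows. The simp rules below move associators to the left
  and slide arrows past each other in a fixed order, so that an equation reduces to a coherence law.
\<close>

definition lw where "lw u f = \<i>\<d> u \<otimes> f"
definition rw where "rw f u = f \<otimes> \<i>\<d> u"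
abbreviation as where "as \<equiv> assoc V"
abbreviation lu where "lu \<equiv> lunit V"
abbreviation ru where "ru \<equiv> runit V"
definition ai where "ai u v w = inv_arr V (assoc V u v w)"
definition li where "li u = inv_arr V (lunit V u)"
definition ri where "ri u = inv_arr V (runit V u)"

declare one_obj [simp] tobj_obj [simp]

lemma assoc_typing [simp]:
  assumes "u \<in> objs V" "v \<in> objs V" "w \<in> objs V"
  shows "as u v w \<in> arrs V" "src V (as u v w) = u \<odot> v \<odot> w" "trg V (as u v w) = u \<odot> (v \<odot> w)"
    "ai u v w \<in> arrs V" "trg V (ai u v w) = u \<odot> v \<odot> w" "src V (ai u v w) = u \<odot> (v \<odot> w)"
    "as u v w \<cdot> ai u v w = \<i>\<d> (u \<odot> v \<odot> w)" "ai u v w \<cdot> as u v w = \<i>\<d> (u \<odot> (v \<odot> w))"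
  using assoc_hom[OF assms] iso_simps[OF assoc_iso[OF assms]] by (simp_all add: hom_def ai_def)

lemma unit_typing [simp]:
  assumes "u \<in> objs V"
  shows "lu u \<in> arrs V" "src V (lu u) = \<one> \<odot> u" "trg V (lu u) = u"
    "li u \<in> arrs V" "trg V (li u) = \<one> \<odot> u" "src V (li u) = u"
    "ru u \<in> arrs V" "src V (ru u) = u \<odot> \<one>" "trg V (ru u) = u"
    "ri u \<in> arrs V" "trg V (ri u) = u \<odot> \<one>" "src V (ri u) = u"
    "lu u \<cdot> li u = \<i>\<d> (\<one> \<odot> u)" "li u \<cdot> lu u = \<i>\<d> u"
    "ru u \<cdot> ri u = \<i>\<d> (u \<odot> \<one>)" "ri u \<cdot> ru u = \<i>\<d> u"
  using lunit_hom[OF assms] iso_simps[OF lunit_iso[OF assms]]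
    runit_hom[OF assms] iso_simps[OF runit_iso[OF assms]]
  by (simp_all add: hom_def li_def ri_def)

lemma whisker_typing [simp]:
  assumes "u \<in> objs V" "f \<in> arrs V"
  shows "lw u f \<in> arrs V" "src V (lw u f) = u \<odot> src V f" "trg V (lw u f) = u \<odot> trg V f"
    "rw f u \<in> arrs V" "src V (rw f u) = src V f \<odot> u" "trg V (rw f u) = trg V f \<odot> u"
  using tarr_hom[OF idn_hom[OF assms(1)], of f "src V f" "trg V f"]
    tarr_hom[OF _ idn_hom[OF assms(1)], of f "src V f" "trg V f"] assms
  by (auto simp: hom_def lw_def rw_def)

lemma whisker_idn [simp]:
  assumes "u \<in> objs V" "v \<in> objs V"
  shows "lw u (\<i>\<d> v) = \<i>\<d> (u \<odot> v)" "rw (\<i>\<d> v) u = \<i>\<d> (v \<odot> u)"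
  using assms by (auto simp: lw_def rw_def tarr_idn)

lemma tarr_cmp:
  assumes "f \<in> arrs V" "g \<in> arrs V" "f' \<in> arrs V" "g' \<in> arrs V" "trg V f = src V g" "trg V f' = src V g'"
  shows "(f \<otimes> f') \<cdot> (g \<otimes> g') = (f \<cdot> g) \<otimes> (f' \<cdot> g')"
  using interchange[of f "src V f" "src V g" g "trg V g" f' "src V f'" "src V g'" g' "trg V g'"] assms
  by (simp add: hom_def)

lemma tarr_typing [simp]:
  assumes "f \<in> arrs V" "g \<in> arrs V"
  shows "f \<otimes> g \<in> arrs V" "src V (f \<otimes> g) = src V f \<odot> src V g" "trg V (f \<otimes> g) = trg V f \<odot> trg V g"
  using tarr_hom[of f "src V f" "trg V f" g "src V g" "trg V g"] assms by (auto simp: hom_def)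

lemma whisker_cmp [simp]:
  assumes "u \<in> objs V" "f \<in> arrs V" "g \<in> arrs V" "trg V f = src V g"
  shows "lw u (f \<cdot> g) = lw u f \<cdot> lw u g" "rw (f \<cdot> g) u = rw f u \<cdot> rw g u"
  using assms by (simp_all add: lw_def rw_def tarr_cmp)

lemma tarr_split:
  assumes "f \<in> arrs V" "g \<in> arrs V"
  shows "f \<otimes> g = rw f (src V g) \<cdot> lw (trg V f) g"
  using assms by (simp add: lw_def rw_def tarr_cmp)

text \<open>Interchange, oriented so that the left tensor factor acts before the right one. Proofs
  that need the opposite order delete this rule or state the swap by hand.\<close>

lemma whisker_swap [simp]:
  assumes "f \<in> arrs V" "g \<in> arrs V" "src V f = u" "trg V g = v"
  shows "lw u g \<cdot> rw f v = rw f (src V g) \<cdot> lw (trg V f) g"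
  using assms by (auto simp: lw_def rw_def tarr_cmp)

lemma whisker_swap' [simp]:
  assumes "f \<in> arrs V" "g \<in> arrs V" "src V f = u" "trg V g = v" "h \<in> arrs V" "src V h = trg V f \<odot> trg V g"
  shows "lw u g \<cdot> (rw f v \<cdot> h) = rw f (src V g) \<cdot> (lw (trg V f) g \<cdot> h)"
  using cmp_extend[OF whisker_swap[OF assms(1-4)], of h] assms by auto

lemma as_nat [simp]:
  assumes "u \<in> objs V" "v \<in> objs V" "f \<in> arrs V" "x = trg V f"
  shows "rw (rw f u) v \<cdot> as x u v = as (src V f) u v \<cdot> rw f (u \<odot> v)"
    and "rw (lw u f) v \<cdot> as u x v = as u (src V f) v \<cdot> lw u (rw f v)"
    and "lw (u \<odot> v) f \<cdot> as u v x = as u v (src V f) \<cdot> lw u (lw v f)"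
  using assms assoc_nat[of f "src V f" x "\<i>\<d> u" u u "\<i>\<d> v" v v]
    assoc_nat[of "\<i>\<d> u" u u f "src V f" x "\<i>\<d> v" v v]
    assoc_nat[of "\<i>\<d> u" u u "\<i>\<d> v" v v f "src V f" x]
  by (simp_all add: hom_def rw_def lw_def tarr_idn)

lemma ri_iso: "u \<in> objs V \<Longrightarrow> is_iso V (ri u)"
  by (intro is_isoI[of _ "ru u"]) simp_all

lemma conjugate_inverse:
  assumes "f \<cdot> a = b \<cdot> g" "a \<cdot> a' = \<i>\<d> (src V a)" "b' \<cdot> b = \<i>\<d> (trg V b)"
    "f \<in> arrs V" "g \<in> arrs V" "a \<in> arrs V" "b \<in> arrs V" "a' \<in> arrs V" "b' \<in> arrs V"
    "trg V f = src V a" "trg V b = src V g" "src V f = src V b" "trg V g = trg V a"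
    "src V a' = trg V a" "trg V b' = src V b"
  shows "g \<cdot> a' = b' \<cdot> f"
proof -
  have t: "trg V a' = src V a"
    using trg_cmp[of a a'] assms(2,6,8,14) by simp
  have "src V b' = trg V b"
    using src_cmp[of b' b] assms(3,7,9,15) by simp
  have "g \<cdot> a' = (b' \<cdot> b) \<cdot> (g \<cdot> a')"
    using assms(3,5,8,11,13,14) by simp
  also have "\<dots> = b' \<cdot> (b \<cdot> (g \<cdot> a'))"
    using assms(5,7-9,11,13-15) by (intro cmp_assoc') simp_all
  also have "b \<cdot> (g \<cdot> a') = f \<cdot> g' \<cdot> a'" if "g' = a" for g'
    using cmp_extend[OF assms(1)[symmetric], of a'] assms(4-8,10-14) that by (simp del: cmp_assoc')
  also have "f \<cdot> a \<cdot> a' = f \<cdot> (a \<cdot> a')"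
    using assms(4,6,8,10,14) by (intro cmp_assoc') simp_all
  finally show ?thesis
    using assms(2,4,10) by simp
qed

lemma ai_nat [simp]:
  assumes "u \<in> objs V" "v \<in> objs V" "f \<in> arrs V" "x = trg V f"
  shows "rw f (u \<odot> v) \<cdot> ai x u v = ai (src V f) u v \<cdot> rw (rw f u) v"
    and "lw u (rw f v) \<cdot> ai u x v = ai u (src V f) v \<cdot> rw (lw u f) v"
    and "lw u (lw v f) \<cdot> ai u v x = ai u v (src V f) \<cdot> lw (u \<odot> v) f"
  using assms
    conjugate_inverse[OF as_nat(1)[OF assms], of "ai x u v" "ai (src V f) u v"]
    conjugate_inverse[OF as_nat(2)[OF assms], of "ai u x v" "ai u (src V f) v"]
    conjugate_inverse[OF as_nat(3)[OF assms], of "ai u v x" "ai u v (src V f)"]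
  by simp_all

lemma lu_nat [simp]: "f \<in> arrs V \<Longrightarrow> u = trg V f \<Longrightarrow> lw \<one> f \<cdot> lu u = lu (src V f) \<cdot> f"
  and ru_nat [simp]: "f \<in> arrs V \<Longrightarrow> u = trg V f \<Longrightarrow> rw f \<one> \<cdot> ru u = ru (src V f) \<cdot> f"
  using lunit_nat runit_nat by (auto simp: hom_def lw_def rw_def)

lemma li_nat [simp]: "f \<in> arrs V \<Longrightarrow> u = src V f \<Longrightarrow> li u \<cdot> lw \<one> f = f \<cdot> li (trg V f)"
  and ri_nat [simp]: "f \<in> arrs V \<Longrightarrow> u = src V f \<Longrightarrow> ri u \<cdot> rw f \<one> = f \<cdot> ri (trg V f)"
  by (rule conjugate_inverse[OF lu_nat[OF _ refl], symmetric]; simp)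
    (rule conjugate_inverse[OF ru_nat[OF _ refl], symmetric]; simp)

lemma lw_cong:
  assumes "f \<cdot> g = k" "u \<in> objs V" "f \<in> arrs V" "g \<in> arrs V" "trg V f = src V g"
  shows "lw u f \<cdot> lw u g = lw u k"
  using assms whisker_cmp by metis

lemma rw_cong:
  assumes "f \<cdot> g = k" "u \<in> objs V" "f \<in> arrs V" "g \<in> arrs V" "trg V f = src V g"
  shows "rw f u \<cdot> rw g u = rw k u"
  using assms whisker_cmp by metis

lemmas structure_nat_extend [simp] = as_nat[THEN cmp_extend] ai_nat[THEN cmp_extend]
  lu_nat[THEN cmp_extend] ru_nat[THEN cmp_extend] li_nat[THEN cmp_extend] ri_nat[THEN cmp_extend]

lemmas structure_inv_extend [simp] =
  assoc_typing(7,8)[THEN cmp_extend] unit_typing(13-16)[THEN cmp_extend]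
  assoc_typing(7,8)[THEN lw_cong] unit_typing(13-16)[THEN lw_cong]
  assoc_typing(7,8)[THEN rw_cong] unit_typing(13-16)[THEN rw_cong]
  assoc_typing(7,8)[THEN lw_cong, THEN cmp_extend] unit_typing(13-16)[THEN lw_cong, THEN cmp_extend]
  assoc_typing(7,8)[THEN rw_cong, THEN cmp_extend] unit_typing(13-16)[THEN rw_cong, THEN cmp_extend]

text \<open>Naturality of \<open>lu\<close> makes \<open>\<one> \<odot> _\<close> isomorphic to the
  identity functor, hence faithful. This strips the auxiliary unit factor that Kelly's argument
  introduces.\<close>

lemma lw_one_inj:
  assumes "lw \<one> f = lw \<one> g" "f \<in> arrs V" "g \<in> arrs V" "src V f = src V g" "trg V f = trg V g"
  shows "f = g"
proof -
  have "lw \<one> f \<cdot> lu (trg V f) = lw \<one> g \<cdot> lu (trg V f)"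
    by (simp only: assms(1))
  then have "lu (src V g) \<cdot> f = lu (src V g) \<cdot> g"
    using assms(2-) by simp
  then show ?thesis
    by (rule iso_cancel_left[rotated]) (use assms lunit_iso in simp_all)
qed

lemma rw_one_inj:
  assumes "rw f \<one> = rw g \<one>" "f \<in> arrs V" "g \<in> arrs V" "src V f = src V g" "trg V f = trg V g"
  shows "f = g"
proof -
  have "rw f \<one> \<cdot> ru (trg V f) = rw g \<one> \<cdot> ru (trg V f)"
    by (simp only: assms(1))
  then have "ru (src V g) \<cdot> f = ru (src V g) \<cdot> g"
    using assms(2-) by simp
  then show ?thesis
    by (rule iso_cancel_left[rotated]) (use assms runit_iso in simp_all)
qed

lemma pentagon_as:
  assumes "u \<in> objs V" "v \<in> objs V" "w \<in> objs V" "x \<in> objs V"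
  shows "rw (as u v w) x \<cdot> (as u (v \<odot> w) x \<cdot> lw u (as v w x)) = as (u \<odot> v) w x \<cdot> as u v (w \<odot> x)"
  using pentagon[OF assms] assms by (simp add: lw_def[symmetric] rw_def[symmetric])

lemma triangle_as [simp]:
  assumes "u \<in> objs V" "v \<in> objs V"
  shows "as u \<one> v \<cdot> lw u (lu v) = rw (ru u) v"
  using triangle[OF assms] assms by (simp add: lw_def[symmetric] rw_def[symmetric])

lemma rw_iso:
  assumes "is_iso V f" "u \<in> objs V"
  shows "is_iso V (rw f u)"
  using assms iso_simps[OF assms(1)] rw_cong[of f "inv_arr V f" _ u] rw_cong[of "inv_arr V f" f _ u]
  by (intro is_isoI[of _ "rw (inv_arr V f) u"]) auto

lemma lw_iso:
  assumes "is_iso V f" "u \<in> objs V"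
  shows "is_iso V (lw u f)"
  using assms iso_simps[OF assms(1)] lw_cong[of f "inv_arr V f" _ u] lw_cong[of "inv_arr V f" f _ u]
  by (intro is_isoI[of _ "lw u (inv_arr V f)"]) auto

text \<open>Kelly's derivation of the remaining unit coherences from pentagon and triangle.\<close>

lemma as_lu [simp]:
  assumes u: "u \<in> objs V" "v \<in> objs V"
  shows "as \<one> u v \<cdot> lu (u \<odot> v) = rw (lu u) v"
proof -
  have "rw (as \<one> \<one> u) v \<cdot> (as \<one> (\<one> \<odot> u) v \<cdot> lw \<one> (as \<one> u v)) \<cdot> lw \<one> (lu (u \<odot> v))
      = as (\<one> \<odot> \<one>) u v \<cdot> (as \<one> \<one> (u \<odot> v) \<cdot> lw \<one> (lu (u \<odot> v)))"
    unfolding pentagon_as[OF one_obj one_obj u] using u by (simp del: triangle_as)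
  also have "\<dots> = rw (rw (ru \<one>) u) v \<cdot> as \<one> u v"
    using u by simp
  also have "\<dots> = rw (as \<one> \<one> u \<cdot> lw \<one> (lu u)) v \<cdot> as \<one> u v"
    using u by (simp del: whisker_cmp)
  also have "\<dots> = rw (as \<one> \<one> u) v \<cdot> (as \<one> (\<one> \<odot> u) v \<cdot> lw \<one> (rw (lu u) v))"
    using u by (simp del: triangle_as)
  finally have "rw (as \<one> \<one> u) v \<cdot> (as \<one> (\<one> \<odot> u) v \<cdot> lw \<one> (as \<one> u v \<cdot> lu (u \<odot> v)))
    = rw (as \<one> \<one> u) v \<cdot> (as \<one> (\<one> \<odot> u) v \<cdot> lw \<one> (rw (lu u) v))"
    using u by simp
  then have "as \<one> (\<one> \<odot> u) v \<cdot> lw \<one> (as \<one> u v \<cdot> lu (u \<odot> v)) = as \<one> (\<one> \<odot> u) v \<cdot> lw \<one> (rw (lu u) v)"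
    by (rule iso_cancel_left[rotated]) (use u assoc_iso rw_iso in simp_all)
  then have "lw \<one> (as \<one> u v \<cdot> lu (u \<odot> v)) = lw \<one> (rw (lu u) v)"
    by (rule iso_cancel_left[rotated]) (use u assoc_iso rw_iso in simp_all)
  then show ?thesis
    by (rule lw_one_inj) (use u in simp_all)
qed

text \<open>Mirror image of \<open>as_lu\<close>: the pentagon at
  \<open>u, v, \<one>, \<one>\<close> and the triangle identify both sides after whiskering by
  \<open>\<one>\<close> on the right, which is faithful.\<close>

lemma as_ru [simp]:
  assumes u: "u \<in> objs V" "v \<in> objs V"
  shows "as u v \<one> \<cdot> lw u (ru v) = ru (u \<odot> v)"
proof -
  have "rw (as u v \<one>) \<one> \<cdot> (as u (v \<odot> \<one>) \<one> \<cdot> lw u (as v \<one> \<one>)) \<cdot> lw u (lw v (lu \<one>))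
      = as (u \<odot> v) \<one> \<one> \<cdot> (as u v (\<one> \<odot> \<one>) \<cdot> lw u (lw v (lu \<one>)))"
    unfolding pentagon_as[OF u one_obj one_obj] using u by simp
  also have "\<dots> = as (u \<odot> v) \<one> \<one> \<cdot> lw (u \<odot> v) (lu \<one>) \<cdot> as u v \<one>"
    using u by (simp del: triangle_as triangle_as[THEN cmp_extend])
  also have "\<dots> = rw (ru (u \<odot> v)) \<one> \<cdot> as u v \<one>"
    using u by (simp del: as_nat structure_nat_extend cmp_assoc')
  finally have "rw (as u v \<one> \<cdot> lw u (ru v)) \<one> \<cdot> as u v \<one> = rw (ru (u \<odot> v)) \<one> \<cdot> as u v \<one>"
    using u triangle_as[THEN lw_cong, of v \<one> u] by simp
  then have "rw (as u v \<one> \<cdot> lw u (ru v)) \<one> = rw (ru (u \<odot> v)) \<one>"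
    by (rule iso_cancel_right[rotated]) (use u assoc_iso in simp_all)
  then show ?thesis
    by (rule rw_one_inj) (use u in simp_all)
qed

text \<open>Naturality of \<open>lu\<close> at \<open>lu \<one>\<close> itself gives
  \<open>lw \<one> (lu \<one>) = lu (\<one> \<odot> \<one>)\<close>. Preceded by
  \<open>as \<one> \<one> \<one>\<close>, the two sides become \<open>rw (ru \<one>) \<one>\<close>
  by the triangle and \<open>rw (lu \<one>) \<one>\<close> by \<open>as_lu\<close>.\<close>

lemma lu_one: "lu \<one> = ru \<one>"
proof -
  have "lw \<one> (lu \<one>) \<cdot> lu \<one> = lu (\<one> \<odot> \<one>) \<cdot> lu \<one>"
    by simp
  then have "lw \<one> (lu \<one>) = lu (\<one> \<odot> \<one>)"
    by (rule iso_cancel_right[rotated]) (use lunit_iso in simp_all)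
  then have "rw (lu \<one>) \<one> = rw (ru \<one>) \<one>"
    using as_lu[of \<one> \<one>] triangle_as[of \<one> \<one>] by simp
  then show ?thesis
    by (rule rw_one_inj) simp_all
qed

lemma li_one: "li \<one> = ri \<one>"
  by (simp add: li_def ri_def lu_one)

lemma unit_coherence [simp]:
  assumes u: "u \<in> objs V" "v \<in> objs V"
  shows "ai u \<one> v \<cdot> rw (ru u) v = lw u (lu v)"
    "lw u (li v) \<cdot> ai u \<one> v = rw (ri u) v"
    "rw (ri u) v \<cdot> as u \<one> v = lw u (li v)"
    "ai \<one> u v \<cdot> rw (lu u) v = lu (u \<odot> v)"
    "li (u \<odot> v) \<cdot> ai \<one> u v = rw (li u) v"
    "rw (li u) v \<cdot> as \<one> u v = li (u \<odot> v)"
    "ai u v \<one> \<cdot> ru (u \<odot> v) = lw u (ru v)"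
    "lw u (ri v) \<cdot> ai u v \<one> = ri (u \<odot> v)"
    "ri (u \<odot> v) \<cdot> as u v \<one> = lw u (ri v)"
proof -
  \<comment> \<open>A triangle \<open>f \<cdot> g = h\<close> of isomorphisms with inverses
    \<open>f'\<close>, \<open>g'\<close>, \<open>h'\<close> has three mixed consequences; the nine
    claims are these for \<open>triangle_as\<close>, \<open>as_lu\<close> and
    \<open>as_ru\<close>.\<close>
  have *: "f' \<cdot> h = g" "g' \<cdot> f' = h'" "h' \<cdot> f = g'"
    if "f \<cdot> g = h" "f \<cdot> f' = \<i>\<d> (src V f)" "f' \<cdot> f = \<i>\<d> (src V g)" "g \<cdot> g' = \<i>\<d> (src V g)" "g' \<cdot> g = \<i>\<d> (trg V g)"
      "h \<cdot> h' = \<i>\<d> (src V f)" "h' \<cdot> h = \<i>\<d> (trg V g)"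
      "{f, g, h, f', g', h'} \<subseteq> arrs V" "trg V f = src V g" "src V f' = src V g" "trg V f' = src V f"
      "src V g' = trg V g" "trg V g' = src V g" "src V h' = trg V g" "trg V h' = src V f"
      "src V h = src V f" "trg V h = trg V g"
    for f g h f' g' h'
  proof -
    show 1: "f' \<cdot> h = g"
      using cmp_extend[OF that(3), of g] that by simp
    have "g' \<cdot> f' = g' \<cdot> f' \<cdot> (h \<cdot> h')"
      using that by simp
    also have "\<dots> = g' \<cdot> (g \<cdot> h')"
      using cmp_extend[OF 1, of h'] that(2-) by simp
    finally show 2: "g' \<cdot> f' = h'"
      using cmp_extend[OF that(5), of h'] that by simp
    have "g' \<cdot> f' \<cdot> f = g'"
      using that by simp
    then show "h' \<cdot> f = g'"
      unfolding 2 .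
  qed
  show "ai u \<one> v \<cdot> rw (ru u) v = lw u (lu v)"
    "lw u (li v) \<cdot> ai u \<one> v = rw (ri u) v"
    "rw (ri u) v \<cdot> as u \<one> v = lw u (li v)"
    using *[OF triangle_as[OF u], of "ai u \<one> v" "lw u (li v)" "rw (ri u) v"] u by simp_all
  show "ai \<one> u v \<cdot> rw (lu u) v = lu (u \<odot> v)"
    "li (u \<odot> v) \<cdot> ai \<one> u v = rw (li u) v"
    "rw (li u) v \<cdot> as \<one> u v = li (u \<odot> v)"
    using *[OF as_lu[OF u], of "ai \<one> u v" "li (u \<odot> v)" "rw (li u) v"] u by simp_all
  show "ai u v \<one> \<cdot> ru (u \<odot> v) = lw u (ru v)"
    "lw u (ri v) \<cdot> ai u v \<one> = ri (u \<odot> v)"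
    "ri (u \<odot> v) \<cdot> as u v \<one> = lw u (ri v)"
    using *[OF as_ru[OF u], of "ai u v \<one>" "lw u (ri v)" "ri (u \<odot> v)"] u by simp_all
qed

lemmas coherence_extend [simp] =
  triangle_as[THEN cmp_extend] as_lu[THEN cmp_extend] as_ru[THEN cmp_extend] unit_coherence[THEN cmp_extend]


text \<open>Sides of the pentagon are moved across by their inverses. These are not simp rules, as
  each diagram needs its own direction: form 1 serves Kleisli composition, forms 2 to 4 the
  tensorings, forms 5 to 7 the monad behind the completion.\<close>

lemma pentagon_forms:
  assumes u: "u \<in> objs V" "v \<in> objs V" "w \<in> objs V" "x \<in> objs V"
  shows "ai u (v \<odot> w) x \<cdot> (rw (ai u v w) x \<cdot> as (u \<odot> v) w x) = lw u (as v w x) \<cdot> ai u v (w \<odot> x)"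
    and "as u v (w \<odot> x) \<cdot> lw u (ai v w x) = ai (u \<odot> v) w x \<cdot> (rw (as u v w) x \<cdot> as u (v \<odot> w) x)"
    and "lw u (ai v w x) \<cdot> (ai u (v \<odot> w) x \<cdot> rw (ai u v w) x) = ai u v (w \<odot> x) \<cdot> ai (u \<odot> v) w x"
    and "ai u v (w \<odot> x) \<cdot> (ai (u \<odot> v) w x \<cdot> rw (as u v w) x) = lw u (ai v w x) \<cdot> ai u (v \<odot> w) x"
    and "ai (u \<odot> v) w x \<cdot> rw (as u v w) x = as u v (w \<odot> x) \<cdot> (lw u (ai v w x) \<cdot> ai u (v \<odot> w) x)"
    and "rw (ai u v w) x \<cdot> (as (u \<odot> v) w x \<cdot> as u v (w \<odot> x)) = as u (v \<odot> w) x \<cdot> lw u (as v w x)"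
    and "rw (as u v w) x \<cdot> as u (v \<odot> w) x = as (u \<odot> v) w x \<cdot> (as u v (w \<odot> x) \<cdot> lw u (ai v w x))"
proof -
  let ?A = "rw (as u v w) x" and ?B = "as u (v \<odot> w) x" and ?C = "lw u (as v w x)"
    and ?D = "as (u \<odot> v) w x" and ?E = "as u v (w \<odot> x)"
  let ?A' = "rw (ai u v w) x" and ?B' = "ai u (v \<odot> w) x" and ?C' = "lw u (ai v w x)"
    and ?D' = "ai (u \<odot> v) w x" and ?E' = "ai u v (w \<odot> x)"
  \<comment> \<open>Each context \<open>\<lambda>t. ...\<close> below pads both sides of the
    pentagon with inverses, which simp cancels.\<close>
  note pent = arg_cong[OF pentagon_as[OF u]]
  show "?B' \<cdot> (?A' \<cdot> ?D) = ?C \<cdot> ?E'"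
    using pent[of "\<lambda>t. ?B' \<cdot> (?A' \<cdot> (t \<cdot> ?E'))"] u by simp
  show "?E \<cdot> ?C' = ?D' \<cdot> (?A \<cdot> ?B)"
    using pent[of "\<lambda>t. ?D' \<cdot> (t \<cdot> ?C')"] u by simp
  show "?C' \<cdot> (?B' \<cdot> ?A') = ?E' \<cdot> ?D'"
    using pent[of "\<lambda>t. ?C' \<cdot> (?B' \<cdot> (?A' \<cdot> (t \<cdot> (?E' \<cdot> ?D'))))"] u by simp
  show "?E' \<cdot> (?D' \<cdot> ?A) = ?C' \<cdot> ?B'"
    using pent[of "\<lambda>t. ?E' \<cdot> (?D' \<cdot> (t \<cdot> (?C' \<cdot> ?B')))"] u by simp
  show "?D' \<cdot> ?A = ?E \<cdot> (?C' \<cdot> ?B')"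
    using pent[of "\<lambda>t. ?D' \<cdot> (t \<cdot> (?C' \<cdot> ?B'))"] u by simp
  show "?A' \<cdot> (?D \<cdot> ?E) = ?B \<cdot> ?C"
    using pent[of "\<lambda>t. ?A' \<cdot> t"] u by simp
  show "?A \<cdot> ?B = ?D \<cdot> (?E \<cdot> ?C')"
    using pent[of "\<lambda>t. t \<cdot> ?C'"] u by simp
qed

end

section \<open>Currying and evaluation\<close>

context closed_monoidal_category
begin

declare ihom_obj [simp]

lemma mate_typing [simp]:
  assumes "f \<in> arrs V" "src V f = u \<odot> w" "trg V f = v" "u \<in> objs V" "w \<in> objs V"
  shows "mate V u w v f \<in> arrs V" "src V (mate V u w v f) = w" "trg V (mate V u w v f) = ihom V u v"
proof -
  have "mate V u w v f \<in> hom V w (ihom V u v)"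
    using assms by (intro bij_betw_apply[OF mate_bij]) (auto simp: hom_def)
  then show "mate V u w v f \<in> arrs V" "src V (mate V u w v f) = w" "trg V (mate V u w v f) = ihom V u v"
    by (simp_all add: hom_def)
qed

lemma unmate_mate:
  assumes "u \<in> objs V" "w \<in> objs V" "v \<in> objs V" "g \<in> hom V w (ihom V u v)"
  shows "unmate V u w v g \<in> hom V (u \<odot> w) v" "mate V u w v (unmate V u w v g) = g"
  using mate_bij[OF assms(1-3)] assms(4) unfolding unmate_def
  by (auto simp: bij_betw_def the_inv_into_into f_the_inv_into_f)

lemma ev_typing [simp]:
  assumes "u \<in> objs V" "v \<in> objs V"
  shows "ev V u v \<in> arrs V" "src V (ev V u v) = u \<odot> ihom V u v" "trg V (ev V u v) = v"
  using unmate_mate(1)[of u "ihom V u v" v "\<i>\<d> (ihom V u v)"] assms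
  by (simp_all add: hom_def ev_def)

lemma mate_ev: "u \<in> objs V \<Longrightarrow> v \<in> objs V \<Longrightarrow> mate V u (ihom V u v) v (ev V u v) = \<i>\<d> (ihom V u v)"
  using unmate_mate(2)[of u "ihom V u v" v "\<i>\<d> (ihom V u v)"]
  by (simp_all add: hom_def ev_def)

lemma mate_lw:
  assumes "u \<in> objs V" "g \<in> arrs V" "f \<in> arrs V" "src V f = u \<odot> w" "trg V g = w" "trg V f = v" "src V g = w'"
  shows "mate V u w' v (lw u g \<cdot> f) = g \<cdot> mate V u w v f"
  using mate_nat[of u v g w' w f] assms by (auto simp: hom_def lw_def)

lemma mate_lw_ev:
  assumes "u \<in> objs V" "v \<in> objs V" "g \<in> arrs V" "trg V g = ihom V u v"
  shows "mate V u (src V g) v (lw u g \<cdot> ev V u v) = g"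
  using assms mate_lw[of u g "ev V u v" "ihom V u v" v "src V g"] by (simp add: mate_ev)

text \<open>By \<open>mate_lw_ev\<close> an arrow into an internal hom is the mate of its
  evaluation. This is the standard opening for the laws of the enriched categories and functors
  below.\<close>

lemma ev_inj:
  assumes "lw u f \<cdot> ev V u v = lw u g \<cdot> ev V u v" "u \<in> objs V" "v \<in> objs V" "f \<in> arrs V" "g \<in> arrs V"
    "trg V f = ihom V u v" "trg V g = ihom V u v" "src V f = src V g"
  shows "f = g"
  using mate_lw_ev[of u v f] mate_lw_ev[of u v g] assms by metis

text \<open>The beta rule of currying: both sides have the same mate by \<open>mate_lw_ev\<close>,
  and \<open>mate\<close> is injective. It removes mates once \<open>ev_inj\<close> has exposed an
  evaluation.\<close>

lemma lw_mate_ev [simp]: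
  assumes "u \<in> objs V" "w \<in> objs V" "f \<in> arrs V" "src V f = u \<odot> w" "trg V f = v"
  shows "lw u (mate V u w v f) \<cdot> ev V u v = f"
proof -
  have v: "v \<in> objs V" using assms by auto
  have "mate V u w v (lw u (mate V u w v f) \<cdot> ev V u v) = mate V u w v f"
    using mate_lw_ev[of u v "mate V u w v f"] assms v by simp
  moreover have "inj_on (mate V u w v) (hom V (u \<odot> w) v)"
    using mate_bij assms v by (auto simp: bij_betw_def)
  ultimately show ?thesis
    using assms v by (auto simp: hom_def dest!: inj_onD)
qed

lemmas lw_mate_ev_extend [simp] = lw_mate_ev[THEN cmp_extend] lw_mate_ev[THEN lw_cong]
  lw_mate_ev[THEN rw_cong] lw_mate_ev[THEN lw_cong, THEN cmp_extend] lw_mate_ev[THEN rw_cong, THEN cmp_extend]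

lemma unmate_eq:
  assumes "u \<in> objs V" "v \<in> objs V" "g \<in> arrs V" "trg V g = ihom V u v" "src V g = w"
  shows "unmate V u w v g = lw u g \<cdot> ev V u v"
proof -
  have "w \<in> objs V" using assms by auto
  moreover have "g \<in> hom V w (ihom V u v)" using assms by (simp add: hom_def)
  ultimately have "lw u g \<cdot> ev V u v = lw u (mate V u w v (unmate V u w v g)) \<cdot> ev V u v"
    using unmate_mate(2)[of u w v g] assms by simp
  also have "\<dots> = unmate V u w v g"
    using unmate_mate(1)[of u w v g] assms \<open>w \<in> objs V\<close> \<open>g \<in> hom V w (ihom V u v)\<close>
    by (intro lw_mate_ev) (auto simp: hom_def)
  finally show ?thesis ..
qed

end

section \<open>Enriched Kleisli categories of strong monads with many objects\<close>

text \<open>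
  \<open>P a b\<close> are the components of a strong monad with object set \<open>A\<close>, and \<open>ext\<close> is Kleisli extension with
  a parameter \<open>y\<close>, which packages multiplication and strength. The two instances are \<open>P a b v = v\<close>, which
  yields the self-enrichment, and \<open>P a b v = ehom C a b \<odot> v\<close>, which yields the completion.
\<close>

locale strong_kleisli = closed_monoidal_category V
  for V :: "('o, 'm) closed_monoidal_category" (structure) +
  fixes A :: "'a set"
    and P :: "'a \<Rightarrow> 'a \<Rightarrow> 'o \<Rightarrow> 'o"
    and unt :: "'a \<Rightarrow> 'o \<Rightarrow> 'm"
    and ext :: "'a \<Rightarrow> 'a \<Rightarrow> 'a \<Rightarrow> 'o \<Rightarrow> 'o \<Rightarrow> 'o \<Rightarrow> 'm \<Rightarrow> 'm"
  assumes P_obj [simp]: "a \<in> A \<Longrightarrow> b \<in> A \<Longrightarrow> v \<in> objs V \<Longrightarrow> P a b v \<in> objs V"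
    and unt_hom: "a \<in> A \<Longrightarrow> v \<in> objs V \<Longrightarrow> unt a v \<in> hom V v (P a a v)"
    and ext_hom: "a \<in> A \<Longrightarrow> b \<in> A \<Longrightarrow> c \<in> A \<Longrightarrow> v \<in> objs V \<Longrightarrow> y \<in> objs V \<Longrightarrow> w \<in> objs V \<Longrightarrow>
      g \<in> hom V (v \<odot> y) (P b c w) \<Longrightarrow> ext a b c v y w g \<in> hom V (P a b v \<odot> y) (P a c w)"
    and ext_nat: "a \<in> A \<Longrightarrow> b \<in> A \<Longrightarrow> c \<in> A \<Longrightarrow> v \<in> objs V \<Longrightarrow> w \<in> objs V \<Longrightarrow>
      g \<in> hom V (v \<odot> y) (P b c w) \<Longrightarrow> h \<in> hom V y' y \<Longrightarrow>
      lw (P a b v) h \<cdot> ext a b c v y w g = ext a b c v y' w (lw v h \<cdot> g)"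
    and unt_ext: "a \<in> A \<Longrightarrow> b \<in> A \<Longrightarrow> v \<in> objs V \<Longrightarrow> y \<in> objs V \<Longrightarrow> w \<in> objs V \<Longrightarrow>
      g \<in> hom V (v \<odot> y) (P a b w) \<Longrightarrow> rw (unt a v) y \<cdot> ext a a b v y w g = g"
    and ext_unt: "a \<in> A \<Longrightarrow> b \<in> A \<Longrightarrow> v \<in> objs V \<Longrightarrow>
      ext a b b v \<one> v (ru v \<cdot> unt b v) = ru (P a b v)"
    and ext_ext: "a \<in> A \<Longrightarrow> b \<in> A \<Longrightarrow> c \<in> A \<Longrightarrow> d \<in> A \<Longrightarrow>
      v \<in> objs V \<Longrightarrow> y \<in> objs V \<Longrightarrow> w \<in> objs V \<Longrightarrow> z \<in> objs V \<Longrightarrow> q \<in> objs V \<Longrightarrow>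
      g \<in> hom V (v \<odot> y) (P b c w) \<Longrightarrow> k \<in> hom V (w \<odot> z) (P c d q) \<Longrightarrow>
      rw (ext a b c v y w g) z \<cdot> ext a c d w z q k =
      as (P a b v) y z \<cdot> ext a b d v (y \<odot> z) q (ai v y z \<cdot> (rw g z \<cdot> ext b c d w z q k))"
begin

lemma unt_typing [simp]:
  assumes "a \<in> A" "v \<in> objs V"
  shows "unt a v \<in> arrs V" "src V (unt a v) = v" "trg V (unt a v) = P a a v"
  using unt_hom[OF assms] by (simp_all add: hom_def)

lemma ext_typing [simp]:
  assumes "a \<in> A" "b \<in> A" "c \<in> A" "v \<in> objs V" "y \<in> objs V" "w \<in> objs V"
    "g \<in> arrs V" "src V g = v \<odot> y" "trg V g = P b c w"
  shows "ext a b c v y w g \<in> arrs V" "src V (ext a b c v y w g) = P a b v \<odot> y"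
    "trg V (ext a b c v y w g) = P a c w"
  using ext_hom[OF assms(1-6)] assms(7-) by (simp_all add: hom_def)

lemma ext_nat' [simp]:
  assumes "a \<in> A" "b \<in> A" "c \<in> A" "v \<in> objs V" "w \<in> objs V" "Q = P a b v"
    "g \<in> arrs V" "src V g = v \<odot> y" "trg V g = P b c w" "h \<in> arrs V" "trg V h = y"
  shows "lw Q h \<cdot> ext a b c v y w g = ext a b c v (src V h) w (lw v h \<cdot> g)"
  using ext_nat[OF assms(1-5), of g y h "src V h"] assms(6-) by (simp add: hom_def)

lemma unt_ext' [simp]:
  assumes "a \<in> A" "b \<in> A" "v \<in> objs V" "y \<in> objs V" "w \<in> objs V"
    "g \<in> arrs V" "src V g = v \<odot> y" "trg V g = P a b w"
  shows "rw (unt a v) y \<cdot> ext a a b v y w g = g"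
  using unt_ext[OF assms(1-5)] assms(6-) by (simp add: hom_def)

lemma ext_ext' [simp]:
  assumes "a \<in> A" "b \<in> A" "c \<in> A" "d \<in> A" "v \<in> objs V" "y \<in> objs V" "w \<in> objs V" "z \<in> objs V" "q \<in> objs V"
    "g \<in> arrs V" "src V g = v \<odot> y" "trg V g = P b c w" "k \<in> arrs V" "src V k = w \<odot> z" "trg V k = P c d q"
  shows "rw (ext a b c v y w g) z \<cdot> ext a c d w z q k =
      as (P a b v) y z \<cdot> ext a b d v (y \<odot> z) q (ai v y z \<cdot> (rw g z \<cdot> ext b c d w z q k))"
  using ext_ext[OF assms(1-9)] assms(10-) by (simp add: hom_def)

declare ext_unt [simp]

lemmas ext_extend [simp] = ext_nat'[THEN cmp_extend] unt_ext'[THEN cmp_extend] ext_ext'[THEN cmp_extend]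

end

text \<open>An object \<open>i\<close> carries a monad index \<open>cl i\<close> and an object
  \<open>U i\<close> of \<open>V\<close>; this fits \<open>objs V\<close> with a single index as
  well as the pairs of the completion. \<open>E\<close> is characterised by equations rather than
  constructed, so that \<open>self_enriched V\<close> and \<open>completion V C\<close> are
  themselves instances.\<close>

locale kleisli_category = strong_kleisli V A P unt ext
  for V :: "('o, 'm) closed_monoidal_category" (structure)
    and A :: "'a set" and P unt ext +
  fixes I :: "'i set" and cl :: "'i \<Rightarrow> 'a" and U :: "'i \<Rightarrow> 'o"
    and E :: "('i, 'o, 'm) enriched_category"
  assumes cl [simp]: "i \<in> I \<Longrightarrow> cl i \<in> A"
    and U_obj [simp]: "i \<in> I \<Longrightarrow> U i \<in> objs V"
    and eobjs_E [simp]: "eobjs E = I"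
    and ehom_E [simp]: "i \<in> I \<Longrightarrow> j \<in> I \<Longrightarrow> ehom E i j = ihom V (U i) (P (cl i) (cl j) (U j))"
    and eid_E [simp]: "i \<in> I \<Longrightarrow> eid E i = mate V (U i) \<one> (P (cl i) (cl i) (U i)) (ru (U i) \<cdot> unt (cl i) (U i))"
    and ecmp_E: "i \<in> I \<Longrightarrow> j \<in> I \<Longrightarrow> k \<in> I \<Longrightarrow>
      ecmp E i j k = mate V (U i) (ehom E i j \<odot> ehom E j k) (P (cl i) (cl k) (U k))
        (ai (U i) (ehom E i j) (ehom E j k) \<cdot> (rw (ev V (U i) (P (cl i) (cl j) (U j))) (ehom E j k) \<cdot>
          ext (cl i) (cl j) (cl k) (U j) (ehom E j k) (U k) (ev V (U j) (P (cl j) (cl k) (U k)))))"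
begin

lemma ecmp_E_typing [simp]:
  assumes "i \<in> I" "j \<in> I" "k \<in> I"
  shows "ecmp E i j k \<in> arrs V"
    "src V (ecmp E i j k) = ihom V (U i) (P (cl i) (cl j) (U j)) \<odot> ihom V (U j) (P (cl j) (cl k) (U k))"
    "trg V (ecmp E i j k) = ihom V (U i) (P (cl i) (cl k) (U k))"
  using assms by (simp_all add: ecmp_E)

lemma ecmp_E_ev [simp]:
  assumes "i \<in> I" "j \<in> I" "k \<in> I" "u = U i" "x = P (cl i) (cl k) (U k)"
  shows "lw u (ecmp E i j k) \<cdot> ev V u x =
       ai u (ehom E i j) (ehom E j k) \<cdot> (rw (ev V u (P (cl i) (cl j) (U j))) (ehom E j k) \<cdot>
          ext (cl i) (cl j) (cl k) (U j) (ehom E j k) (U k) (ev V (U j) (P (cl j) (cl k) (U k))))"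
  using assms by (simp add: ecmp_E)

lemmas ecmp_E_extend [simp] = ecmp_E_ev[THEN cmp_extend] ecmp_E_ev[THEN lw_cong]
  ecmp_E_ev[THEN rw_cong] ecmp_E_ev[THEN lw_cong, THEN cmp_extend]
  ecmp_E_ev[THEN rw_cong, THEN cmp_extend]

text \<open>After evaluation, associativity is \<open>ext_ext\<close> together with a pentagon, and
  the unit laws are \<open>unt_ext\<close> and \<open>ext_unt\<close>.\<close>

lemma enriched_category_E: "enriched_category V E"
proof unfold_locales
  fix a b c d assume "a \<in> eobjs E" "b \<in> eobjs E" "c \<in> eobjs E" "d \<in> eobjs E"
  then have [simp]: "a \<in> I" "b \<in> I" "c \<in> I" "d \<in> I" by simp_all
  show "(ecmp E a b c \<otimes> \<i>\<d> (ehom E c d)) \<cdot> ecmp E a c d =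
    assoc V (ehom E a b) (ehom E b c) (ehom E c d) \<cdot> (\<i>\<d> (ehom E a b) \<otimes> ecmp E b c d) \<cdot> ecmp E a b d"
    by (rule ev_inj[where u = "U a" and v = "P (cl a) (cl d) (U d)"])
      (simp_all add: lw_def[symmetric] rw_def[symmetric] pentagon_forms(1)[THEN cmp_extend3])
next
  fix a b assume "a \<in> eobjs E" "b \<in> eobjs E"
  then have [simp]: "a \<in> I" "b \<in> I" by simp_all
  show "(eid E a \<otimes> \<i>\<d> (ehom E a b)) \<cdot> ecmp E a a b = lunit V (ehom E a b)"
    by (rule ev_inj[where u = "U a" and v = "P (cl a) (cl b) (U b)"]) (simp_all add: rw_def[symmetric])
  show "(\<i>\<d> (ehom E a b) \<otimes> eid E b) \<cdot> ecmp E a b b = runit V (ehom E a b)"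
    by (rule ev_inj[where u = "U a" and v = "P (cl a) (cl b) (U b)"]) (simp_all add: lw_def[symmetric])
qed (auto simp: hom_def)

end

sublocale kleisli_category \<subseteq> E: enriched_category V E
  by (rule enriched_category_E)

section \<open>Self-enrichment and representable functors\<close>

context closed_monoidal_category
begin

text \<open>The identity monad on one index: extension does nothing, so Kleisli composition is
  composition in \<open>V\<close>.\<close>

lemma strong_kleisli_self:
  "strong_kleisli V UNIV (\<lambda>(_ :: unit) _ v. v) (\<lambda>_ u. \<i>\<d> u) (\<lambda>_ _ _ _ _ _ g. g)"
proof unfold_locales
  fix v y w z q g k
  assume "v \<in> objs V" "y \<in> objs V" "w \<in> objs V" "z \<in> objs V" "q \<in> objs V"
    "g \<in> hom V (v \<odot> y) w" "k \<in> hom V (w \<odot> z) q"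
  then show "rw g z \<cdot> k = as v y z \<cdot> (ai v y z \<cdot> (rw g z \<cdot> k))"
    by (auto simp: hom_def)
qed (auto simp: hom_def)

lemma kleisli_category_self:
  "kleisli_category V UNIV (\<lambda>(_ :: unit) _ v. v) (\<lambda>_ u. \<i>\<d> u) (\<lambda>_ _ _ _ _ _ g. g)
    (objs V) (\<lambda>_. ()) (\<lambda>u. u) (self_enriched V)"
  by (intro kleisli_category.intro strong_kleisli_self kleisli_category_axioms.intro)
    (simp_all add: self_enriched_def lw_def[symmetric] rw_def[symmetric] ai_def[symmetric])

lemma self_simps [simp]:
  "eobjs (self_enriched V) = objs V"
  "ehom (self_enriched V) = ihom V"
  "u \<in> objs V \<Longrightarrow> eid (self_enriched V) u = mate V u \<one> u (ru u)"
  by (simp_all add: self_enriched_def)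

sublocale self: enriched_category V "self_enriched V"
  using kleisli_category.enriched_category_E[OF kleisli_category_self] .

lemma self_ecmp [simp]:
  assumes "u \<in> objs V" "v \<in> objs V" "w \<in> objs V"
  shows "ecmp (self_enriched V) u v w \<in> arrs V"
    "src V (ecmp (self_enriched V) u v w) = ihom V u v \<odot> ihom V v w"
    "trg V (ecmp (self_enriched V) u v w) = ihom V u w"
    "lw u (ecmp (self_enriched V) u v w) \<cdot> ev V u w =
       ai u (ihom V u v) (ihom V v w) \<cdot> (rw (ev V u v) (ihom V v w) \<cdot> ev V v w)"
  using assms by (simp_all add: self_enriched_def lw_def[symmetric] rw_def[symmetric] ai_def[symmetric])

lemmas self_ecmp_extend [simp] = self_ecmp(4)[THEN cmp_extend] self_ecmp(4)[THEN lw_cong]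
  self_ecmp(4)[THEN rw_cong] self_ecmp(4)[THEN lw_cong, THEN cmp_extend]
  self_ecmp(4)[THEN rw_cong, THEN cmp_extend]

end

context enriched_category
begin

declare ehom_obj [simp]

lemma enriched_typing [simp]:
  shows "a \<in> eobjs C \<Longrightarrow> eid C a \<in> arrs V"
    "a \<in> eobjs C \<Longrightarrow> src V (eid C a) = \<one>"
    "a \<in> eobjs C \<Longrightarrow> trg V (eid C a) = ehom C a a"
    "a \<in> eobjs C \<Longrightarrow> b \<in> eobjs C \<Longrightarrow> c \<in> eobjs C \<Longrightarrow> ecmp C a b c \<in> arrs V"
    "a \<in> eobjs C \<Longrightarrow> b \<in> eobjs C \<Longrightarrow> c \<in> eobjs C \<Longrightarrow> src V (ecmp C a b c) = ehom C a b \<odot> ehom C b c"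
    "a \<in> eobjs C \<Longrightarrow> b \<in> eobjs C \<Longrightarrow> c \<in> eobjs C \<Longrightarrow> trg V (ecmp C a b c) = ehom C a c"
  using eid_hom ecmp_hom by (simp_all add: hom_def)

lemma ecmp_laws [simp]:
  shows "a \<in> eobjs C \<Longrightarrow> b \<in> eobjs C \<Longrightarrow> c \<in> eobjs C \<Longrightarrow> d \<in> eobjs C \<Longrightarrow> h = ehom C c d \<Longrightarrow>
      rw (ecmp C a b c) h \<cdot> ecmp C a c d =
      as (ehom C a b) (ehom C b c) h \<cdot> (lw (ehom C a b) (ecmp C b c d) \<cdot> ecmp C a b d)"
    and "a \<in> eobjs C \<Longrightarrow> b \<in> eobjs C \<Longrightarrow> h = ehom C a b \<Longrightarrow> rw (eid C a) h \<cdot> ecmp C a a b = lu h"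
    and "a \<in> eobjs C \<Longrightarrow> b \<in> eobjs C \<Longrightarrow> h = ehom C a b \<Longrightarrow> lw h (eid C b) \<cdot> ecmp C a b b = ru h"
  using ecmp_assoc[of a b c d] eid_ecmp[of a b] ecmp_eid[of a b]
  by (simp_all add: rw_def[symmetric] lw_def[symmetric])

lemmas ecmp_laws_extend [simp] = ecmp_laws[THEN cmp_extend] ecmp_laws(2,3)[THEN lw_cong]
  ecmp_laws(2,3)[THEN rw_cong] ecmp_laws(2,3)[THEN lw_cong, THEN cmp_extend]
  ecmp_laws(2,3)[THEN rw_cong, THEN cmp_extend]

text \<open>After evaluation, the composition law is associativity in \<open>C\<close> and the
  identity law is its right unit law.\<close>

lemma enriched_functor_representable:
  assumes [simp]: "a \<in> eobjs C"
  shows "enriched_functor V C (self_enriched V) (representable V C a)"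
proof unfold_locales
  fix b assume [simp]: "b \<in> eobjs C"
  show "eid C b \<cdot> farr (representable V C a) b b = eid (self_enriched V) (fobj (representable V C a) b)"
    by (rule ev_inj[where u = "ehom C a b" and v = "ehom C a b"]) (simp_all add: representable_def)
  fix c d assume [simp]: "c \<in> eobjs C" "d \<in> eobjs C"
  show "ecmp C b c d \<cdot> farr (representable V C a) b d =
      (farr (representable V C a) b c \<otimes> farr (representable V C a) c d) \<cdot>
      ecmp (self_enriched V) (fobj (representable V C a) b) (fobj (representable V C a) c)
         (fobj (representable V C a) d)"
    by (rule ev_inj[where u = "ehom C a b" and v = "ehom C a d"]) (simp_all add: representable_def tarr_split)
qed (simp_all add: representable_def hom_def)

end

section \<open>Tensorings of enriched Kleisli categories\<close>

context closed_monoidal_category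
begin

lemma ihom_tensor_typing [simp]:
  assumes "u \<in> objs V" "v \<in> objs V" "x \<in> objs V"
  shows "ihom_tensor V u v x \<in> arrs V" "src V (ihom_tensor V u v x) = ihom V (u \<odot> v) x"
    "trg V (ihom_tensor V u v x) = ihom V v (ihom V u x)"
  using assms by (simp_all add: ihom_tensor_def ai_def[symmetric])

lemma ihom_tensor_ev [simp]:
  assumes "u \<in> objs V" "v \<in> objs V" "x \<in> objs V" "y = ihom V u x" "z = ihom V (u \<odot> v) x"
  shows "lw v (ihom_tensor V u v x) \<cdot> ev V v y = mate V u (v \<odot> z) x (ai u v z \<cdot> ev V (u \<odot> v) x)"
  using assms by (simp add: ihom_tensor_def ai_def[symmetric])

lemmas ihom_tensor_ev_extend [simp] = ihom_tensor_ev[THEN cmp_extend] ihom_tensor_ev[THEN lw_cong]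
  ihom_tensor_ev[THEN rw_cong] ihom_tensor_ev[THEN lw_cong, THEN cmp_extend]
  ihom_tensor_ev[THEN rw_cong, THEN cmp_extend]

lemma ev_inj2:
  assumes "lw u (lw v f \<cdot> ev V v (ihom V u x)) \<cdot> ev V u x = lw u (lw v g \<cdot> ev V v (ihom V u x)) \<cdot> ev V u x"
    "u \<in> objs V" "v \<in> objs V" "x \<in> objs V" "f \<in> arrs V" "g \<in> arrs V"
    "trg V f = ihom V v (ihom V u x)" "trg V g = ihom V v (ihom V u x)" "src V f = src V g"
  shows "f = g"
proof (rule ev_inj)
  show "lw v f \<cdot> ev V v (ihom V u x) = lw v g \<cdot> ev V v (ihom V u x)"
    by (rule ev_inj[OF assms(1)]) (use assms(2-) in simp_all)
qed (use assms(2-) in simp_all)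

lemma ihom_tensor_iso:
  assumes [simp]: "u \<in> objs V" "v \<in> objs V" "x \<in> objs V"
  shows "is_iso V (ihom_tensor V u v x)"
proof -
  let ?y = "ihom V v (ihom V u x)"
  \<comment> \<open>The inverse uncurries: it is the mate of two successive evaluations.\<close>
  let ?g = "mate V (u \<odot> v) ?y x (as u v ?y \<cdot> (lw u (ev V v (ihom V u x)) \<cdot> ev V u x))"
  have "ihom_tensor V u v x \<cdot> ?g = \<i>\<d> (ihom V (u \<odot> v) x)"
    by (rule ev_inj[where u = "u \<odot> v" and v = x]) simp_all
  moreover have "?g \<cdot> ihom_tensor V u v x = \<i>\<d> ?y"
    by (rule ev_inj2[where u = u and v = v and x = x]) simp_all
  ultimately show ?thesis
    by (intro is_isoI[of _ ?g]) simp_all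
qed

end

text \<open>Tensoring with \<open>v\<close> keeps the index and tensors \<open>U i\<close> on the
  right. The hom action of \<open>ladj\<close> is that of \<open>U i \<odot> _\<close>, made a
  Kleisli arrow by the unit; \<open>tiso\<close> is plain currying of the source of a Kleisli
  arrow.\<close>

locale kleisli_tensoring = kleisli_category V A P unt ext I cl U E
  for V :: "('o, 'm) closed_monoidal_category" (structure)
    and A :: "'a set" and P unt ext and I :: "'i set" and cl U E +
  fixes T :: "('i, 'o, 'm) tensoring"
  assumes act_T [simp]: "i \<in> I \<Longrightarrow> v \<in> objs V \<Longrightarrow> act T i v \<in> I"
    and cl_act [simp]: "i \<in> I \<Longrightarrow> v \<in> objs V \<Longrightarrow> cl (act T i v) = cl i"
    and U_act [simp]: "i \<in> I \<Longrightarrow> v \<in> objs V \<Longrightarrow> U (act T i v) = U i \<odot> v"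
    and farr_ladj [simp]: "i \<in> I \<Longrightarrow> v \<in> objs V \<Longrightarrow> w \<in> objs V \<Longrightarrow> farr (ladj T i) v w =
      mate V (U i \<odot> v) (ihom V v w) (P (cl i) (cl i) (U i \<odot> w))
        (as (U i) v (ihom V v w) \<cdot> (lw (U i) (ev V v w) \<cdot> unt (cl i) (U i \<odot> w)))"
    and tiso_T [simp]: "i \<in> I \<Longrightarrow> v \<in> objs V \<Longrightarrow> j \<in> I \<Longrightarrow>
      tiso T i v j = ihom_tensor V (U i) v (P (cl i) (cl j) (U j))"
begin

text \<open>The hom action ends in \<open>unt\<close>, so \<open>unt_ext\<close> absorbs the
  extension in the composition law and a pentagon remains.\<close>

lemma enriched_functor_ladj:
  assumes [simp]: "i \<in> I"
  shows "enriched_functor V (self_enriched V) E (ladj T i)"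
proof unfold_locales
  fix v assume "v \<in> eobjs (self_enriched V)"
  then have [simp]: "v \<in> objs V" by simp
  show "eid (self_enriched V) v \<cdot> farr (ladj T i) v v = eid E (act T i v)"
    by (rule ev_inj[where u = "U i \<odot> v" and v = "P (cl i) (cl i) (U i \<odot> v)"]) simp_all
  fix w x assume "w \<in> eobjs (self_enriched V)" "x \<in> eobjs (self_enriched V)"
  then have [simp]: "w \<in> objs V" "x \<in> objs V" by simp_all
  show "ecmp (self_enriched V) v w x \<cdot> farr (ladj T i) v x =
      (farr (ladj T i) v w \<otimes> farr (ladj T i) w x) \<cdot> ecmp E (act T i v) (act T i w) (act T i x)"
    by (rule ev_inj[where u = "U i \<odot> v" and v = "P (cl i) (cl i) (U i \<odot> x)"])
      (simp_all add: tarr_split pentagon_forms(2)[THEN cmp_extend])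
qed (simp_all add: hom_def)

text \<open>Both naturality laws equate arrows into a hom object curried twice; evaluating twice
  leaves reassociations, settled by a pentagon.\<close>

lemma tensoring_E: "tensoring V E T"
proof (intro tensoring.intro tensoring_axioms.intro)
  fix i v j assume "i \<in> eobjs E" "v \<in> objs V" "j \<in> eobjs E"
  then have [simp]: "i \<in> I" "v \<in> objs V" "j \<in> I" by simp_all
  show "is_iso V (tiso T i v j)"
    by (simp add: ihom_tensor_iso)
  {
    fix k assume "k \<in> eobjs E"
    then have [simp]: "k \<in> I" by simp
    show "ecmp E (act T i v) j k \<cdot> tiso T i v k =
      (tiso T i v j \<otimes> farr (representable V E i) j k) \<cdot>
        ecmp (self_enriched V) v (ehom E i j) (ehom E i k)"
      by (rule ev_inj2[where u = "U i" and v = v and x = "P (cl i) (cl k) (U k)"])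
        (simp_all add: tarr_split representable_def pentagon_forms(3)[THEN cmp_extend3])
  next
    fix w assume [simp]: "w \<in> objs V"
    show "(farr (ladj T i) w v \<otimes> \<i>\<d> (ehom E (act T i v) j)) \<cdot>
        ecmp E (act T i w) (act T i v) j \<cdot> tiso T i w j =
      (\<i>\<d> (ihom V w v) \<otimes> tiso T i v j) \<cdot> ecmp (self_enriched V) w v (ehom E i j)"
      by (rule ev_inj2[where u = "U i" and v = w and x = "P (cl i) (cl j) (U j)"])
        (simp_all add: rw_def[symmetric] lw_def[symmetric] pentagon_forms(4)[THEN cmp_extend3])
  }
qed (simp_all add: enriched_functor_ladj hom_def E.enriched_category_axioms)

end

context closed_monoidal_category
begin

lemma kleisli_tensoring_self:
  "kleisli_tensoring V UNIV (\<lambda>(_ :: unit) _ v. v) (\<lambda>_ u. \<i>\<d> u) (\<lambda>_ _ _ _ _ _ g. g)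
    (objs V) (\<lambda>_. ()) (\<lambda>u. u) (self_enriched V) (self_tensoring V)"
  by (intro kleisli_tensoring.intro kleisli_category_self kleisli_tensoring_axioms.intro)
    (simp_all add: self_tensoring_def lw_def[symmetric])

lemma tensoring_self: "tensoring V (self_enriched V) (self_tensoring V)"
  using kleisli_tensoring.tensoring_E[OF kleisli_tensoring_self] .

end

section \<open>The completion\<close>

context enriched_category
begin

text \<open>\<open>C\<close> is viewed as a monoid in \<open>V\<close> with several objects.
  Tensoring with it on the left is a monad, with unit from \<open>eid C\<close> and multiplication
  from \<open>ecmp C\<close>; the strength in a parameter on the right is just the
  associator.\<close>

definition completion_P where "completion_P a b v = ehom C a b \<odot> v"
definition completion_unt where "completion_unt a v = li v \<cdot> rw (eid C a) v"
definition completion_ext where "completion_ext a b c v y w g =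
  as (ehom C a b) v y \<cdot> (lw (ehom C a b) g \<cdot> (ai (ehom C a b) (ehom C b c) w \<cdot> rw (ecmp C a b c) w))"

lemma strong_kleisli_completion: "strong_kleisli V (eobjs C) completion_P completion_unt completion_ext"
proof unfold_locales
  fix a b c d v y w z q g k
  assume "a \<in> eobjs C" "b \<in> eobjs C" "c \<in> eobjs C" "d \<in> eobjs C"
    "v \<in> objs V" "y \<in> objs V" "w \<in> objs V" "z \<in> objs V" "q \<in> objs V"
    "g \<in> hom V (v \<odot> y) (completion_P b c w)" "k \<in> hom V (w \<odot> z) (completion_P c d q)"
  then have [simp]: "a \<in> eobjs C" "b \<in> eobjs C" "c \<in> eobjs C" "d \<in> eobjs C"
    "v \<in> objs V" "y \<in> objs V" "w \<in> objs V" "z \<in> objs V" "q \<in> objs V"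
    "g \<in> arrs V" "src V g = v \<odot> y" "trg V g = ehom C b c \<odot> w"
    "k \<in> arrs V" "src V k = w \<odot> z" "trg V k = ehom C c d \<odot> q"
    by (simp_all add: hom_def completion_P_def)
  let ?ab = "ehom C a b" and ?bc = "ehom C b c" and ?cd = "ehom C c d" and ?ac = "ehom C a c"
  \<comment> \<open>Naming the factors keeps simp from renormalising them during the chase:
    \<open>a\<close>, \<open>b\<close>, \<open>c\<close> are structure arrows, \<open>g\<close> and
    \<open>k\<close> the whiskered Kleisli arrows, \<open>m\<close> the compositions of
    \<open>C\<close>.\<close>
  define a1 a2 a3 a4 a5 a6 where a_defs: "a1 = rw (as ?ab v y) z" "a2 = rw (ai ?ab ?bc w) z"
    "a3 = as (?ab \<odot> ?bc) w z" "a4 = ai ?ac ?cd q" "a5 = lw ?ab (as ?bc w z)" "a6 = ai (?ab \<odot> ?bc) ?cd q"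
  define b1 b2 b3 b4 b5 b6 where b_defs: "b1 = as (?ab \<odot> v) y z" "b2 = as ?ab v (y \<odot> z)"
    "b3 = lw ?ab (ai v y z)" "b4 = lw ?ab (ai ?bc ?cd q)" "b5 = ai ?ab (?bc \<odot> ?cd) q" "b6 = rw (as ?ab ?bc ?cd) q"
  define c1 c2 c3 c4 where c_defs: "c1 = as ?ab (v \<odot> y) z" "c2 = as ?ab (?bc \<odot> w) z"
    "c3 = as ?ab ?bc (w \<odot> z)" "c4 = as ?ab ?bc (?cd \<odot> q)"
  define g1 g2 k1 k2 k3 where gk_defs: "g1 = rw (lw ?ab g) z" "g2 = lw ?ab (rw g z)"
    "k1 = lw ?ac k" "k2 = lw ?ab (lw ?bc k)" "k3 = lw (?ab \<odot> ?bc) k"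
  define m1 m2 m3 m4 m5 m6 where m_defs: "m1 = rw (ecmp C a b c) (w \<odot> z)" "m2 = rw (ecmp C a c d) q"
    "m3 = rw (lw ?ab (ecmp C b c d)) q" "m4 = rw (ecmp C a b d) q" "m5 = rw (rw (ecmp C a b c) ?cd) q"
    "m6 = rw (ecmp C a b c) (?cd \<odot> q)"
  note defs = a_defs b_defs c_defs gk_defs m_defs
  \<comment> \<open>The cells of the diagram: pentagons (1, 3, 5), naturality of the associator (2,
    4, 7), associativity of \<open>C\<close> (6) and interchange (8).\<close>
  have eqs: "b1 \<cdot> (b2 \<cdot> b3) = a1 \<cdot> c1" "c1 \<cdot> g2 = g1 \<cdot> c2" "c2 \<cdot> a5 = a2 \<cdot> (a3 \<cdot> c3)"
    "c3 \<cdot> k2 = k3 \<cdot> c4" "c4 \<cdot> (b4 \<cdot> b5) = a6 \<cdot> b6" "b6 \<cdot> (m3 \<cdot> m4) = m5 \<cdot> m2" "a6 \<cdot> m5 = m6 \<cdot> a4"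
    "k3 \<cdot> m6 = m1 \<cdot> k1"
    using ecmp_laws(1)[THEN rw_cong, of a b c d ?cd q]
    by (simp_all add: defs pentagon_forms(5-7))
  have typing [simp]: "f \<in> arrs V" if "f \<in> {a1, a2, a3, a4, a5, a6, b1, b2, b3, b4, b5, b6, c1, c2, c3, c4,
    g1, g2, k1, k2, k3, m1, m2, m3, m4, m5, m6}" for f
    using that by (auto simp: defs)
  have [simp]: "src V b1 = src V a1" "src V b2 = trg V b1" "src V b3 = trg V b2" "trg V b3 = trg V c1"
    "src V c1 = trg V a1" "src V g2 = trg V c1" "src V g1 = trg V a1" "src V c2 = trg V g1" "trg V g2 = trg V c2"
    "src V a5 = trg V c2" "src V a2 = trg V g1" "src V a3 = trg V a2" "src V c3 = trg V a3" "trg V a5 = trg V c3"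
    "src V k2 = trg V c3" "src V k3 = trg V a3" "src V c4 = trg V k3" "trg V k2 = trg V c4"
    "src V b4 = trg V c4" "src V b5 = trg V b4" "src V a6 = trg V k3" "src V b6 = trg V a6" "trg V b5 = trg V b6"
    "src V m3 = trg V b6" "src V m4 = trg V m3" "src V m5 = trg V a6" "src V m2 = trg V m5" "trg V m4 = trg V m2"
    "src V m6 = trg V k3" "src V a4 = trg V m6" "trg V a4 = trg V m5"
    "src V m1 = trg V a3" "src V k1 = trg V m1" "trg V k1 = trg V m6"
    by (simp_all add: defs)
  have "a1 \<cdot> (g1 \<cdot> (a2 \<cdot> (a3 \<cdot> (m1 \<cdot> (k1 \<cdot> (a4 \<cdot> m2))))))
    = b1 \<cdot> (b2 \<cdot> (b3 \<cdot> (g2 \<cdot> (a5 \<cdot> (k2 \<cdot> (b4 \<cdot> (b5 \<cdot> (m3 \<cdot> m4))))))))"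
    by (simp add: eqs(1,5)[THEN cmp_extend3] eqs(2-4,7,8)[THEN cmp_extend] eqs(6))
  then show "rw (completion_ext a b c v y w g) z \<cdot> completion_ext a c d w z q k =
      as (completion_P a b v) y z \<cdot> completion_ext a b d v (y \<odot> z) q (ai v y z \<cdot> (rw g z \<cdot> completion_ext b c d w z q k))"
    by (simp add: completion_P_def completion_ext_def defs)
next
  fix a b v y w g
  assume "a \<in> eobjs C" "b \<in> eobjs C"
    "v \<in> objs V" "y \<in> objs V" "w \<in> objs V"
    "g \<in> hom V (v \<odot> y) (completion_P a b w)"
  then have [simp]: "a \<in> eobjs C" "b \<in> eobjs C" "v \<in> objs V" "y \<in> objs V" "w \<in> objs V"
    "g \<in> arrs V" "src V g = v \<odot> y" "trg V g = ehom C a b \<odot> w"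
    by (simp_all add: hom_def completion_P_def)
  \<comment> \<open>The unit law of \<open>C\<close> can absorb \<open>eid\<close> only after it has
    moved behind \<open>g\<close>, against the orientation of \<open>whisker_swap\<close>.\<close>
  have "rw (eid C a) (v \<odot> y) \<cdot> lw (ehom C a a) g = lw \<one> g \<cdot> rw (eid C a) (ehom C a b \<odot> w)"
    by simp
  from cmp_extend[OF this] show "rw (completion_unt a v) y \<cdot> completion_ext a a b v y w g = g"
    by (simp add: completion_P_def completion_ext_def completion_unt_def del: whisker_swap whisker_swap')
next
  fix a b v
  assume "a \<in> eobjs C" "b \<in> eobjs C" "v \<in> objs V"
  then show "completion_ext a b b v \<one> v (ru v \<cdot> completion_unt b v) = ru (completion_P a b v)"
    by (auto simp: hom_def completion_P_def completion_ext_def completion_unt_def)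
qed (auto simp: hom_def completion_P_def completion_unt_def completion_ext_def)

lemma kleisli_category_completion:
  "kleisli_category V (eobjs C) completion_P completion_unt completion_ext (eobjs C \<times> objs V) fst snd (completion V C)"
proof -
  interpret strong_kleisli V "eobjs C" completion_P completion_unt completion_ext
    by (rule strong_kleisli_completion)
  show ?thesis
    by unfold_locales (auto simp: completion_def completion_P_def completion_unt_def completion_ext_def Let_def
      lw_def[symmetric] rw_def[symmetric] ai_def[symmetric] li_def[symmetric])
qed

lemma kleisli_tensoring_completion:
  "kleisli_tensoring V (eobjs C) completion_P completion_unt completion_ext (eobjs C \<times> objs V) fst snd
    (completion V C) (completion_tensoring V C)"
  by (intro kleisli_tensoring.intro kleisli_category_completion kleisli_tensoring_axioms.intro)
    (auto simp: completion_tensoring_def completion_P_def completion_unt_def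
      lw_def[symmetric] rw_def[symmetric] ai_def[symmetric] li_def[symmetric])

lemma enriched_functor_embedding:
  "enriched_functor V C (completion V C) (completion_embedding V C)"
proof -
  interpret K: kleisli_category V "eobjs C" completion_P completion_unt completion_ext "eobjs C \<times> objs V" fst snd "completion V C"
    by (rule kleisli_category_completion)
  interpret K: enriched_category V "completion V C"
    by (rule K.enriched_category_E)
  show ?thesis
  proof unfold_locales
    fix a assume [simp]: "a \<in> eobjs C"
    show "eid C a \<cdot> farr (completion_embedding V C) a a = eid (completion V C) (fobj (completion_embedding V C) a)"
      by (rule ev_inj[where u = \<one> and v = "ehom C a a \<odot> \<one>"])
        (simp_all add: completion_embedding_def ri_def[symmetric] completion_P_def completion_unt_def lu_one li_one)
    fix b c assume [simp]: "b \<in> eobjs C" "c \<in> eobjs C"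
    show "ecmp C a b c \<cdot> farr (completion_embedding V C) a c =
      (farr (completion_embedding V C) a b \<otimes> farr (completion_embedding V C) b c) \<cdot>
      ecmp (completion V C) (fobj (completion_embedding V C) a) (fobj (completion_embedding V C) b)
        (fobj (completion_embedding V C) c)"
      by (rule ev_inj[where u = \<one> and v = "ehom C a c \<odot> \<one>"])
        (simp_all add: completion_embedding_def ri_def[symmetric] completion_P_def completion_ext_def tarr_split)
  qed (auto simp: completion_embedding_def hom_def ri_def[symmetric] completion_P_def)
qed

text \<open>Full faithfulness of the embedding: \<open>ihom V \<one> X\<close> is isomorphic to
  \<open>X\<close> by evaluation at the unit, up to unitors.\<close>

lemma embedding_iso:
  assumes [simp]: "a \<in> eobjs C" "b \<in> eobjs C"
  shows "is_iso V (farr (completion_embedding V C) a b)"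
proof -
  let ?x = "ehom C a b"
  let ?f = "mate V \<one> ?x (?x \<odot> \<one>) (lu ?x \<cdot> ri ?x)"
    and ?g = "li (ihom V \<one> (?x \<odot> \<one>)) \<cdot> (ev V \<one> (?x \<odot> \<one>) \<cdot> ru ?x)"
  have "?f \<cdot> ?g = ?f \<cdot> li (ihom V \<one> (?x \<odot> \<one>)) \<cdot> (ev V \<one> (?x \<odot> \<one>) \<cdot> ru ?x)"
    by simp
  \<comment> \<open>Naturality of \<open>li\<close> puts \<open>?f\<close> under
    \<open>lw \<one>\<close>, where the beta rule applies.\<close>
  also have "?f \<cdot> li (ihom V \<one> (?x \<odot> \<one>)) = li ?x \<cdot> lw \<one> ?f"
    by simp
  also have "\<dots> \<cdot> (ev V \<one> (?x \<odot> \<one>) \<cdot> ru ?x) = li ?x \<cdot> (lw \<one> ?f \<cdot> (ev V \<one> (?x \<odot> \<one>) \<cdot> ru ?x))"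
    by (intro cmp_assoc') simp_all
  finally have 1: "?f \<cdot> ?g = \<i>\<d> ?x" by simp
  have 2: "?g \<cdot> ?f = \<i>\<d> (ihom V \<one> (?x \<odot> \<one>))"
    by (rule ev_inj[where u = \<one> and v = "?x \<odot> \<one>"]) simp_all
  show ?thesis
    unfolding completion_embedding_def ri_def[symmetric] enriched_functor.simps
    by (rule is_isoI[of _ ?g]) (use 1 2 in simp_all)
qed

end

section \<open>Composition with underlying arrows\<close>

context enriched_category
begin

text \<open>\<open>pre\<close> and \<open>post\<close> turn an underlying arrow into an arrow of
  \<open>V\<close> between hom objects. Composition of underlying arrows and enriched naturality
  thereby become equations between plain composites in \<open>V\<close>, free of unitors.\<close>

definition pre where "pre x' x y \<theta> = li (ehom C x y) \<cdot> (rw \<theta> (ehom C x y) \<cdot> ecmp C x' x y)"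
definition post where "post x y y' \<phi> = ri (ehom C x y) \<cdot> (lw (ehom C x y) \<phi> \<cdot> ecmp C x y y')"

lemma pre_typing [simp]:
  assumes "x \<in> eobjs C" "x' \<in> eobjs C" "y \<in> eobjs C" "\<theta> \<in> arrs V" "src V \<theta> = \<one>" "trg V \<theta> = ehom C x' x"
  shows "pre x' x y \<theta> \<in> arrs V" "src V (pre x' x y \<theta>) = ehom C x y" "trg V (pre x' x y \<theta>) = ehom C x' y"
  using assms by (simp_all add: pre_def)

lemma post_typing [simp]:
  assumes "x \<in> eobjs C" "y \<in> eobjs C" "y' \<in> eobjs C" "\<phi> \<in> arrs V" "src V \<phi> = \<one>" "trg V \<phi> = ehom C y y'"
  shows "post x y y' \<phi> \<in> arrs V" "src V (post x y y' \<phi>) = ehom C x y" "trg V (post x y y' \<phi>) = ehom C x y'"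
  using assms by (simp_all add: post_def)

text \<open>Associativity of \<open>C\<close> with an underlying arrow in the third place;
  \<open>ecmp_pre\<close> and \<open>post_ecmp\<close> have it in the first and in the
  second.\<close>

lemma ecmp_post:
  assumes [simp]: "x \<in> eobjs C" "y \<in> eobjs C" "z \<in> eobjs C" "z' \<in> eobjs C"
    and [simp]: "\<psi> \<in> arrs V" "src V \<psi> = \<one>" "trg V \<psi> = ehom C z z'"
  shows "ecmp C x y z \<cdot> post x z z' \<psi> = lw (ehom C x y) (post y z z' \<psi>) \<cdot> ecmp C x y z'"
proof -
  let ?h = "ehom C"
  have "ecmp C x y z \<cdot> post x z z' \<psi> = ri (?h x y \<odot> ?h y z) \<cdot> rw (ecmp C x y z) \<one> \<cdot> (lw (?h x z) \<psi> \<cdot> ecmp C x z z')"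
    by (simp add: post_def)
  also have "\<dots> = ri (?h x y \<odot> ?h y z) \<cdot> (lw (?h x y \<odot> ?h y z) \<psi> \<cdot> rw (ecmp C x y z) (?h z z') \<cdot> ecmp C x z z')"
    by (simp del: ecmp_laws ecmp_laws_extend ri_nat structure_nat_extend)
  also have "lw (?h x y \<odot> ?h y z) \<psi> \<cdot> rw (ecmp C x y z) (?h z z') \<cdot> ecmp C x z z'
    = lw (?h x y \<odot> ?h y z) \<psi> \<cdot> (rw (ecmp C x y z) (?h z z') \<cdot> ecmp C x z z')"
    by (intro cmp_assoc') simp_all
  finally show ?thesis
    by (simp add: post_def)
qed

lemma ecmp_pre:
  assumes [simp]: "x \<in> eobjs C" "y \<in> eobjs C" "z \<in> eobjs C" "w \<in> eobjs C"
    and [simp]: "\<theta> \<in> arrs V" "src V \<theta> = \<one>" "trg V \<theta> = ehom C x y"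
  shows "ecmp C y z w \<cdot> pre x y w \<theta> = rw (pre x y z \<theta>) (ehom C z w) \<cdot> ecmp C x z w"
proof -
  let ?h = "ehom C"
  have "ecmp C y z w \<cdot> pre x y w \<theta> = ecmp C y z w \<cdot> li (?h y w) \<cdot> (rw \<theta> (?h y w) \<cdot> ecmp C x y w)"
    by (simp add: pre_def)
  also have "ecmp C y z w \<cdot> li (?h y w) = li (?h y z \<odot> ?h z w) \<cdot> lw \<one> (ecmp C y z w)"
    by simp
  also have "\<dots> \<cdot> (rw \<theta> (?h y w) \<cdot> ecmp C x y w) =
      li (?h y z \<odot> ?h z w) \<cdot> (rw \<theta> (?h y z \<odot> ?h z w) \<cdot> (lw (?h x y) (ecmp C y z w) \<cdot> ecmp C x y w))"
    by (simp del: li_nat structure_nat_extend)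
  also have "lw (?h x y) (ecmp C y z w) \<cdot> ecmp C x y w =
      ai (?h x y) (?h y z) (?h z w) \<cdot> (rw (ecmp C x y z) (?h z w) \<cdot> ecmp C x z w)"
    by simp
  finally show ?thesis
    by (simp add: pre_def del: ecmp_laws ecmp_laws_extend)
qed

lemma post_ecmp:
  assumes "x \<in> eobjs C" "y \<in> eobjs C" "y' \<in> eobjs C" "z \<in> eobjs C"
    "\<phi> \<in> arrs V" "src V \<phi> = \<one>" "trg V \<phi> = ehom C y y'"
  shows "rw (post x y y' \<phi>) (ehom C y' z) \<cdot> ecmp C x y' z = lw (ehom C x y) (pre y y' z \<phi>) \<cdot> ecmp C x y z"
  using assms by (simp add: post_def pre_def)

lemma post_post:
  assumes [simp]: "x \<in> eobjs C" "y \<in> eobjs C" "z \<in> eobjs C" "w \<in> eobjs C"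
    and [simp]: "\<phi> \<in> arrs V" "src V \<phi> = \<one>" "trg V \<phi> = ehom C y z" "\<psi> \<in> arrs V" "src V \<psi> = \<one>" "trg V \<psi> = ehom C z w"
  shows "post x y z \<phi> \<cdot> post x z w \<psi> = post x y w (\<phi> \<cdot> post y z w \<psi>)"
  using ecmp_post[of x y z w \<psi>] by (simp add: post_def[of x y])

lemma pre_pre:
  assumes [simp]: "x \<in> eobjs C" "y \<in> eobjs C" "z \<in> eobjs C" "w \<in> eobjs C"
    and [simp]: "\<theta> \<in> arrs V" "src V \<theta> = \<one>" "trg V \<theta> = ehom C y z" "\<theta>' \<in> arrs V" "src V \<theta>' = \<one>" "trg V \<theta>' = ehom C x y"
  shows "pre y z w \<theta> \<cdot> pre x y w \<theta>' = pre x z w (\<theta> \<cdot> pre x y z \<theta>')"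
  using ecmp_pre[of x y z w \<theta>'] by (simp add: pre_def[of _ z])

lemma pre_post:
  assumes [simp]: "x \<in> eobjs C" "y \<in> eobjs C" "z \<in> eobjs C" "w \<in> eobjs C"
    and [simp]: "\<theta> \<in> arrs V" "src V \<theta> = \<one>" "trg V \<theta> = ehom C x y" "\<phi> \<in> arrs V" "src V \<phi> = \<one>" "trg V \<phi> = ehom C z w"
  shows "post y z w \<phi> \<cdot> pre x y w \<theta> = pre x y z \<theta> \<cdot> post x z w \<phi>"
  using ecmp_pre[of x y z w \<theta>] by (simp add: post_def)

lemma pre_eid: "a \<in> eobjs C \<Longrightarrow> b \<in> eobjs C \<Longrightarrow> pre a a b (eid C a) = \<i>\<d> (ehom C a b)"
  and post_eid: "a \<in> eobjs C \<Longrightarrow> b \<in> eobjs C \<Longrightarrow> post a b b (eid C b) = \<i>\<d> (ehom C a b)"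
  by (simp_all add: pre_def post_def)

lemma und_cmp_post:
  assumes [simp]: "a \<in> eobjs C" "b \<in> eobjs C" "c \<in> eobjs C" "f \<in> arrs V" "src V f = \<one>" "trg V f = ehom C a b"
    "g \<in> arrs V" "src V g = \<one>" "trg V g = ehom C b c"
  shows "und_cmp V C a b c f g = f \<cdot> post a b c g"
proof -
  have "und_cmp V C a b c f g = ri \<one> \<cdot> rw f \<one> \<cdot> (lw (ehom C a b) g \<cdot> ecmp C a b c)"
    by (simp add: und_cmp_def li_def[symmetric] li_one tarr_split del: ri_nat structure_nat_extend)
  then show ?thesis
    by (simp add: post_def)
qed

text \<open>Both sides are \<open>und_cmp V C a b c f g\<close>; on the right, naturality of
  \<open>li\<close> plays the part that naturality of \<open>ri\<close> has in
  \<open>und_cmp_post\<close>.\<close>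

lemma und_cmp_pre:
  assumes [simp]: "a \<in> eobjs C" "b \<in> eobjs C" "c \<in> eobjs C" "f \<in> arrs V" "src V f = \<one>" "trg V f = ehom C a b"
    "g \<in> arrs V" "src V g = \<one>" "trg V g = ehom C b c"
  shows "f \<cdot> post a b c g = g \<cdot> pre a b c f"
proof -
  have "g \<cdot> pre a b c f = g \<cdot> li (ehom C b c) \<cdot> (rw f (ehom C b c) \<cdot> ecmp C a b c)"
    by (simp add: pre_def)
  also have "g \<cdot> li (ehom C b c) = li \<one> \<cdot> lw \<one> g"
    by simp
  finally have "g \<cdot> pre a b c f = li \<one> \<cdot> (rw f \<one> \<cdot> (lw (ehom C a b) g \<cdot> ecmp C a b c))"
    by (simp del: li_nat structure_nat_extend)
  also have "\<dots> = und_cmp V C a b c f g"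
    by (simp add: und_cmp_def li_def[symmetric] tarr_split del: li_nat structure_nat_extend)
  finally show ?thesis
    by (simp add: und_cmp_post)
qed

lemma eid_post [simp]:
  assumes "a \<in> eobjs C" "b \<in> eobjs C" "f \<in> arrs V" "src V f = \<one>" "trg V f = ehom C a b"
  shows "eid C a \<cdot> post a a b f = f" "eid C b \<cdot> pre a b b f = f"
  using und_cmp_pre[of a a b "eid C a" f] und_cmp_pre[of a b b f "eid C b"] assms
  by (simp_all add: pre_eid post_eid)

lemma und_iso_iff:
  assumes "a \<in> eobjs C" "b \<in> eobjs C"
  shows "und_iso V C a b f \<longleftrightarrow> f \<in> arrs V \<and> src V f = \<one> \<and> trg V f = ehom C a b \<and>
    (\<exists>g. g \<in> arrs V \<and> src V g = \<one> \<and> trg V g = ehom C b a \<and> f \<cdot> post a b a g = eid C a \<and> g \<cdot> post b a b f = eid C b)"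
  using assms unfolding und_iso_def und_hom_def hom_def by (auto simp: und_cmp_post)

lemma und_iso_trans:
  assumes [simp]: "a \<in> eobjs C" "b \<in> eobjs C" "c \<in> eobjs C" and f: "und_iso V C a b f" and g: "und_iso V C b c g"
  shows "und_iso V C a c (f \<cdot> post a b c g)"
proof -
  obtain f' where [simp]: "f \<in> arrs V" "src V f = \<one>" "trg V f = ehom C a b"
    "f' \<in> arrs V" "src V f' = \<one>" "trg V f' = ehom C b a" and
    ff: "f \<cdot> post a b a f' = eid C a" "f' \<cdot> post b a b f = eid C b"
    using f by (auto simp: und_iso_iff)
  obtain g' where [simp]: "g \<in> arrs V" "src V g = \<one>" "trg V g = ehom C b c"
    "g' \<in> arrs V" "src V g' = \<one>" "trg V g' = ehom C c b" and
    gg: "g \<cdot> post b c b g' = eid C b" "g' \<cdot> post c b c g = eid C c"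
    using g by (auto simp: und_iso_iff)
  have "f \<cdot> post a b c g \<cdot> post a c a (g' \<cdot> post c b a f') = f \<cdot> (post a b c g \<cdot> post a c b g' \<cdot> post a b a f')"
    by (simp add: post_post[symmetric])
  also have "post a b c g \<cdot> post a c b g' = \<i>\<d> (ehom C a b)"
    by (simp add: post_post gg post_eid)
  finally have 1: "f \<cdot> post a b c g \<cdot> post a c a (g' \<cdot> post c b a f') = eid C a"
    by (simp add: ff)
  have "g' \<cdot> post c b a f' \<cdot> post c a c (f \<cdot> post a b c g) = g' \<cdot> (post c b a f' \<cdot> post c a b f \<cdot> post c b c g)"
    by (simp add: post_post[symmetric])
  also have "post c b a f' \<cdot> post c a b f = \<i>\<d> (ehom C c b)"
    by (simp add: post_post ff post_eid)
  finally have 2: "g' \<cdot> post c b a f' \<cdot> post c a c (f \<cdot> post a b c g) = eid C c"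
    by (simp add: gg)
  show ?thesis
    by (subst und_iso_iff) (use 1 2 in \<open>auto intro!: exI[of _ "g' \<cdot> post c b a f'"]\<close>)
qed

lemma und_iso_sym:
  assumes "a \<in> eobjs C" "b \<in> eobjs C" "und_iso V C a b f"
  shows "\<exists>g. und_iso V C b a g"
  using assms by (auto simp: und_iso_iff)

end

context enriched_functor
begin

declare fobj_obj [simp]

lemma farr_typing [simp]:
  assumes "a \<in> eobjs C" "b \<in> eobjs C"
  shows "farr F a b \<in> arrs V" "src V (farr F a b) = ehom C a b" "trg V (farr F a b) = ehom D (fobj F a) (fobj F b)"
  using farr_hom[OF assms] by (simp_all add: hom_def)

lemma farr_ecmp':
  assumes "a \<in> eobjs C" "b \<in> eobjs C" "c \<in> eobjs C"
  shows "ecmp C a b c \<cdot> farr F a c = C.rw (farr F a b) (ehom C b c) \<cdot>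
    (C.lw (ehom D (fobj F a) (fobj F b)) (farr F b c) \<cdot> ecmp D (fobj F a) (fobj F b) (fobj F c))"
  using farr_ecmp[OF assms] assms by (simp add: C.tarr_split)

lemma post_farr:
  assumes [simp]: "x \<in> eobjs C" "y \<in> eobjs C" "z \<in> eobjs C"
    and [simp]: "\<phi> \<in> arrs V" "src V \<phi> = \<one>" "trg V \<phi> = ehom C y z"
  shows "C.post x y z \<phi> \<cdot> farr F x z = farr F x y \<cdot> D.post (fobj F x) (fobj F y) (fobj F z) (\<phi> \<cdot> farr F y z)"
  by (simp add: C.post_def D.post_def farr_ecmp')

lemma pre_farr:
  assumes [simp]: "x \<in> eobjs C" "y \<in> eobjs C" "z \<in> eobjs C"
    and [simp]: "\<theta> \<in> arrs V" "src V \<theta> = \<one>" "trg V \<theta> = ehom C x y"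
  shows "C.pre x y z \<theta> \<cdot> farr F x z = farr F y z \<cdot> D.pre (fobj F x) (fobj F y) (fobj F z) (\<theta> \<cdot> farr F x y)"
proof -
  let ?D = "\<lambda>x y. ehom D (fobj F x) (fobj F y)"
  have "farr F y z \<cdot> D.pre (fobj F x) (fobj F y) (fobj F z) (\<theta> \<cdot> farr F x y) =
      farr F y z \<cdot> C.li (?D y z) \<cdot> (C.rw (\<theta> \<cdot> farr F x y) (?D y z) \<cdot> ecmp D (fobj F x) (fobj F y) (fobj F z))"
    by (simp add: D.pre_def)
  also have "farr F y z \<cdot> C.li (?D y z) = C.li (ehom C y z) \<cdot> C.lw \<one> (farr F y z)"
    by simp
  finally show ?thesis
    by (simp add: C.pre_def farr_ecmp' del: C.li_nat C.structure_nat_extend)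
qed

end

section \<open>Universal property of the tensoring unit\<close>

context tensoring
begin

lemma act_obj [simp]: "a \<in> eobjs C \<Longrightarrow> v \<in> objs V \<Longrightarrow> act T a v \<in> eobjs C"
  using enriched_functor.fobj_obj[OF ladj_functor] by simp

lemma tiso_typing [simp]:
  assumes "a \<in> eobjs C" "v \<in> objs V" "b \<in> eobjs C"
  shows "tiso T a v b \<in> arrs V" "src V (tiso T a v b) = ehom C (act T a v) b"
    "trg V (tiso T a v b) = ihom V v (ehom C a b)"
  using tiso_hom[OF assms] by (simp_all add: hom_def)

lemma tunit_eq:
  assumes "a \<in> eobjs C" "v \<in> objs V"
  shows "tunit V C T a v = ri v \<cdot> (lw v (eid C (act T a v) \<cdot> tiso T a v (act T a v)) \<cdot> ev V v (ehom C a (act T a v)))"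
  using assms by (simp add: tunit_def tunmate_def unmate_eq ri_def[symmetric])

lemma tunit_typing [simp]:
  assumes "a \<in> eobjs C" "v \<in> objs V"
  shows "tunit V C T a v \<in> arrs V" "src V (tunit V C T a v) = v" "trg V (tunit V C T a v) = ehom C a (act T a v)"
  using assms by (simp_all add: tunit_eq)

text \<open>The Yoneda argument: naturality of \<open>tiso\<close> in its last variable, evaluated at an identity.\<close>

lemma tiso_ev:
  assumes [simp]: "a \<in> eobjs C" "v \<in> objs V" "b \<in> eobjs C"
  shows "lw v (tiso T a v b) \<cdot> ev V v (ehom C a b) =
    rw (tunit V C T a v) (ehom C (act T a v) b) \<cdot> ecmp C a (act T a v) b"
proof -
  let ?c = "act T a v"
  have "tiso T a v b = li (ehom C ?c b) \<cdot> (rw (eid C ?c) (ehom C ?c b) \<cdot> (ecmp C ?c ?c b \<cdot> tiso T a v b))"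
    by simp
  also have "ecmp C ?c ?c b \<cdot> tiso T a v b = (tiso T a v ?c \<otimes> farr (representable V C a) ?c b) \<cdot>
        ecmp (self_enriched V) v (ehom C a ?c) (ehom C a b)"
    by (rule tiso_nat_right) simp_all
  finally have "tiso T a v b = li (ehom C ?c b) \<cdot> (rw (eid C ?c) (ehom C ?c b) \<cdot>
    ((tiso T a v ?c \<otimes> farr (representable V C a) ?c b) \<cdot> ecmp (self_enriched V) v (ehom C a ?c) (ehom C a b)))" .
  then show ?thesis
    by (simp add: tarr_split representable_def tunit_eq)
qed

text \<open>The right-hand side is \<open>tunmate V C T a v b g\<close> unfolded: by the Yoneda form
  \<open>tiso_ev\<close>, transposing \<open>g\<close> amounts to composing the unit with
  it.\<close>

lemma tunit_post:
  assumes [simp]: "a \<in> eobjs C" "v \<in> objs V" "b \<in> eobjs C" "g \<in> arrs V" "src V g = \<one>" "trg V g = ehom C (act T a v) b"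
  shows "tunit V C T a v \<cdot> post a (act T a v) b g = ri v \<cdot> (lw v (g \<cdot> tiso T a v b) \<cdot> ev V v (ehom C a b))"
proof -
  let ?c = "act T a v"
  have "tunit V C T a v \<cdot> post a ?c b g =
      ri v \<cdot> rw (tunit V C T a v) \<one> \<cdot> (lw (ehom C a ?c) g \<cdot> ecmp C a ?c b)"
    by (simp add: post_def)
  then show ?thesis
    by (simp add: tiso_ev del: ri_nat structure_nat_extend)
qed

text \<open>The uniqueness half of the universal property: \<open>ri\<close>, evaluation and
  \<open>tiso\<close> are cancelled in turn. The existence half is
  \<open>tunit_post_tmate\<close>.\<close>

lemma tunit_post_inj:
  assumes "tunit V C T a v \<cdot> post a (act T a v) b g = tunit V C T a v \<cdot> post a (act T a v) b g'"
    and [simp]: "a \<in> eobjs C" "v \<in> objs V" "b \<in> eobjs C"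
      "g \<in> arrs V" "src V g = \<one>" "trg V g = ehom C (act T a v) b"
      "g' \<in> arrs V" "src V g' = \<one>" "trg V g' = ehom C (act T a v) b"
  shows "g = g'"
proof -
  have "lw v (g \<cdot> tiso T a v b) \<cdot> ev V v (ehom C a b) = lw v (g' \<cdot> tiso T a v b) \<cdot> ev V v (ehom C a b)"
    by (rule iso_cancel_left[OF ri_iso[of v]]) (use assms(1) in \<open>simp_all add: tunit_post\<close>)
  then have "g \<cdot> tiso T a v b = g' \<cdot> tiso T a v b"
    by (rule ev_inj) simp_all
  then show ?thesis
    by (rule iso_cancel_right[OF tiso_iso[OF assms(2-4)]]) simp_all
qed

lemma tmate_typing [simp]:
  assumes "a \<in> eobjs C" "v \<in> objs V" "b \<in> eobjs C" "h \<in> arrs V" "src V h = v" "trg V h = ehom C a b"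
  shows "tmate V C T a v b h \<in> arrs V" "src V (tmate V C T a v b h) = \<one>"
    "trg V (tmate V C T a v b h) = ehom C (act T a v) b"
  using assms iso_simps[OF tiso_iso[of a v b]] by (simp_all add: tmate_def)

lemma tmate_tiso:
  assumes "a \<in> eobjs C" "v \<in> objs V" "b \<in> eobjs C" "h \<in> arrs V" "src V h = v" "trg V h = ehom C a b"
  shows "tmate V C T a v b h \<cdot> tiso T a v b = mate V v \<one> (ehom C a b) (ru v \<cdot> h)"
  using assms iso_simps[OF tiso_iso[of a v b]] by (simp add: tmate_def)

lemma tunit_post_tmate:
  assumes [simp]: "a \<in> eobjs C" "v \<in> objs V" "b \<in> eobjs C" "h \<in> arrs V" "src V h = v" "trg V h = ehom C a b"
  shows "tunit V C T a v \<cdot> post a (act T a v) b (tmate V C T a v b h) = h"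
  by (simp add: tunit_post tmate_tiso del: whisker_cmp)

end

section \<open>Fully faithful functors\<close>

lemma enriched_functor_cmp:
  assumes "enriched_functor V C D F" "enriched_functor V D E G"
  shows "enriched_functor V C E (cmp_functor V F G)"
proof -
  interpret F: enriched_functor V C D F by fact
  interpret G: enriched_functor V D E G by fact
  show ?thesis
  proof unfold_locales
    fix a b c assume [simp]: "a \<in> eobjs C" "b \<in> eobjs C" "c \<in> eobjs C"
    show "eid C a \<cdot>\<^bsub>V\<^esub> farr (cmp_functor V F G) a a = eid E (fobj (cmp_functor V F G) a)"
      using F.C.cmp_extend[OF F.farr_eid[of a]] G.farr_eid[of "fobj F a"] by (simp add: cmp_functor_def)
    show "ecmp C a b c \<cdot>\<^bsub>V\<^esub> farr (cmp_functor V F G) a c =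
      (farr (cmp_functor V F G) a b \<otimes>\<^bsub>V\<^esub> farr (cmp_functor V F G) b c) \<cdot>\<^bsub>V\<^esub>
      ecmp E (fobj (cmp_functor V F G) a) (fobj (cmp_functor V F G) b) (fobj (cmp_functor V F G) c)"
      using F.C.cmp_extend[OF F.farr_ecmp'[of a b c]] G.farr_ecmp'[of "fobj F a" "fobj F b" "fobj F c"]
      by (simp add: cmp_functor_def F.C.tarr_split)
  qed (simp_all add: cmp_functor_def hom_def)
qed

lemma enriched_functor_id:
  assumes "enriched_category V C"
  shows "enriched_functor V C C (id_functor V C)"
proof -
  interpret enriched_category V C by fact
  show ?thesis
    by unfold_locales (simp_all add: id_functor_def hom_def tarr_split)
qed

lemma (in monoidal_category) tarr_split':
  assumes "f \<in> arrs V" "g \<in> arrs V"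
  shows "f \<otimes> g = lw (src V f) g \<cdot> rw f (trg V g)"
  using assms by (simp add: tarr_split)

text \<open>Naturality is restated through \<open>post\<close> and \<open>pre\<close>, so that later
  verifications avoid the unitors of the definition.\<close>

lemma enriched_nat_isoI:
  assumes F: "enriched_functor V C D F" and G: "enriched_functor V C D G"
    and \<theta>: "\<And>a. a \<in> eobjs C \<Longrightarrow> und_iso V D (fobj F a) (fobj G a) (\<theta> a)"
    and nat: "\<And>a b. a \<in> eobjs C \<Longrightarrow> b \<in> eobjs C \<Longrightarrow>
      farr F a b \<cdot>\<^bsub>V\<^esub> enriched_category.post V D (fobj F a) (fobj F b) (fobj G b) (\<theta> b) =
      farr G a b \<cdot>\<^bsub>V\<^esub> enriched_category.pre V D (fobj F a) (fobj G a) (fobj G b) (\<theta> a)"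
  shows "enriched_nat_iso V C D F G \<theta>"
proof -
  interpret F: enriched_functor V C D F by fact
  interpret G: enriched_functor V C D G by fact
  show ?thesis
  proof unfold_locales
    fix a b assume [simp]: "a \<in> eobjs C" "b \<in> eobjs C"
    have [simp]: "\<theta> c \<in> arrs V" "src V (\<theta> c) = \<one>\<^bsub>V\<^esub>" "trg V (\<theta> c) = ehom D (fobj F c) (fobj G c)"
      if "c \<in> {a, b}" for c
      using \<theta>[of c] that by (auto simp: F.D.und_iso_iff)
    have "inv_arr V (runit V (ehom C a b)) \<cdot>\<^bsub>V\<^esub> (farr F a b \<otimes>\<^bsub>V\<^esub> \<theta> b) \<cdot>\<^bsub>V\<^esub>
        ecmp D (fobj F a) (fobj F b) (fobj G b) = farr F a b \<cdot>\<^bsub>V\<^esub> F.D.post (fobj F a) (fobj F b) (fobj G b) (\<theta> b)"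
      by (simp add: F.C.tarr_split F.C.ri_def[symmetric] F.D.post_def)
    also have "\<dots> = farr G a b \<cdot>\<^bsub>V\<^esub> F.D.pre (fobj F a) (fobj G a) (fobj G b) (\<theta> a)"
      by (rule nat) simp_all
    also have "\<dots> = inv_arr V (lunit V (ehom C a b)) \<cdot>\<^bsub>V\<^esub> (\<theta> a \<otimes>\<^bsub>V\<^esub> farr G a b) \<cdot>\<^bsub>V\<^esub>
        ecmp D (fobj F a) (fobj G a) (fobj G b)"
      by (simp add: F.C.tarr_split' F.C.li_def[symmetric] F.D.pre_def del: F.C.whisker_swap F.C.whisker_swap')
    finally show "inv_arr V (runit V (ehom C a b)) \<cdot>\<^bsub>V\<^esub> (farr F a b \<otimes>\<^bsub>V\<^esub> \<theta> b) \<cdot>\<^bsub>V\<^esub>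
        ecmp D (fobj F a) (fobj F b) (fobj G b) =
      inv_arr V (lunit V (ehom C a b)) \<cdot>\<^bsub>V\<^esub> (\<theta> a \<otimes>\<^bsub>V\<^esub> farr G a b) \<cdot>\<^bsub>V\<^esub>
        ecmp D (fobj F a) (fobj G a) (fobj G b)" .
  qed (rule \<theta>)
qed

locale fully_faithful_functor = enriched_functor V C D F
  for V :: "('o, 'm) closed_monoidal_category" (structure) and C D F +
  assumes farr_iso: "a \<in> eobjs C \<Longrightarrow> b \<in> eobjs C \<Longrightarrow> is_iso V (farr F a b)"
begin

definition farr_inv where "farr_inv a b = inv_arr V (farr F a b)"

lemma farr_inv [simp]:
  assumes "a \<in> eobjs C" "b \<in> eobjs C"
  shows "farr_inv a b \<in> arrs V" "src V (farr_inv a b) = ehom D (fobj F a) (fobj F b)"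
    "trg V (farr_inv a b) = ehom C a b"
    "farr F a b \<cdot> farr_inv a b = \<i>\<d> (ehom C a b)"
    "farr_inv a b \<cdot> farr F a b = \<i>\<d> (ehom D (fobj F a) (fobj F b))"
  using C.iso_simps[OF farr_iso[OF assms]] assms by (simp_all add: farr_inv_def)

lemmas farr_inv_extend [simp] = farr_inv(4,5)[THEN C.cmp_extend]
  farr_inv(4,5)[THEN C.lw_cong] farr_inv(4,5)[THEN C.rw_cong]
  farr_inv(4,5)[THEN C.lw_cong, THEN C.cmp_extend] farr_inv(4,5)[THEN C.rw_cong, THEN C.cmp_extend]

lemma farr_inj:
  assumes "f \<cdot> farr F a b = g \<cdot> farr F a b" "a \<in> eobjs C" "b \<in> eobjs C" "f \<in> arrs V" "g \<in> arrs V"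
    "trg V f = ehom C a b" "trg V g = ehom C a b"
  shows "f = g"
  by (rule C.iso_cancel_right[OF farr_iso assms(1)]) (use assms in simp_all)

text \<open>The inverse in \<open>D\<close> is pulled back along the invertible hom action, and the
  inverse laws are checked after applying \<open>F\<close>.\<close>

lemma und_iso_reflect:
  assumes [simp]: "a \<in> eobjs C" "b \<in> eobjs C" "f \<in> arrs V" "src V f = \<one>" "trg V f = ehom C a b"
    and f: "und_iso V D (fobj F a) (fobj F b) (f \<cdot> farr F a b)"
  shows "und_iso V C a b f"
proof -
  obtain e where [simp]: "e \<in> arrs V" "src V e = \<one>" "trg V e = ehom D (fobj F b) (fobj F a)"
    and e: "f \<cdot> farr F a b \<cdot> D.post (fobj F a) (fobj F b) (fobj F a) e = eid D (fobj F a)"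
      "e \<cdot> D.post (fobj F b) (fobj F a) (fobj F b) (f \<cdot> farr F a b) = eid D (fobj F b)"
    using f by (auto simp: D.und_iso_iff)
  have "f \<cdot> C.post a b a (e \<cdot> farr_inv b a) = eid C a"
    by (rule farr_inj[of _ a a]) (use e in \<open>simp_all add: post_farr farr_eid\<close>)
  moreover have "e \<cdot> farr_inv b a \<cdot> C.post b a b f = eid C b"
    by (rule farr_inj[of _ b b]) (use e in \<open>simp_all add: post_farr farr_eid\<close>)
  ultimately show ?thesis
    by (auto simp: C.und_iso_iff intro!: exI[of _ "e \<cdot> farr_inv b a"])
qed

text \<open>Preimages of objects are chosen by essential surjectivity; hom objects are transported
  along the chosen isomorphisms and then through the inverse of \<open>farr F\<close>.\<close>

lemma witnesses_equivalence:
  assumes ess_surj: "\<And>x. x \<in> eobjs D \<Longrightarrow> \<exists>a \<in> eobjs C. \<exists>e. und_iso V D (fobj F a) x e"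
  shows "witnesses_equivalence V C D F"
proof -
  have "\<exists>a e e'. a \<in> eobjs C \<and> e \<in> arrs V \<and> src V e = \<one> \<and> trg V e = ehom D (fobj F a) x \<and>
      e' \<in> arrs V \<and> src V e' = \<one> \<and> trg V e' = ehom D x (fobj F a) \<and>
      e \<cdot> D.post (fobj F a) x (fobj F a) e' = eid D (fobj F a) \<and>
      e' \<cdot> D.post x (fobj F a) x e = eid D x" if "x \<in> eobjs D" for x
    using ess_surj[OF that] that by (auto simp: D.und_iso_iff)
  then obtain g \<theta> \<theta>' where *: "g x \<in> eobjs C \<and> \<theta> x \<in> arrs V \<and> src V (\<theta> x) = \<one> \<and>
      trg V (\<theta> x) = ehom D (fobj F (g x)) x \<and>
      \<theta>' x \<in> arrs V \<and> src V (\<theta>' x) = \<one> \<and> trg V (\<theta>' x) = ehom D x (fobj F (g x)) \<and>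
      \<theta> x \<cdot> D.post (fobj F (g x)) x (fobj F (g x)) (\<theta>' x) = eid D (fobj F (g x)) \<and>
      \<theta>' x \<cdot> D.post x (fobj F (g x)) x (\<theta> x) = eid D x" if "x \<in> eobjs D" for x
    by metis
  have [simp]: "g x \<in> eobjs C" "\<theta> x \<in> arrs V" "src V (\<theta> x) = \<one>" "trg V (\<theta> x) = ehom D (fobj F (g x)) x"
    "\<theta>' x \<in> arrs V" "src V (\<theta>' x) = \<one>" "trg V (\<theta>' x) = ehom D x (fobj F (g x))" if "x \<in> eobjs D" for x
    using *[OF that] by simp_all
  have inv: "\<theta> x \<cdot> D.post (fobj F (g x)) x (fobj F (g x)) (\<theta>' x) = eid D (fobj F (g x))"
    "\<theta>' x \<cdot> D.post x (fobj F (g x)) x (\<theta> x) = eid D x" if "x \<in> eobjs D" for x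
    using *[OF that] by simp_all
  let ?pre = "\<lambda>x y. D.pre (fobj F (g x)) x y (\<theta> x)"
  let ?post = "\<lambda>a y. D.post a y (fobj F (g y)) (\<theta>' y)"
  \<comment> \<open>Conjugation from \<open>ehom D x y\<close> to
    \<open>ehom D (fobj F (g x)) (fobj F (g y))\<close> by the chosen isomorphisms.\<close>
  define k where "k x y = ?pre x y \<cdot> ?post (fobj F (g x)) y" for x y
  define G where "G = \<lparr>fobj = g, farr = \<lambda>x y. k x y \<cdot> farr_inv (g x) (g y)\<rparr>"
  have k [simp]: "k x y \<in> arrs V" "src V (k x y) = ehom D x y" "trg V (k x y) = ehom D (fobj F (g x)) (fobj F (g y))"
    if "x \<in> eobjs D" "y \<in> eobjs D" for x y
    using that by (simp_all add: k_def)
  have k_post: "k x y \<cdot> D.post (fobj F (g x)) (fobj F (g y)) y (\<theta> y) = ?pre x y"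
    if [simp]: "x \<in> eobjs D" "y \<in> eobjs D" for x y
    by (simp add: k_def D.post_post inv D.post_eid)
  have k_eid: "eid D x \<cdot> k x x = eid D (fobj F (g x))" if [simp]: "x \<in> eobjs D" for x
    using C.cmp_extend[OF D.eid_post(2)[of "fobj F (g x)" x "\<theta> x"], of "?post (fobj F (g x)) x"]
    by (simp add: k_def inv)
  have k_ecmp: "ecmp D x y z \<cdot> k x z =
      C.rw (k x y) (ehom D y z) \<cdot> (C.lw (ehom D (fobj F (g x)) (fobj F (g y))) (k y z) \<cdot>
        ecmp D (fobj F (g x)) (fobj F (g y)) (fobj F (g z)))"
    if [simp]: "x \<in> eobjs D" "y \<in> eobjs D" "z \<in> eobjs D" for x y z
  proof -
    let ?Fx = "fobj F (g x)" and ?Fy = "fobj F (g y)" and ?Fz = "fobj F (g z)"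
    \<comment> \<open>In the product of \<open>k x y\<close> and \<open>k y z\<close> the middle
      pair \<open>\<theta>' y\<close>, \<open>\<theta> y\<close> must cancel. With the
      \<open>pre\<close> of \<open>k y z\<close> written last, \<open>post_ecmp\<close> brings
      \<open>\<theta>' y\<close> next to \<open>\<theta> y\<close>.\<close>
    have kyz: "k y z = ?post y z \<cdot> ?pre y ?Fz"
      unfolding k_def by (rule D.pre_post[symmetric]) simp_all
    have "\<theta> y \<cdot> D.pre y ?Fy y (\<theta>' y) = eid D y"
      using D.und_cmp_pre[of y ?Fy y "\<theta>' y" "\<theta> y"] inv[of y] by simp
    then have "?pre y ?Fz \<cdot> D.pre y ?Fy ?Fz (\<theta>' y) = \<i>\<d> (ehom D y ?Fz)"
      by (simp add: D.pre_pre D.pre_eid)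
    then have kp: "k y z \<cdot> D.pre y ?Fy ?Fz (\<theta>' y) = ?post y z"
      by (simp add: kyz)
    have "C.rw (k x y) (ehom D y z) \<cdot> (C.lw (ehom D ?Fx ?Fy) (k y z) \<cdot> ecmp D ?Fx ?Fy ?Fz) =
        C.rw (?pre x y) (ehom D y z) \<cdot> (C.lw (ehom D ?Fx y) (k y z) \<cdot>
          (C.rw (?post ?Fx y) (ehom D ?Fy ?Fz) \<cdot> ecmp D ?Fx ?Fy ?Fz))"
      by (simp add: k_def[of x y])
    also have "\<dots> = C.rw (?pre x y) (ehom D y z) \<cdot> (C.lw (ehom D ?Fx y) (k y z \<cdot> D.pre y ?Fy ?Fz (\<theta>' y)) \<cdot>
          ecmp D ?Fx y ?Fz)"
      by (simp add: D.post_ecmp)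
    also have "\<dots> = C.rw (?pre x y) (ehom D y z) \<cdot> (ecmp D ?Fx y z \<cdot> ?post ?Fx z)"
      by (simp add: kp D.ecmp_post)
    also have "\<dots> = ecmp D x y z \<cdot> k x z"
      using C.cmp_extend[OF D.ecmp_pre[of ?Fx x y z "\<theta> x"], of "?post ?Fx z"] by (simp add: k_def)
    finally show ?thesis ..
  qed
  have G: "enriched_functor V D C G"
  proof unfold_locales
    fix x y z assume [simp]: "x \<in> eobjs D" "y \<in> eobjs D" "z \<in> eobjs D"
    show "eid D x \<cdot> farr G x x = eid C (fobj G x)"
      using C.cmp_extend[OF k_eid[of x], of "farr_inv (g x) (g x)"]
        C.cmp_extend[OF farr_eid[of "g x"], of "farr_inv (g x) (g x)"] by (simp add: G_def)
    show "ecmp D x y z \<cdot> farr G x z =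
        (farr G x y \<otimes> farr G y z) \<cdot> ecmp C (fobj G x) (fobj G y) (fobj G z)"
      by (rule farr_inj[of _ "g x" "g z"])
        (simp_all add: G_def k_ecmp farr_ecmp' C.tarr_split)
  qed (simp_all add: G_def hom_def)
  interpret G: enriched_functor V D C G by (rule G)
  \<comment> \<open>The preimage under \<open>F\<close> of the isomorphism
    \<open>\<theta> (fobj F a)\<close>; its invertibility and naturality are both deduced from those
    in \<open>D\<close>.\<close>
  define \<psi> where "\<psi> a = \<theta> (fobj F a) \<cdot> farr_inv (g (fobj F a)) a" for a
  have [simp]: "\<psi> a \<in> arrs V" "src V (\<psi> a) = \<one>" "trg V (\<psi> a) = ehom C (g (fobj F a)) a" if "a \<in> eobjs C" for a
    using that by (simp_all add: \<psi>_def)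
  have \<psi>_farr: "\<psi> a \<cdot> farr F (g (fobj F a)) a = \<theta> (fobj F a)" if "a \<in> eobjs C" for a
    using that by (simp add: \<psi>_def)
  have \<theta>_iso: "und_iso V D (fobj F (g x)) x (\<theta> x)" if [simp]: "x \<in> eobjs D" for x
    using inv[of x] by (auto simp: D.und_iso_iff intro!: exI[of _ "\<theta>' x"])
  have "enriched_nat_iso V D D (cmp_functor V G F) (id_functor V D) \<theta>"
  proof (rule enriched_nat_isoI)
    show "enriched_functor V D D (cmp_functor V G F)"
      using G by (rule enriched_functor_cmp) unfold_locales
    show "enriched_functor V D D (id_functor V D)"
      by (rule enriched_functor_id) unfold_locales
  qed (simp_all add: cmp_functor_def id_functor_def G_def \<theta>_iso k_post)
  moreover have "enriched_nat_iso V C C (cmp_functor V F G) (id_functor V C) \<psi>"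
  proof (rule enriched_nat_isoI)
    show "enriched_functor V C C (cmp_functor V F G)"
      by (rule enriched_functor_cmp[OF _ G]) unfold_locales
    show "enriched_functor V C C (id_functor V C)"
      by (rule enriched_functor_id) unfold_locales
    fix a b assume [simp]: "a \<in> eobjs C" "b \<in> eobjs C"
    show "und_iso V C (fobj (cmp_functor V F G) a) (fobj (id_functor V C) a) (\<psi> a)"
      using und_iso_reflect[of "g (fobj F a)" a "\<psi> a"] \<theta>_iso[of "fobj F a"]
      by (simp add: \<psi>_farr cmp_functor_def id_functor_def G_def)
    show "farr (cmp_functor V F G) a b \<cdot>
        C.post (fobj (cmp_functor V F G) a) (fobj (cmp_functor V F G) b) (fobj (id_functor V C) b) (\<psi> b) =
      farr (id_functor V C) a b \<cdot>
        C.pre (fobj (cmp_functor V F G) a) (fobj (id_functor V C) a) (fobj (id_functor V C) b) (\<psi> a)"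
      by (rule farr_inj[of _ "g (fobj F a)" b])
        (simp_all add: cmp_functor_def id_functor_def G_def post_farr pre_farr \<psi>_farr k_post)
  qed
  ultimately show ?thesis
    unfolding witnesses_equivalence_def using G enriched_functor_axioms by blast
qed

end

section \<open>Comparison morphisms\<close>

locale fully_faithful_tensored = fully_faithful_functor V C D F + S: tensoring V C S + T: tensoring V D T
  for V :: "('o, 'm) closed_monoidal_category" (structure) and C D F S T
begin

text \<open>
  The comparison \<open>\<mu>\<close> is universal among underlying arrows into objects in the image of \<open>F\<close>: here \<open>l\<close>
  factors the given isomorphism \<open>e\<close> through \<open>\<mu>\<close>, and uniqueness shows that \<open>m\<close> is a two-sided inverse.
\<close>

lemma tensored_functor:
  assumes *: "\<And>c v. c \<in> eobjs C \<Longrightarrow> v \<in> objs V \<Longrightarrow>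
    \<exists>b \<in> eobjs C. \<exists>e. und_iso V D (act T (fobj F c) v) (fobj F b) e"
  shows "tensored_functor V C S D T F"
proof unfold_locales
  fix c v assume [simp]: "c \<in> eobjs C" "v \<in> objs V"
  let ?c = "act S c v" and ?Fc = "fobj F c" and ?Fc' = "fobj F (act S c v)" and ?y = "act T (fobj F c) v"
  let ?\<eta> = "tunit V C S c v" and ?\<eta>' = "tunit V D T ?Fc v"
  define \<mu> where "\<mu> = comparison V C S D T F c v"
  have [simp]: "\<mu> \<in> arrs V" "src V \<mu> = \<one>" "trg V \<mu> = ehom D ?y ?Fc'"
    by (simp_all add: \<mu>_def comparison_def)
  have \<mu>: "?\<eta>' \<cdot> D.post ?Fc ?y ?Fc' \<mu> = ?\<eta> \<cdot> farr F c ?c"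
    unfolding \<mu>_def comparison_def by (rule T.tunit_post_tmate) simp_all
  obtain b e e' where [simp]: "b \<in> eobjs C" "e \<in> arrs V" "src V e = \<one>" "trg V e = ehom D ?y (fobj F b)"
    "e' \<in> arrs V" "src V e' = \<one>" "trg V e' = ehom D (fobj F b) ?y"
    and e: "e \<cdot> D.post ?y (fobj F b) ?y e' = eid D ?y"
    using *[of c v] by (auto simp: D.und_iso_iff)
  \<comment> \<open>The unit \<open>?\<eta>'\<close> followed by \<open>e\<close> lands in
    \<open>ehom D ?Fc (fobj F b)\<close>, a hom object between images of \<open>F\<close>; full
    faithfulness moves it to \<open>C\<close>, where \<open>S\<close> can transpose it.\<close>
  define k where "k = tmate V C S c v b (?\<eta>' \<cdot> D.post ?Fc ?y (fobj F b) e \<cdot> farr_inv c b)"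
  have [simp]: "k \<in> arrs V" "src V k = \<one>" "trg V k = ehom C ?c b"
    by (simp_all add: k_def)
  have k: "?\<eta> \<cdot> C.post c ?c b k = ?\<eta>' \<cdot> D.post ?Fc ?y (fobj F b) e \<cdot> farr_inv c b"
    unfolding k_def by (rule S.tunit_post_tmate) simp_all
  define l where "l = k \<cdot> farr F ?c b"
  have [simp]: "l \<in> arrs V" "src V l = \<one>" "trg V l = ehom D ?Fc' (fobj F b)"
    by (simp_all add: l_def)
  have \<mu>l: "\<mu> \<cdot> D.post ?y ?Fc' (fobj F b) l = e"
  proof (rule T.tunit_post_inj[of ?Fc v "fobj F b"])
    have "?\<eta>' \<cdot> D.post ?Fc ?y (fobj F b) (\<mu> \<cdot> D.post ?y ?Fc' (fobj F b) l) =
        ?\<eta>' \<cdot> (D.post ?Fc ?y ?Fc' \<mu> \<cdot> D.post ?Fc ?Fc' (fobj F b) l)"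
      by (simp add: D.post_post)
    also have "\<dots> = ?\<eta> \<cdot> farr F c ?c \<cdot> D.post ?Fc ?Fc' (fobj F b) l"
      using C.cmp_extend[OF \<mu>, of "D.post ?Fc ?Fc' (fobj F b) l"] by simp
    also have "\<dots> = ?\<eta> \<cdot> C.post c ?c b k \<cdot> farr F c b"
      by (simp add: post_farr l_def)
    also have "\<dots> = ?\<eta>' \<cdot> D.post ?Fc ?y (fobj F b) e"
      unfolding k by simp
    finally show "?\<eta>' \<cdot> D.post ?Fc ?y (fobj F b) (\<mu> \<cdot> D.post ?y ?Fc' (fobj F b) l) = ?\<eta>' \<cdot> D.post ?Fc ?y (fobj F b) e" .
  qed simp_all
  define m where "m = l \<cdot> D.post ?Fc' (fobj F b) ?y e'"
  have [simp]: "m \<in> arrs V" "src V m = \<one>" "trg V m = ehom D ?Fc' ?y"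
    by (simp_all add: m_def)
  have 1: "\<mu> \<cdot> D.post ?y ?Fc' ?y m = eid D ?y"
    using C.cmp_extend[OF \<mu>l, of "D.post ?y (fobj F b) ?y e'"] e by (simp add: m_def D.post_post[symmetric])
  define p where "p = m \<cdot> D.post ?Fc' ?y ?Fc' \<mu>"
  have [simp]: "p \<in> arrs V" "src V p = \<one>" "trg V p = ehom D ?Fc' ?Fc'"
    by (simp_all add: p_def)
  have "\<mu> \<cdot> D.post ?y ?Fc' ?Fc' p = \<mu> \<cdot> D.post ?y ?Fc' ?y m \<cdot> D.post ?y ?y ?Fc' \<mu>"
    by (simp add: p_def D.post_post)
  also have "\<dots> = \<mu>"
    unfolding 1 by simp
  finally have \<mu>p: "\<mu> \<cdot> D.post ?y ?Fc' ?Fc' p = \<mu>" .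
  \<comment> \<open>\<open>p\<close> is an endomorphism of an object in the image of
    \<open>F\<close>, so it comes from \<open>C\<close>. There the unit of \<open>S\<close>
    determines it, and \<open>\<mu>p\<close> shows that it acts on that unit as the identity
    does.\<close>
  have "p \<cdot> farr_inv ?c ?c = eid C ?c"
  proof (rule S.tunit_post_inj[of c v ?c])
    show "?\<eta> \<cdot> C.post c ?c ?c (p \<cdot> farr_inv ?c ?c) = ?\<eta> \<cdot> C.post c ?c ?c (eid C ?c)"
    proof (rule farr_inj[of _ c ?c])
      have "?\<eta> \<cdot> C.post c ?c ?c (p \<cdot> farr_inv ?c ?c) \<cdot> farr F c ?c = ?\<eta> \<cdot> farr F c ?c \<cdot> D.post ?Fc ?Fc' ?Fc' p"
        by (simp add: post_farr)
      also have "\<dots> = ?\<eta>' \<cdot> D.post ?Fc ?y ?Fc' \<mu> \<cdot> D.post ?Fc ?Fc' ?Fc' p"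
        unfolding \<mu> ..
      also have "\<dots> = ?\<eta>' \<cdot> D.post ?Fc ?y ?Fc' \<mu>"
        by (simp add: D.post_post \<mu>p)
      finally show "?\<eta> \<cdot> C.post c ?c ?c (p \<cdot> farr_inv ?c ?c) \<cdot> farr F c ?c =
          ?\<eta> \<cdot> C.post c ?c ?c (eid C ?c) \<cdot> farr F c ?c"
        by (simp add: \<mu> C.post_eid)
    qed simp_all
  qed simp_all
  then have "p \<cdot> farr_inv ?c ?c \<cdot> farr F ?c ?c = eid D ?Fc'"
    by (simp only: farr_eid S.act_obj \<open>c \<in> eobjs C\<close> \<open>v \<in> objs V\<close>)
  then have 2: "p = eid D ?Fc'"
    by simp
  show "und_iso V D ?y ?Fc' (comparison V C S D T F c v)"
    unfolding \<mu>_def[symmetric] using 1 2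
    by (auto simp: D.und_iso_iff p_def intro!: exI[of _ m])
qed

end

section \<open>Underlying arrows of Kleisli categories\<close>

context kleisli_category
begin

text \<open>
  \<open>point i j\<close> identifies the arrows \<open>U i \<rightarrow> P (cl i) (cl j) (U j)\<close> with the underlying arrows of \<open>E\<close>;
  composition becomes Kleisli composition, with \<open>kl\<close> the extension at the parameter \<open>\<one>\<close>.
\<close>

definition point where "point i j f = mate V (U i) \<one> (P (cl i) (cl j) (U j)) (ru (U i) \<cdot> f)"

definition kl where
  "kl i j k g = ri (P (cl i) (cl j) (U j)) \<cdot> ext (cl i) (cl j) (cl k) (U j) \<one> (U k) (ru (U j) \<cdot> g)"

lemma kl_typing [simp]:
  assumes "i \<in> I" "j \<in> I" "k \<in> I" "g \<in> arrs V" "src V g = U j" "trg V g = P (cl j) (cl k) (U k)"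
  shows "kl i j k g \<in> arrs V" "src V (kl i j k g) = P (cl i) (cl j) (U j)" "trg V (kl i j k g) = P (cl i) (cl k) (U k)"
  using assms by (simp_all add: kl_def)

lemma point_typing [simp]:
  assumes "i \<in> I" "j \<in> I" "f \<in> arrs V" "src V f = U i" "trg V f = P (cl i) (cl j) (U j)"
  shows "point i j f \<in> arrs V" "src V (point i j f) = \<one>" "trg V (point i j f) = ehom E i j"
  using assms by (simp_all add: point_def)

lemma point_post:
  assumes [simp]: "i \<in> I" "j \<in> I" "k \<in> I" "f \<in> arrs V" "src V f = U i" "trg V f = P (cl i) (cl j) (U j)"
    "g \<in> arrs V" "src V g = U j" "trg V g = P (cl j) (cl k) (U k)"
  shows "point i j f \<cdot> E.post i j k (point j k g) = point i k (f \<cdot> kl i j k g)"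
  by (rule ev_inj[where u = "U i" and v = "P (cl i) (cl k) (U k)"])
    (simp_all add: point_def kl_def E.post_def)

lemma point_surj:
  assumes [simp]: "i \<in> I" "j \<in> I" "h \<in> arrs V" "src V h = \<one>" "trg V h = ehom E i j"
  shows "\<exists>f. f \<in> arrs V \<and> src V f = U i \<and> trg V f = P (cl i) (cl j) (U j) \<and> h = point i j f"
proof (intro exI conjI)
  let ?f = "ri (U i) \<cdot> (lw (U i) h \<cdot> ev V (U i) (P (cl i) (cl j) (U j)))"
  show "h = point i j ?f"
    by (rule ev_inj[where u = "U i" and v = "P (cl i) (cl j) (U j)"]) (simp_all add: point_def)
qed simp_all

lemma point_eq_iff:
  assumes [simp]: "i \<in> I" "j \<in> I" "f \<in> arrs V" "src V f = U i" "trg V f = P (cl i) (cl j) (U j)"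
    "g \<in> arrs V" "src V g = U i" "trg V g = P (cl i) (cl j) (U j)"
  shows "point i j f = point i j g \<longleftrightarrow> f = g"
proof
  assume eq: "point i j f = point i j g"
  have "lw (U i) (point i j h) \<cdot> ev V (U i) (P (cl i) (cl j) (U j)) = ru (U i) \<cdot> h" if "h \<in> {f, g}" for h
    using that by (auto simp: point_def)
  from this[of f] this[of g] have "ru (U i) \<cdot> f = ru (U i) \<cdot> g"
    by (simp add: eq)
  then show "f = g"
    by (rule iso_cancel_left[OF runit_iso[of "U i"], rotated]) simp_all
qed simp

lemma und_iso_point:
  assumes [simp]: "i \<in> I" "j \<in> I" "f \<in> arrs V" "src V f = U i" "trg V f = P (cl i) (cl j) (U j)"
  shows "und_iso V E i j (point i j f) \<longleftrightarrow> (\<exists>g. g \<in> arrs V \<and> src V g = U j \<and> trg V g = P (cl j) (cl i) (U i) \<and>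
    f \<cdot> kl i j i g = unt (cl i) (U i) \<and> g \<cdot> kl j i j f = unt (cl j) (U j))"
proof -
  have eid: "eid E k = point k k (unt (cl k) (U k))" if "k \<in> {i, j}" for k
    using that by (auto simp: point_def)
  have "point i j f \<cdot> E.post i j i (point j i g) = eid E i \<longleftrightarrow> f \<cdot> kl i j i g = unt (cl i) (U i)"
    "point j i g \<cdot> E.post j i j (point i j f) = eid E j \<longleftrightarrow> g \<cdot> kl j i j f = unt (cl j) (U j)"
    if [simp]: "g \<in> arrs V" "src V g = U j" "trg V g = P (cl j) (cl i) (U i)" for g
    using eid[of i] eid[of j] by (simp_all add: point_post point_eq_iff del: eid_E)
  note * = this
  show ?thesis
  proof
    assume "und_iso V E i j (point i j f)"
    then obtain h where h: "h \<in> arrs V" "src V h = \<one>" "trg V h = ehom E j i"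
      "point i j f \<cdot> E.post i j i h = eid E i" "h \<cdot> E.post j i j (point i j f) = eid E j"
      by (subst (asm) E.und_iso_iff) (auto simp del: eid_E)
    then obtain g where "g \<in> arrs V" "src V g = U j" "trg V g = P (cl j) (cl i) (U i)" "h = point j i g"
      using point_surj[of j i h] by auto
    then show "\<exists>g. g \<in> arrs V \<and> src V g = U j \<and> trg V g = P (cl j) (cl i) (U i) \<and>
        f \<cdot> kl i j i g = unt (cl i) (U i) \<and> g \<cdot> kl j i j f = unt (cl j) (U j)"
      using h *[of g] by auto
  next
    assume "\<exists>g. g \<in> arrs V \<and> src V g = U j \<and> trg V g = P (cl j) (cl i) (U i) \<and>
        f \<cdot> kl i j i g = unt (cl i) (U i) \<and> g \<cdot> kl j i j f = unt (cl j) (U j)"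
    then obtain g where "g \<in> arrs V" "src V g = U j" "trg V g = P (cl j) (cl i) (U i)"
        "f \<cdot> kl i j i g = unt (cl i) (U i)" "g \<cdot> kl j i j f = unt (cl j) (U j)"
      by blast
    then show "und_iso V E i j (point i j f)"
      using *[of g] by (subst E.und_iso_iff) (auto simp del: eid_E ehom_E intro!: exI[of _ "point j i g"])
  qed
qed

lemma unt_kl:
  assumes [simp]: "i \<in> I" "j \<in> I" "k \<in> I" "a \<in> A" and cl_eq [simp]: "cl i = a" "cl j = a"
    and [simp]: "f \<in> arrs V" "src V f = U j" "trg V f = P a (cl k) (U k)"
  shows "unt a (U j) \<cdot> kl i j k f = f"
proof -
  \<comment> \<open>Naturality of \<open>ri\<close> places the monad unit directly in front of the
    extension with parameter \<open>\<one>\<close>, where \<open>unt_ext\<close> applies.\<close>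
  have "unt a (U j) \<cdot> kl i j k f = ri (U j) \<cdot> rw (unt a (U j)) \<one> \<cdot> ext a a (cl k) (U j) \<one> (U k) (ru (U j) \<cdot> f)"
    by (simp add: kl_def)
  then show ?thesis
    by (simp del: ri_nat structure_nat_extend)
qed

text \<open>The functor \<open>h \<mapsto> h \<cdot> unt\<close> from \<open>V\<close> to Kleisli
  arrows preserves isomorphisms. It is meant for \<open>h = lu u\<close>, to remove the unit factor
  from \<open>(a, \<one> \<odot> u)\<close>.\<close>

lemma und_iso_same_class:
  assumes [simp]: "i \<in> I" "j \<in> I" and cl_eq: "cl i = cl j"
    and h: "is_iso V h" "src V h = U i" "trg V h = U j"
  shows "und_iso V E i j (point i j (h \<cdot> unt (cl j) (U j)))"
proof -
  let ?h = "inv_arr V h"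
  note [simp] = cl_eq h(2,3) iso_simps[OF h(1)] iso_simps(4,5)[OF h(1), THEN cmp_extend]
  have "h \<cdot> unt (cl j) (U j) \<cdot> kl i j i (?h \<cdot> unt (cl j) (U i)) = unt (cl i) (U i)"
    "?h \<cdot> unt (cl j) (U i) \<cdot> kl j i j (h \<cdot> unt (cl j) (U j)) = unt (cl j) (U j)"
    by (simp_all add: unt_kl)
  then show ?thesis
    by (subst und_iso_point) (auto intro!: exI[of _ "?h \<cdot> unt (cl j) (U i)"])
qed

end

context kleisli_tensoring
begin

text \<open>As \<open>tiso\<close> is currying, transposing a curried arrow returns the uncurried
  arrow, read as an underlying arrow.\<close>

lemma tmate_mate:
  assumes [simp]: "i \<in> I" "j \<in> I" "v \<in> objs V" "f \<in> arrs V" "src V f = U i \<odot> v" "trg V f = P (cl i) (cl j) (U j)"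
  shows "tmate V E T i v j (mate V (U i) v (P (cl i) (cl j) (U j)) f) = point (act T i v) j f"
proof -
  let ?t = "ihom_tensor V (U i) v (P (cl i) (cl j) (U j))"
  have "point (act T i v) j f \<cdot> ?t = mate V v \<one> (ihom V (U i) (P (cl i) (cl j) (U j)))
      (ru v \<cdot> mate V (U i) v (P (cl i) (cl j) (U j)) f)"
    by (rule ev_inj2[where u = "U i" and v = v and x = "P (cl i) (cl j) (U j)"]) (simp_all add: point_def)
  then have "tmate V E T i v j (mate V (U i) v (P (cl i) (cl j) (U j)) f) =
      point (act T i v) j f \<cdot> ?t \<cdot> inv_arr V ?t"
    by (simp add: tmate_def)
  also have "\<dots> = point (act T i v) j f"
    using iso_simps[OF ihom_tensor_iso[of "U i" v "P (cl i) (cl j) (U j)"]] by simp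
  finally show ?thesis .
qed

end

context closed_monoidal_category
begin

lemma self_tensoring_act: "act (self_tensoring V) u v = u \<odot> v"
  by (simp add: self_tensoring_def)

lemma tmate_self:
  assumes "u \<in> objs V" "v \<in> objs V" "x \<in> objs V" "f \<in> arrs V" "src V f = u \<odot> v" "trg V f = x"
  shows "tmate V (self_enriched V) (self_tensoring V) u v x (mate V u v x f) =
    mate V (u \<odot> v) \<one> x (ru (u \<odot> v) \<cdot> f)"
  using kleisli_tensoring.tmate_mate[OF kleisli_tensoring_self, of u x v f] assms
  by (simp add: kleisli_category.point_def[OF kleisli_category_self] self_tensoring_act)

text \<open>For the identity monad \<open>kl\<close> returns the arrow itself, so Kleisli inverses
  are inverses in \<open>V\<close>.\<close>

lemma und_iso_self_iff:
  assumes [simp]: "w \<in> objs V" "x \<in> objs V" "f \<in> arrs V" "src V f = w" "trg V f = x"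
  shows "und_iso V (self_enriched V) w x (mate V w \<one> x (ru w \<cdot> f)) \<longleftrightarrow> is_iso V f"
proof -
  have "is_iso V f \<longleftrightarrow> (\<exists>g. g \<in> arrs V \<and> src V g = x \<and> trg V g = w \<and> f \<cdot> g = \<i>\<d> w \<and> g \<cdot> f = \<i>\<d> x)"
    by (simp add: is_iso_def inverse_arrows_def hom_def conj_assoc)
  moreover have "ri w \<cdot> (ru w \<cdot> g) = g" if "g \<in> arrs V" "src V g = w" "w \<in> objs V" for w g
    using that by simp
  ultimately show ?thesis
    using kleisli_category.und_iso_point[OF kleisli_category_self, of w x f]
    by (simp add: kleisli_category.point_def[OF kleisli_category_self]
        kleisli_category.kl_def[OF kleisli_category_self] cong: conj_cong)
qed

end

section \<open>The equivalences\<close>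

context tensoring
begin

definition rep_comparison where "rep_comparison a c v = lw (ehom C a c) (tunit V C T c v) \<cdot> ecmp C a c (act T c v)"

lemma rep_comparison_typing [simp]:
  assumes "a \<in> eobjs C" "c \<in> eobjs C" "v \<in> objs V"
  shows "rep_comparison a c v \<in> arrs V" "src V (rep_comparison a c v) = ehom C a c \<odot> v" "trg V (rep_comparison a c v) = ehom C a (act T c v)"
  using assms by (simp_all add: rep_comparison_def)

text \<open>Naturality of the comparison in \<open>a\<close>, from associativity in
  \<open>C\<close>; it relates the comparisons at different \<open>a\<close> in both directions of
  (1) and (2).\<close>

lemma ecmp_rep_comparison:
  assumes "a \<in> eobjs C" "b \<in> eobjs C" "c \<in> eobjs C" "v \<in> objs V"
  shows "rw (ecmp C a b c) v \<cdot> rep_comparison a c v =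
    as (ehom C a b) (ehom C b c) v \<cdot> (lw (ehom C a b) (rep_comparison b c v) \<cdot> ecmp C a b (act T c v))"
proof -
  have "rw (ecmp C a b c) v \<cdot> rep_comparison a c v = rw (ecmp C a b c) v \<cdot> lw (ehom C a c) (tunit V C T c v) \<cdot> ecmp C a c (act T c v)"
    using assms by (simp add: rep_comparison_def)
  also have "rw (ecmp C a b c) v \<cdot> lw (ehom C a c) (tunit V C T c v) =
      lw (ehom C a b \<odot> ehom C b c) (tunit V C T c v) \<cdot> rw (ecmp C a b c) (ehom C c (act T c v))"
    using assms by simp
  also have "\<dots> \<cdot> ecmp C a c (act T c v) =
      lw (ehom C a b \<odot> ehom C b c) (tunit V C T c v) \<cdot> (rw (ecmp C a b c) (ehom C c (act T c v)) \<cdot> ecmp C a c (act T c v))"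
    using assms by (intro cmp_assoc') simp_all
  finally show ?thesis
    using assms by (simp add: rep_comparison_def)
qed

text \<open>The Yoneda counterpart of \<open>ecmp_rep_comparison\<close>: at the identity of
  \<open>c\<close>, the left unit law lets the comparison return the tensoring unit.\<close>

lemma eid_rep_comparison:
  assumes "c \<in> eobjs C" "v \<in> objs V"
  shows "rw (eid C c) v \<cdot> rep_comparison c c v = lu v \<cdot> tunit V C T c v"
proof -
  have "rw (eid C c) v \<cdot> rep_comparison c c v = rw (eid C c) v \<cdot> lw (ehom C c c) (tunit V C T c v) \<cdot> ecmp C c c (act T c v)"
    using assms by (simp add: rep_comparison_def)
  also have "rw (eid C c) v \<cdot> lw (ehom C c c) (tunit V C T c v) =
      lw \<one> (tunit V C T c v) \<cdot> rw (eid C c) (ehom C c (act T c v))"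
    using assms by simp
  also have "\<dots> \<cdot> ecmp C c c (act T c v) =
      lw \<one> (tunit V C T c v) \<cdot> (rw (eid C c) (ehom C c (act T c v)) \<cdot> ecmp C c c (act T c v))"
    using assms by (intro cmp_assoc') simp_all
  finally show ?thesis
    using assms by simp
qed

text \<open>Naturality of \<open>mate\<close> writes the unit followed by the hom action of the
  representable as the mate of \<open>rep_comparison\<close>; transposing in the self-enrichment
  uncurries it again.\<close>

lemma representable_tensored_iff:
  assumes a [simp]: "a \<in> eobjs C"
  shows "tensored_functor V C T (self_enriched V) (self_tensoring V) (representable V C a) \<longleftrightarrow>
    (\<forall>c \<in> eobjs C. \<forall>v \<in> objs V. is_iso V (rep_comparison a c v))"
proof -
  have "und_iso V (self_enriched V) (act (self_tensoring V) (fobj (representable V C a) c) v)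
      (fobj (representable V C a) (act T c v))
      (comparison V C T (self_enriched V) (self_tensoring V) (representable V C a) c v) \<longleftrightarrow>
    is_iso V (rep_comparison a c v)" if [simp]: "c \<in> eobjs C" "v \<in> objs V" for c v
  proof -
    have "tunit V C T c v \<cdot> farr (representable V C a) c (act T c v) =
        mate V (ehom C a c) v (ehom C a (act T c v)) (rep_comparison a c v)"
      by (simp add: representable_def rep_comparison_def mate_lw)
    then show ?thesis
      by (simp add: comparison_def representable_def self_tensoring_act tmate_self und_iso_self_iff)
  qed
  moreover have "tensored_functor V C T (self_enriched V) (self_tensoring V) (representable V C a) \<longleftrightarrow>
    tensored_functor_axioms V C T (self_enriched V) (self_tensoring V) (representable V C a)"
    unfolding tensored_functor_def
    using tensoring_axioms tensoring_self enriched_functor_representable[OF a] by blast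
  ultimately show ?thesis
    unfolding tensored_functor_axioms_def by blast
qed

text \<open>The right-hand side states the two Kleisli equations between the unit and an inverse
  \<open>g\<close>, with unit factors removed.\<close>

lemma embedding_tensored_iff:
  "tensored_functor V C T (completion V C) (completion_tensoring V C) (completion_embedding V C) \<longleftrightarrow>
    (\<forall>c \<in> eobjs C. \<forall>v \<in> objs V. \<exists>g. g \<in> arrs V \<and> src V g = \<one> \<and> trg V g = ehom C (act T c v) c \<odot> v \<and>
      g \<cdot> rep_comparison (act T c v) c v = eid C (act T c v) \<and>
      tunit V C T c v \<cdot> (ri (ehom C c (act T c v)) \<cdot> (lw (ehom C c (act T c v)) g \<cdot>
        (ai (ehom C c (act T c v)) (ehom C (act T c v) c) v \<cdot> rw (ecmp C c (act T c v) c) v))) =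
      li v \<cdot> rw (eid C c) v)"
proof -
  interpret K: kleisli_tensoring V "eobjs C" completion_P completion_unt completion_ext "eobjs C \<times> objs V" fst snd
    "completion V C" "completion_tensoring V C"
    by (rule kleisli_tensoring_completion)
  let ?I = "completion_embedding V C"
  have "und_iso V (completion V C) (act (completion_tensoring V C) (fobj ?I c) v) (fobj ?I (act T c v))
      (comparison V C T (completion V C) (completion_tensoring V C) ?I c v) \<longleftrightarrow>
    (\<exists>g. g \<in> arrs V \<and> src V g = \<one> \<and> trg V g = ehom C (act T c v) c \<odot> v \<and>
      g \<cdot> rep_comparison (act T c v) c v = eid C (act T c v) \<and>
      tunit V C T c v \<cdot> (ri (ehom C c (act T c v)) \<cdot> (lw (ehom C c (act T c v)) g \<cdot>
        (ai (ehom C c (act T c v)) (ehom C (act T c v) c) v \<cdot> rw (ecmp C c (act T c v) c) v))) =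
      li v \<cdot> rw (eid C c) v)" (is "_ \<longleftrightarrow> ?R") if [simp]: "c \<in> eobjs C" "v \<in> objs V" for c v
  proof -
    let ?c = "act T c v" and ?\<eta> = "tunit V C T c v"
    let ?x = "ehom C c ?c" and ?y = "ehom C ?c c"
    \<comment> \<open>The unit \<open>?\<eta>\<close> padded by unitors, since the objects compared
      are \<open>(c, \<one> \<odot> v)\<close> and \<open>(?c, \<one>)\<close>.\<close>
    define f where "f = lw \<one> ?\<eta> \<cdot> (lu ?x \<cdot> ri ?x)"
    have [simp]: "f \<in> arrs V" "src V f = \<one> \<odot> v" "trg V f = ?x \<odot> \<one>"
      by (simp_all add: f_def)
    have "?\<eta> \<cdot> farr ?I c ?c = mate V \<one> v (?x \<odot> \<one>) f"
      unfolding f_def by (subst mate_lw) (simp_all add: completion_embedding_def ri_def[symmetric])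
    then have "comparison V C T (completion V C) (completion_tensoring V C) ?I c v =
        K.point (c, \<one> \<odot> v) (?c, \<one>) f"
      using K.tmate_mate[of "(c, \<one>)" "(?c, \<one>)" v f]
      by (simp add: comparison_def completion_embedding_def completion_tensoring_def completion_P_def)
    then have "und_iso V (completion V C) (act (completion_tensoring V C) (fobj ?I c) v) (fobj ?I (act T c v))
      (comparison V C T (completion V C) (completion_tensoring V C) ?I c v) \<longleftrightarrow>
      (\<exists>g0. g0 \<in> arrs V \<and> src V g0 = \<one> \<and> trg V g0 = ?y \<odot> (\<one> \<odot> v) \<and>
        f \<cdot> K.kl (c, \<one> \<odot> v) (?c, \<one>) (c, \<one> \<odot> v) g0 = completion_unt c (\<one> \<odot> v) \<and>
        g0 \<cdot> K.kl (?c, \<one>) (c, \<one> \<odot> v) (?c, \<one>) f = completion_unt ?c \<one>)"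
      using K.und_iso_point[of "(c, \<one> \<odot> v)" "(?c, \<one>)" f]
      by (simp add: completion_embedding_def completion_tensoring_def completion_P_def)
    also have "\<dots> \<longleftrightarrow> ?R"
    proof -
      let ?X = "\<lambda>g. ?\<eta> \<cdot> (ri ?x \<cdot> (lw ?x g \<cdot> (ai ?x ?y v \<cdot> rw (ecmp C c ?c c) v)))"
      \<comment> \<open>A Kleisli inverse \<open>g0\<close> has target
        \<open>?y \<odot> (\<one> \<odot> v)\<close>; \<open>lw ?y (lu v)\<close> turns it into the
        \<open>g\<close> of the statement. \<open>A\<close> treats the equation at the source of the
        comparison, \<open>B\<close> the one at its target.\<close>
      have A: "f \<cdot> K.kl (c, \<one> \<odot> v) (?c, \<one>) (c, \<one> \<odot> v) g0 = completion_unt c (\<one> \<odot> v) \<longleftrightarrow>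
          ?X (g0 \<cdot> lw ?y (lu v)) = li v \<cdot> rw (eid C c) v" (is "?l = ?r \<longleftrightarrow> ?l' = ?r'")
        if [simp]: "g0 \<in> arrs V" "src V g0 = \<one>" "trg V g0 = ?y \<odot> (\<one> \<odot> v)" for g0
      proof -
        let ?L = "lw (ehom C c c) (lu v)"
        have [simp]: "?l \<in> arrs V" "src V ?l = \<one> \<odot> v" "trg V ?l = ehom C c c \<odot> (\<one> \<odot> v)"
          "?r \<in> arrs V" "src V ?r = \<one> \<odot> v" "trg V ?r = ehom C c c \<odot> (\<one> \<odot> v)"
          by (simp_all add: K.kl_def completion_ext_def completion_unt_def completion_P_def)
        have L: "?l \<cdot> ?L = lu v \<cdot> ?l'"
          by (simp add: f_def K.kl_def completion_ext_def completion_P_def)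
        have "rw (eid C c) (\<one> \<odot> v) \<cdot> ?L = lw \<one> (lu v) \<cdot> rw (eid C c) v"
          by simp
        then have R: "?r \<cdot> ?L = lu v \<cdot> ?r'"
          by (simp add: completion_unt_def del: whisker_swap whisker_swap')
        show ?thesis
        proof
          assume "?l = ?r"
          then have "lu v \<cdot> ?l' = lu v \<cdot> ?r'"
            using L R by metis
          then show "?l' = ?r'"
            by (rule iso_cancel_left[OF lunit_iso[OF \<open>v \<in> objs V\<close>]]) simp_all
        next
          assume "?l' = ?r'"
          then have "?l \<cdot> ?L = ?r \<cdot> ?L"
            using L R by metis
          then show "?l = ?r"
            by (rule iso_cancel_right[OF lw_iso[OF lunit_iso[OF \<open>v \<in> objs V\<close>]], rotated]) simp_all
        qed
      qed
      have B: "g0 \<cdot> K.kl (?c, \<one>) (c, \<one> \<odot> v) (?c, \<one>) f = completion_unt ?c \<one> \<longleftrightarrow>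
          g0 \<cdot> lw ?y (lu v) \<cdot> rep_comparison ?c c v = eid C ?c"
        if [simp]: "g0 \<in> arrs V" "src V g0 = \<one>" "trg V g0 = ?y \<odot> (\<one> \<odot> v)" for g0
      proof -
        have "lw ?y (lw \<one> ?\<eta>) \<cdot> lw ?y (lu ?x) = lw ?y (lu v) \<cdot> lw ?y ?\<eta>"
          using lw_cong[OF lu_nat[of ?\<eta> ?x], of ?y] by simp
        from cmp_extend[OF this]
        have "g0 \<cdot> K.kl (?c, \<one>) (c, \<one> \<odot> v) (?c, \<one>) f = g0 \<cdot> lw ?y (lu v) \<cdot> rep_comparison ?c c v \<cdot> ri (ehom C ?c ?c)"
          by (simp add: f_def rep_comparison_def K.kl_def completion_ext_def completion_P_def)
        moreover have "completion_unt ?c \<one> = eid C ?c \<cdot> ri (ehom C ?c ?c)"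
          by (simp add: completion_unt_def li_one)
        moreover have "g0 \<cdot> lw ?y (lu v) \<cdot> rep_comparison ?c c v \<cdot> ri (ehom C ?c ?c) = eid C ?c \<cdot> ri (ehom C ?c ?c) \<longleftrightarrow>
            g0 \<cdot> lw ?y (lu v) \<cdot> rep_comparison ?c c v = eid C ?c" (is "?l \<cdot> ?ri = ?r \<cdot> ?ri \<longleftrightarrow> _")
        proof
          assume "?l \<cdot> ?ri = ?r \<cdot> ?ri"
          then show "?l = ?r"
            by (rule iso_cancel_right[OF ri_iso, rotated]) simp_all
        qed (simp only:)
        ultimately show ?thesis
          by (simp only:)
      qed
      show ?thesis
      proof
        assume "\<exists>g0. g0 \<in> arrs V \<and> src V g0 = \<one> \<and> trg V g0 = ?y \<odot> (\<one> \<odot> v) \<and>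
          f \<cdot> K.kl (c, \<one> \<odot> v) (?c, \<one>) (c, \<one> \<odot> v) g0 = completion_unt c (\<one> \<odot> v) \<and>
          g0 \<cdot> K.kl (?c, \<one>) (c, \<one> \<odot> v) (?c, \<one>) f = completion_unt ?c \<one>"
        then obtain g0 where g0: "g0 \<in> arrs V" "src V g0 = \<one>" "trg V g0 = ?y \<odot> (\<one> \<odot> v)"
          "f \<cdot> K.kl (c, \<one> \<odot> v) (?c, \<one>) (c, \<one> \<odot> v) g0 = completion_unt c (\<one> \<odot> v)"
          "g0 \<cdot> K.kl (?c, \<one>) (c, \<one> \<odot> v) (?c, \<one>) f = completion_unt ?c \<one>"
          by blast
        show ?R
          using A[OF g0(1-3)] B[OF g0(1-3)] g0
          by (intro exI[of _ "g0 \<cdot> lw ?y (lu v)"] conjI) (simp_all del: whisker_cmp cmp_assoc')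
      next
        assume ?R
        then obtain g where g: "g \<in> arrs V" "src V g = \<one>" "trg V g = ?y \<odot> v"
          "g \<cdot> rep_comparison ?c c v = eid C ?c" "?X g = li v \<cdot> rw (eid C c) v"
          by blast
        have g': "g \<cdot> lw ?y (li v) \<cdot> lw ?y (lu v) = g"
          using g(1-3) by simp
        have t: "g \<cdot> lw ?y (li v) \<in> arrs V" "src V (g \<cdot> lw ?y (li v)) = \<one>" "trg V (g \<cdot> lw ?y (li v)) = ?y \<odot> (\<one> \<odot> v)"
          using g(1-3) by simp_all
        show "\<exists>g0. g0 \<in> arrs V \<and> src V g0 = \<one> \<and> trg V g0 = ?y \<odot> (\<one> \<odot> v) \<and>
          f \<cdot> K.kl (c, \<one> \<odot> v) (?c, \<one>) (c, \<one> \<odot> v) g0 = completion_unt c (\<one> \<odot> v) \<and>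
          g0 \<cdot> K.kl (?c, \<one>) (c, \<one> \<odot> v) (?c, \<one>) f = completion_unt ?c \<one>"
          using A[OF t, unfolded g'] B[OF t, unfolded g'] g(4,5) t by blast
      qed
    qed
    finally show ?thesis .
  qed
  moreover have "tensored_functor V C T (completion V C) (completion_tensoring V C) ?I \<longleftrightarrow>
    tensored_functor_axioms V C T (completion V C) (completion_tensoring V C) ?I"
    unfolding tensored_functor_def
    using tensoring_axioms K.tensoring_E enriched_functor_embedding by blast
  ultimately show ?thesis
    unfolding tensored_functor_axioms_def by blast
qed

lemma representables_tensored_iff_embedding_tensored:
  "(\<forall>a \<in> eobjs C. tensored_functor V C T (self_enriched V) (self_tensoring V) (representable V C a)) \<longleftrightarrow>
    tensored_functor V C T (completion V C) (completion_tensoring V C) (completion_embedding V C)"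
proof
  assume "\<forall>a \<in> eobjs C. tensored_functor V C T (self_enriched V) (self_tensoring V) (representable V C a)"
  then have iso: "is_iso V (rep_comparison a c v)" if "a \<in> eobjs C" "c \<in> eobjs C" "v \<in> objs V" for a c v
    using that by (auto simp: representable_tensored_iff)
  show "tensored_functor V C T (completion V C) (completion_tensoring V C) (completion_embedding V C)"
    unfolding embedding_tensored_iff
  proof (intro ballI)
    fix c v assume [simp]: "c \<in> eobjs C" "v \<in> objs V"
    let ?c = "act T c v" and ?\<eta> = "tunit V C T c v"
    let ?x = "ehom C c ?c" and ?y = "ehom C ?c c"
    define g where "g = eid C ?c \<cdot> inv_arr V (rep_comparison ?c c v)"
    have [simp]: "is_iso V (rep_comparison ?c c v)"
      by (rule iso) simp_all
    note [simp] = iso_simps[OF this]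
    have [simp]: "g \<in> arrs V" "src V g = \<one>" "trg V g = ?y \<odot> v"
      by (simp_all add: g_def)
    have g: "g \<cdot> rep_comparison ?c c v = eid C ?c"
      by (simp add: g_def)
    \<comment> \<open>The second Kleisli equation is tested against the comparison at
      \<open>a = c\<close>, also invertible by assumption. By \<open>ecmp_rep_comparison\<close> and
      \<open>g\<close> one side reduces to \<open>?\<eta>\<close>, by
      \<open>eid_rep_comparison\<close> the other.\<close>
    have "?\<eta> \<cdot> (ri ?x \<cdot> (lw ?x g \<cdot> (ai ?x ?y v \<cdot> rw (ecmp C c ?c c) v))) \<cdot> rep_comparison c c v =
        ?\<eta> \<cdot> (ri ?x \<cdot> (lw ?x (g \<cdot> rep_comparison ?c c v) \<cdot> ecmp C c ?c ?c))"
      by (simp add: ecmp_rep_comparison)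
    also have "\<dots> = li v \<cdot> rw (eid C c) v \<cdot> rep_comparison c c v"
      by (simp add: g eid_rep_comparison)
    finally have "?\<eta> \<cdot> (ri ?x \<cdot> (lw ?x g \<cdot> (ai ?x ?y v \<cdot> rw (ecmp C c ?c c) v))) = li v \<cdot> rw (eid C c) v"
      by (rule iso_cancel_right[OF iso[OF \<open>c \<in> eobjs C\<close> \<open>c \<in> eobjs C\<close> \<open>v \<in> objs V\<close>]]) simp_all
    with g show "\<exists>g. g \<in> arrs V \<and> src V g = \<one> \<and> trg V g = ?y \<odot> v \<and> g \<cdot> rep_comparison ?c c v = eid C ?c \<and>
        ?\<eta> \<cdot> (ri ?x \<cdot> (lw ?x g \<cdot> (ai ?x ?y v \<cdot> rw (ecmp C c ?c c) v))) = li v \<cdot> rw (eid C c) v"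
      by (auto intro!: exI[of _ g])
  qed
next
  assume tens: "tensored_functor V C T (completion V C) (completion_tensoring V C) (completion_embedding V C)"
  have "is_iso V (rep_comparison a c v)" if [simp]: "a \<in> eobjs C" "c \<in> eobjs C" "v \<in> objs V" for a c v
  proof -
    let ?c = "act T c v" and ?\<eta> = "tunit V C T c v"
    let ?x = "ehom C c ?c" and ?y = "ehom C ?c c" and ?z = "ehom C a ?c" and ?w = "ehom C a c"
    obtain g where [simp]: "g \<in> arrs V" "src V g = \<one>" "trg V g = ?y \<odot> v"
      and g: "g \<cdot> rep_comparison ?c c v = eid C ?c"
      and \<eta>: "?\<eta> \<cdot> (ri ?x \<cdot> (lw ?x g \<cdot> (ai ?x ?y v \<cdot> rw (ecmp C c ?c c) v))) = li v \<cdot> rw (eid C c) v"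
      using tens[unfolded embedding_tensored_iff, rule_format, OF \<open>c \<in> eobjs C\<close> \<open>v \<in> objs V\<close>] by blast
    define k where "k = ri ?z \<cdot> (lw ?z g \<cdot> (ai ?z ?y v \<cdot> rw (ecmp C a ?c c) v))"
    have [simp]: "k \<in> arrs V" "src V k = ?z" "trg V k = ?w \<odot> v"
      by (simp_all add: k_def)
    have "k \<cdot> rep_comparison a c v = ri ?z \<cdot> (lw ?z (g \<cdot> rep_comparison ?c c v) \<cdot> ecmp C a ?c ?c)"
      by (simp add: k_def ecmp_rep_comparison)
    then have 1: "k \<cdot> rep_comparison a c v = \<i>\<d> ?z"
      by (simp add: g)
    let ?m = "ecmp C a c ?c"
    \<comment> \<open>Slides \<open>g\<close> in front of \<open>?m\<close>, so that
      \<open>?m\<close> and the composition inside \<open>k\<close> become adjacent and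
      associativity can act on them.\<close>
    have "?m \<cdot> (ri ?z \<cdot> lw ?z g) = ri (?w \<odot> ?x) \<cdot> (lw (?w \<odot> ?x) g \<cdot> rw ?m (?y \<odot> v))"
      by simp
    from cmp_extend3[OF this, of "ai ?z ?y v \<cdot> rw (ecmp C a ?c c) v"]
    have "rep_comparison a c v \<cdot> k = lw ?w ?\<eta> \<cdot> (ri (?w \<odot> ?x) \<cdot> (lw (?w \<odot> ?x) g \<cdot>
        (ai (?w \<odot> ?x) ?y v \<cdot> (rw (rw ?m ?y) v \<cdot> rw (ecmp C a ?c c) v))))"
      by (simp add: rep_comparison_def k_def del: whisker_swap whisker_swap')
    \<comment> \<open>Associativity of \<open>C\<close> and a pentagon pull out \<open>?w\<close>,
      so that the equation \<open>\<eta>\<close> applies under \<open>lw ?w\<close>; the right unit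
      law of \<open>C\<close> leaves the identity.\<close>
    also have "\<dots> = lw ?w (?\<eta> \<cdot> (ri ?x \<cdot> (lw ?x g \<cdot> (ai ?x ?y v \<cdot> rw (ecmp C c ?c c) v)))) \<cdot>
        (ai ?w (ehom C c c) v \<cdot> rw (ecmp C a c c) v)"
    proof -
      have "lw ?w (ecmp C c ?c c) \<cdot> ecmp C a c c = ai ?w ?x ?y \<cdot> (rw ?m ?y \<cdot> ecmp C a ?c c)"
        by simp
      from rw_cong[OF this, of v]
      have "rw (lw ?w (ecmp C c ?c c)) v \<cdot> rw (ecmp C a c c) v =
          rw (ai ?w ?x ?y) v \<cdot> (rw (rw ?m ?y) v \<cdot> rw (ecmp C a ?c c) v)"
        by (simp del: ecmp_laws ecmp_laws_extend)
      then show ?thesis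
        by (simp add: pentagon_forms(3)[THEN cmp_extend3] del: ecmp_laws ecmp_laws_extend)
    qed
    also have "\<dots> = \<i>\<d> (?w \<odot> v)"
      unfolding \<eta> by simp
    finally have "rep_comparison a c v \<cdot> k = \<i>\<d> (?w \<odot> v)" .
    with 1 show ?thesis
      by (intro is_isoI[of _ k]) simp_all
  qed
  then show "\<forall>a \<in> eobjs C. tensored_functor V C T (self_enriched V) (self_tensoring V) (representable V C a)"
    by (auto simp: representable_tensored_iff)
qed

lemma embedding_tensored_iff_equivalence:
  "tensored_functor V C T (completion V C) (completion_tensoring V C) (completion_embedding V C) \<longleftrightarrow>
    witnesses_equivalence V C (completion V C) (completion_embedding V C)"
proof -
  let ?I = "completion_embedding V C"
  interpret K: kleisli_tensoring V "eobjs C" completion_P completion_unt completion_ext "eobjs C \<times> objs V" fst snd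
    "completion V C" "completion_tensoring V C"
    by (rule kleisli_tensoring_completion)
  interpret I: enriched_functor V C "completion V C" ?I
    by (rule enriched_functor_embedding)
  interpret I: fully_faithful_tensored V C "completion V C" ?I T "completion_tensoring V C"
    by (intro fully_faithful_tensored.intro fully_faithful_functor.intro fully_faithful_functor_axioms.intro
      I.enriched_functor_axioms embedding_iso tensoring_axioms K.tensoring_E)
  show ?thesis
  proof
    assume "tensored_functor V C T (completion V C) (completion_tensoring V C) ?I"
    then interpret tensored_functor V C T "completion V C" "completion_tensoring V C" ?I .
    show "witnesses_equivalence V C (completion V C) ?I"
    proof (rule I.witnesses_equivalence)
      fix x assume "x \<in> eobjs (completion V C)"
      then obtain a u where x: "x = (a, u)" and [simp]: "a \<in> eobjs C" "u \<in> objs V"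
        by auto
      have "act (completion_tensoring V C) (fobj ?I a) u = (a, \<one> \<odot> u)"
        by (simp add: completion_tensoring_def completion_embedding_def)
      then obtain e where "und_iso V (completion V C) (fobj ?I (act T a u)) (a, \<one> \<odot> u) e"
        using comparison_iso[of a u] K.E.und_iso_sym[of "(a, \<one> \<odot> u)" "fobj ?I (act T a u)"]
        by (auto simp: completion_embedding_def)
      moreover have "und_iso V (completion V C) (a, \<one> \<odot> u) (a, u) (K.point (a, \<one> \<odot> u) (a, u) (lu u \<cdot> completion_unt a u))"
        using K.und_iso_same_class[of "(a, \<one> \<odot> u)" "(a, u)" "lu u"] lunit_iso by simp
      ultimately have "\<exists>e. und_iso V (completion V C) (fobj ?I (act T a u)) x e"
        using K.E.und_iso_trans[of "fobj ?I (act T a u)" "(a, \<one> \<odot> u)" "(a, u)"]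
        by (auto simp: x completion_embedding_def)
      then show "\<exists>a \<in> eobjs C. \<exists>e. und_iso V (completion V C) (fobj ?I a) x e"
        using act_obj[OF \<open>a \<in> eobjs C\<close> \<open>u \<in> objs V\<close>] by blast
    qed
  next
    assume "witnesses_equivalence V C (completion V C) ?I"
    then obtain G \<theta> where "enriched_nat_iso V (completion V C) (completion V C) (cmp_functor V G ?I)
        (id_functor V (completion V C)) \<theta>" and G: "enriched_functor V (completion V C) C G"
      unfolding witnesses_equivalence_def by blast
    then interpret \<theta>: enriched_nat_iso V "completion V C" "completion V C" "cmp_functor V G ?I"
        "id_functor V (completion V C)" \<theta>
      by simp
    show "tensored_functor V C T (completion V C) (completion_tensoring V C) ?I"
    proof (rule I.tensored_functor)
      fix c v assume [simp]: "c \<in> eobjs C" "v \<in> objs V"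
      let ?y = "act (completion_tensoring V C) (fobj ?I c) v"
      have y: "?y \<in> eobjs (completion V C)"
        using K.act_T[of "fobj ?I c" v] by (simp add: completion_embedding_def)
      have Gy: "fobj G ?y \<in> eobjs C"
        using enriched_functor.fobj_obj[OF G y] .
      \<comment> \<open>The quasi-inverse supplies the required object: \<open>?y\<close> is
        isomorphic to the image of \<open>fobj G ?y\<close>.\<close>
      have "und_iso V (completion V C) (fobj ?I (fobj G ?y)) ?y (\<theta> ?y)"
        using \<theta>.component_iso[OF y] by (simp add: cmp_functor_def id_functor_def)
      then show "\<exists>b \<in> eobjs C. \<exists>e. und_iso V (completion V C) ?y (fobj ?I b) e"
        using K.E.und_iso_sym[OF I.fobj_obj[OF Gy] y] Gy by blast
    qed
  qed
qed

end

theorem theorem1p6: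
  fixes V :: "('o, 'm) closed_monoidal_category"
    and C :: "('a, 'o, 'm) enriched_category"
    and T :: "('a, 'o, 'm) tensoring"
  assumes "closed_monoidal_category V"
    and "enriched_category V C"
    and "tensoring V C T"
  shows "((\<forall>a \<in> eobjs C.
            tensored_functor V C T (self_enriched V) (self_tensoring V) (representable V C a))
          \<longleftrightarrow> tensored_functor V C T (completion V C) (completion_tensoring V C)
                (completion_embedding V C))
      \<and> (tensored_functor V C T (completion V C) (completion_tensoring V C)
            (completion_embedding V C)
          \<longleftrightarrow> witnesses_equivalence V C (completion V C) (completion_embedding V C))"
  using tensoring.representables_tensored_iff_embedding_tensored[OF assms(3)]
    tensoring.embedding_tensored_iff_equivalence[OF assms(3)] by blast

end
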